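(* Let $\Gamma=\mathrm{SL}(2,\mathbb{Z})$ and suppose (H1)--(H3) and $\kappa_\rho^{(1)}\in\mathbb{Z}$ hold for the MODE $y'''+Q_2(z)y'+Q_3(z)y=0$ on $\Gamma$. Then the following two conditions are equivalent: (3) $\{3\kappa_{\mathrm i}^{(1)},3\kappa_{\mathrm i}^{(2)},3\kappa_{\mathrm i}^{(3)}\}\equiv\{0,0,1\}\bmod 2$; (4) $\kappa_\rho^{(j)}\in\mathbb{Z}$ for all $j$ and $\{\kappa_\rho^{(1)},\kappa_\rho^{(2)},\kappa_\rho^{(3)}\}\equiv\{0,1,2\}\bmod 3$.
   Context: $\mathbb{H}$ is the upper half plane, $'=\frac{d}{dz}$, $\mathrm i=\sqrt{-1}$, $\rho=(-1+\sqrt3\,\mathrm i)/2$. A MODE on $\mathrm{SL}(2,\mathbb{Z})$ is an equation $y'''+Q_2(z)y'+Q_3(z)y=0$ on $\mathbb{H}$ such that $Q_2$ and $Q_3-\frac12Q_2'$ are meromorphic modular forms on $\mathrm{SL}(2,\mathbb{Z})$ of weights $4$ and $6$. Singular points are the poles of $Q_2,Q_3$. If $Q_j(z)=A_j(z-z_0)^{-j}+O((z-z_0)^{-j+1})$, the local exponents $\kappa_{z_0}^{(1)}\le\kappa_{z_0}^{(2)}\le\kappa_{z_0}^{(3)}$ at $z_0\in\mathbb{H}$ are the roots of $\kappa(\kappa-1)(\kappa-2)+A_2\kappa+A_3=0$ (so $0,1,2$ at a regular point). The local exponents $\kappa_\infty^{(1)}\le\kappa_\infty^{(2)}\le\kappa_\infty^{(3)}$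 at the cusp $\infty$ are the roots of $\kappa^3+(2\pi \mathrm i)^{-2}Q_2(\infty)\kappa+(2\pi \mathrm i)^{-3}Q_3(\infty)=0$. A singular point is apparent if no solution has a logarithmic singularity there. Conditions: (H1) The equation is Fuchsian on $\mathbb{H}\cup\{\infty\}$: poles of $Q_j$ in $\mathbb{H}$ have order at most $j$, and $Q_2,Q_3$ are holomorphic at $\infty$. (H2) At any singular point $z_0\in\mathbb{H}$, $\kappa_{z_0}^{(1)}<\kappa_{z_0}^{(2)}<\kappa_{z_0}^{(3)}$ satisfy $\kappa_{z_0}^{(1)}\in\frac13\mathbb{Z}_{\le0}$, $\kappa_{z_0}^{(j)}-\kappa_{z_0}^{(1)}\in\mathbb{Z}$ for $j=2,3$, and $z_0$ is apparent. (H3) $\kappa_\infty^{(1)}\in\frac13\mathbb{Z}_{\le0}$ and $\kappa_\infty^{(j)}-\kappa_\infty^{(1)}\in\mathbb{Z}$ for $j=2,3$. Congruences of sets are congruences of multisets, up to reordering. *)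

theory Defs
  imports
    "HOL-Complex_Analysis.Complex_Analysis"
    "HOL-Library.Landau_Symbols"
    "HOL-Library.Multiset"
    "HOL-Library.Real_Mod"
begin

definition upper_half_plane :: "complex set" where
  "upper_half_plane = {z. Im z > 0}"

definition rho :: complex where
  "rho = (-1 + of_real (sqrt 3) * \<i>) / 2"

text \<open>
  The library predicate \<^const>\<open>meromorphic_on\<close> does not constrain the values on a sparse set
  of points (at poles or removable singularities), so identities between meromorphic functions
  are required outside a sparse set, i.e. as identities of meromorphic functions.
\<close>

text \<open>\<open>F\<close> expresses \<open>f\<close> near the cusp in terms of the local coordinate \<open>q = exp (2 \<pi> \<i> z)\<close>.\<close>

definition q_function :: "(complex \<Rightarrow> complex) \<Rightarrow> (complex \<Rightarrow> complex) \<Rightarrow> bool" where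
  "q_function f F \<longleftrightarrow>
     (\<exists>Y>0. \<forall>\<^sub>\<approx>z\<in>{z. Im z > Y}. f z = F (exp (2 * of_real pi * \<i> * z)))"

definition meromorphic_at_cusp :: "(complex \<Rightarrow> complex) \<Rightarrow> bool" where
  "meromorphic_at_cusp f \<longleftrightarrow> (\<exists>F. F meromorphic_on {0} \<and> q_function f F)"

definition holomorphic_at_cusp :: "(complex \<Rightarrow> complex) \<Rightarrow> bool" where
  "holomorphic_at_cusp f \<longleftrightarrow> (\<exists>F. F analytic_on {0} \<and> q_function f F)"

text \<open>The value \<open>f(\<infinity>)\<close>; meaningful if \<open>holomorphic_at_cusp f\<close>.\<close>

definition cusp_value :: "(complex \<Rightarrow> complex) \<Rightarrow> complex" where
  "cusp_value f = (THE v. \<exists>F. F analytic_on {0} \<and> q_function f F \<and> F 0 = v)"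

definition meromorphic_modular_form :: "int \<Rightarrow> (complex \<Rightarrow> complex) \<Rightarrow> bool" where
  "meromorphic_modular_form k f \<longleftrightarrow>
     f meromorphic_on upper_half_plane \<and>
     (\<forall>a b c d :: int. a * d - b * c = 1 \<longrightarrow>
        (\<forall>\<^sub>\<approx>z\<in>upper_half_plane.
           f ((of_int a * z + of_int b) / (of_int c * z + of_int d)) =
             (of_int c * z + of_int d) powi k * f z)) \<and>
     meromorphic_at_cusp f"

text \<open>The equation \<open>y''' + Q2 y' + Q3 y = 0\<close> is represented by the pair \<open>Q2\<close>, \<open>Q3\<close>.\<close>

definition MODE :: "(complex \<Rightarrow> complex) \<Rightarrow> (complex \<Rightarrow> complex) \<Rightarrow> bool" where
  "MODE Q2 Q3 \<longleftrightarrow>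
     meromorphic_modular_form 4 Q2 \<and>
     meromorphic_modular_form 6 (\<lambda>z. Q3 z - deriv Q2 z / 2)"

definition solution_on ::
    "(complex \<Rightarrow> complex) \<Rightarrow> (complex \<Rightarrow> complex) \<Rightarrow> complex set \<Rightarrow> (complex \<Rightarrow> complex) \<Rightarrow> bool" where
  "solution_on Q2 Q3 S y \<longleftrightarrow>
     y holomorphic_on S \<and>
     (\<forall>z\<in>S. (deriv ^^ 3) y z + Q2 z * deriv y z + Q3 z * y z = 0)"

definition singular_point ::
    "(complex \<Rightarrow> complex) \<Rightarrow> (complex \<Rightarrow> complex) \<Rightarrow> complex \<Rightarrow> bool" where
  "singular_point Q2 Q3 z0 \<longleftrightarrow> is_pole Q2 z0 \<or> is_pole Q3 z0"

text \<open>
  The coefficient \<open>A\<close> in \<open>Q z = A (z - z0)\<^sup>-\<^sup>j + O ((z - z0)\<^sup>-\<^sup>j\<^sup>+\<^sup>1)\<close> as \<open>z\<close> tends to \<open>z0\<close>;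
  meaningful if \<open>Q\<close> is meromorphic with a pole of order at most \<open>j\<close> at \<open>z0\<close>.
\<close>

definition polar_coeff :: "nat \<Rightarrow> (complex \<Rightarrow> complex) \<Rightarrow> complex \<Rightarrow> complex" where
  "polar_coeff j Q z0 =
     (THE A. (\<lambda>z. Q z - A * (z - z0) powi (- int j)) \<in> O[at z0](\<lambda>z. (z - z0) powi (1 - int j)))"

definition indicial_poly ::
    "(complex \<Rightarrow> complex) \<Rightarrow> (complex \<Rightarrow> complex) \<Rightarrow> complex \<Rightarrow> complex poly" where
  "indicial_poly Q2 Q3 z0 =
     [:0, 1:] * [:-1, 1:] * [:-2, 1:] + smult (polar_coeff 2 Q2 z0) [:0, 1:] + [:polar_coeff 3 Q3 z0:]"

definition cusp_indicial_poly :: "(complex \<Rightarrow> complex) \<Rightarrow> (complex \<Rightarrow> complex) \<Rightarrow> complex poly" where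
  "cusp_indicial_poly Q2 Q3 =
     [:0, 1:] ^ 3
     + smult ((2 * of_real pi * \<i>) powi (-2) * cusp_value Q2) [:0, 1:]
     + [:(2 * of_real pi * \<i>) powi (-3) * cusp_value Q3:]"

text \<open>The roots of \<open>p\<close>, with multiplicity, are real and in increasing order \<open>k1, k2, k3\<close>.\<close>

definition ordered_roots :: "complex poly \<Rightarrow> real \<Rightarrow> real \<Rightarrow> real \<Rightarrow> bool" where
  "ordered_roots p k1 k2 k3 \<longleftrightarrow>
     k1 \<le> k2 \<and> k2 \<le> k3 \<and> proots p = {#of_real k1, of_real k2, of_real k3#}"

definition local_exponents ::
    "(complex \<Rightarrow> complex) \<Rightarrow> (complex \<Rightarrow> complex) \<Rightarrow> complex \<Rightarrow> real \<Rightarrow> real \<Rightarrow> real \<Rightarrow> bool" where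
  "local_exponents Q2 Q3 z0 k1 k2 k3 \<longleftrightarrow> ordered_roots (indicial_poly Q2 Q3 z0) k1 k2 k3"

definition cusp_exponents ::
    "(complex \<Rightarrow> complex) \<Rightarrow> (complex \<Rightarrow> complex) \<Rightarrow> real \<Rightarrow> real \<Rightarrow> real \<Rightarrow> bool" where
  "cusp_exponents Q2 Q3 k1 k2 k3 \<longleftrightarrow> ordered_roots (cusp_indicial_poly Q2 Q3) k1 k2 k3"

text \<open>
  The slit is the branch cut of the principal logarithm of \<open>z - z0\<close>, so that (branches of)
  multivalued solutions on the punctured disc are holomorphic functions on the slit disc.
\<close>

definition slit_disc :: "complex \<Rightarrow> real \<Rightarrow> complex set" where
  "slit_disc z0 r = {z \<in> ball z0 r. z - z0 \<notin> \<real>\<^sub>\<le>\<^sub>0}"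

text \<open>
  At a regular singular point, every solution is a finite sum of terms
  \<open>(z - z0)\<^sup>\<alpha> (log (z - z0))\<^sup>m h(z)\<close> with \<open>h\<close> holomorphic at \<open>z0\<close> (Frobenius). It has a logarithmic
  singularity if it cannot be written without a positive power of the logarithm.
\<close>

definition logarithmic_singularity :: "complex \<Rightarrow> real \<Rightarrow> (complex \<Rightarrow> complex) \<Rightarrow> bool" where
  "logarithmic_singularity z0 r y \<longleftrightarrow>
     \<not> (\<exists>(E :: complex set) h. finite E \<and> (\<forall>\<alpha>\<in>E. h \<alpha> holomorphic_on ball z0 r) \<and>
          (\<forall>z\<in>slit_disc z0 r. y z = (\<Sum>\<alpha>\<in>E. (z - z0) powr \<alpha> * h \<alpha> z)))"

definition apparent :: "(complex \<Rightarrow> complex) \<Rightarrow> (complex \<Rightarrow> complex) \<Rightarrow> complex \<Rightarrow> bool" where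
  "apparent Q2 Q3 z0 \<longleftrightarrow>
     (\<exists>r>0. Q2 holomorphic_on (ball z0 r - {z0}) \<and> Q3 holomorphic_on (ball z0 r - {z0}) \<and>
        \<not> (\<exists>y. solution_on Q2 Q3 (slit_disc z0 r) y \<and> logarithmic_singularity z0 r y))"

definition pole_order_le :: "nat \<Rightarrow> (complex \<Rightarrow> complex) \<Rightarrow> bool" where
  "pole_order_le j Q \<longleftrightarrow> (\<forall>z\<in>upper_half_plane. is_pole Q z \<longrightarrow> - zorder Q z \<le> int j)"

definition H1 :: "(complex \<Rightarrow> complex) \<Rightarrow> (complex \<Rightarrow> complex) \<Rightarrow> bool" where
  "H1 Q2 Q3 \<longleftrightarrow>
     pole_order_le 2 Q2 \<and> pole_order_le 3 Q3 \<and> holomorphic_at_cusp Q2 \<and> holomorphic_at_cusp Q3"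

definition third_nonpos_int :: "real \<Rightarrow> bool" where
  "third_nonpos_int x \<longleftrightarrow> (\<exists>n::int. n \<le> 0 \<and> x = of_int n / 3)"

definition H2 :: "(complex \<Rightarrow> complex) \<Rightarrow> (complex \<Rightarrow> complex) \<Rightarrow> bool" where
  "H2 Q2 Q3 \<longleftrightarrow>
     (\<forall>z0\<in>upper_half_plane. singular_point Q2 Q3 z0 \<longrightarrow>
        (\<exists>k1 k2 k3. local_exponents Q2 Q3 z0 k1 k2 k3 \<and> k1 < k2 \<and> k2 < k3 \<and>
           third_nonpos_int k1 \<and> k2 - k1 \<in> \<int> \<and> k3 - k1 \<in> \<int>) \<and>
        apparent Q2 Q3 z0)"

definition H3 :: "(complex \<Rightarrow> complex) \<Rightarrow> (complex \<Rightarrow> complex) \<Rightarrow> bool" where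
  "H3 Q2 Q3 \<longleftrightarrow>
     (\<exists>k1 k2 k3. cusp_exponents Q2 Q3 k1 k2 k3 \<and>
        third_nonpos_int k1 \<and> k2 - k1 \<in> \<int> \<and> k3 - k1 \<in> \<int>)"

definition mset_cong :: "real multiset \<Rightarrow> real multiset \<Rightarrow> real \<Rightarrow> bool" where
  "mset_cong A B m \<longleftrightarrow> rel_mset (\<lambda>x y. [x = y] (rmod m)) A B"

end

theory Submission
  imports Defs
begin

text \<open>
  Bol's lemma says that the action of weight \<open>-2\<close>, \<open>y(z) \<mapsto> (c z + d)\<^sup>2 y((a z + b) / (c z + d))\<close>,
  maps solutions to solutions. At a singular point the exponents differ by integers and no
  logarithms occur, so a loop around it multiplies all solutions by the same number, a cube root of
  unity because three times an exponent is an integer. The half-plane being simply connected, the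
  ratios of solutions are single-valued, and \<open>SL(2, \<int>)\<close> acts on the solution space up to scalars.

  Let \<open>S\<close>, \<open>T\<close> and \<open>R = S T\<close> be the substitutions \<open>-1 / z\<close>, \<open>z + 1\<close> and \<open>-1 / (z + 1)\<close>, so that
  \<open>S\<close> fixes \<open>\<i>\<close> and \<open>R\<close> fixes \<open>rho\<close>. If the exponents at such a fixed point are \<open>k\<close>, \<open>k + m2\<close>,
  \<open>k + m3\<close>, the substitution acts diagonally with eigenvalues \<open>1\<close>, \<open>\<zeta>\<^sup>m\<^sup>2\<close>, \<open>\<zeta>\<^sup>m\<^sup>3\<close> up to a common factor,
  where \<open>\<zeta>\<close> is its derivative at the fixed point (\<open>eigen_germ\<close>, \<open>U_scalar\<close>). As \<open>\<zeta> = -1\<close> for \<open>S\<close> and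
  \<open>\<zeta>\<close> is a primitive cube root of unity for \<open>R\<close>, the action of \<open>S\<close> is scalar iff both gaps at \<open>\<i>\<close>
  are even, and that of \<open>R\<close> is scalar iff both gaps at \<open>rho\<close> are divisible by \<open>3\<close>. The exponents at
  each point have the sum \<open>3\<close>; therefore the congruence modulo \<open>2\<close> at \<open>\<i>\<close> says that \<open>S\<close> is not scalar
  (\<open>parity_criterion\<close>), and the congruence modulo \<open>3\<close> at \<open>rho\<close> that \<open>R\<close> is not scalar
  (\<open>mod3_criterion\<close>).

  It remains to compare \<open>S\<close> and \<open>R\<close>, and this is decided at the cusp. The exponents there differ by
  integers, so \<open>T\<close> has only one eigenvalue, although it may fail to be diagonalisable
  (\<open>multiplicative_solution\<close>). If \<open>S\<close> is scalar, then \<open>R\<close> and \<open>T\<close> agree up to a scalar, hence the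
  diagonalisable \<open>R\<close> has a single eigenvalue and is scalar too; the argument is symmetric in \<open>S\<close> and
  \<open>R\<close> (\<open>elliptic_points_agree\<close>).

  The action up to scalars is only ever evaluated on two eigenvectors. A pair \<open>(Y1, Y2)\<close> of
  solutions up to a common cube root of unity is recorded by the single-valued functions \<open>Y1\<^sup>3\<close> and
  \<open>Y1\<^sup>2 Y2\<close>, which determine the ratio of the eigenvalues. Such pairs continue from a disc to the whole
  half-plane (\<open>global_section\<close>), so a pair of eigenvectors found at one elliptic point can be followed
  to the other one and to the cusp.
\<close>

section \<open>Linear third-order equations in the complex domain\<close>

definition ode3 ::
    "(complex \<Rightarrow> complex) \<Rightarrow> (complex \<Rightarrow> complex) \<Rightarrow> (complex \<Rightarrow> complex) \<Rightarrow> complex set \<Rightarrow>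
     (complex \<Rightarrow> complex) \<Rightarrow> bool" where
  "ode3 p1 p2 p3 S y \<longleftrightarrow> y holomorphic_on S \<and>
     (\<forall>z\<in>S. (deriv ^^ 3) y z + p1 z * (deriv ^^ 2) y z + p2 z * deriv y z + p3 z * y z = 0)"

lemma higher_deriv_chain:
  assumes "open S" and z: "z \<in> S"
    and d0: "\<And>z. z \<in> S \<Longrightarrow> (y has_field_derivative y1 z) (at z)"
    and d1: "\<And>z. z \<in> S \<Longrightarrow> (y1 has_field_derivative y2 z) (at z)"
    and d2: "\<And>z. z \<in> S \<Longrightarrow> (y2 has_field_derivative y3 z) (at z)"
  shows "y holomorphic_on S" "deriv y z = y1 z" "(deriv ^^ 2) y z = y2 z" "(deriv ^^ 3) y z = y3 z"
proof -
  show "y holomorphic_on S"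
    using d0 by (meson assms(1) holomorphic_on_open)
  have e1: "deriv y z = y1 z" if "z \<in> S" for z
    using d0[OF that] by (rule DERIV_imp_deriv)
  have e2: "(deriv ^^ 2) y z = y2 z" if "z \<in> S" for z
  proof -
    have "(deriv y has_field_derivative y2 z) (at z)"
      using d1[OF that] by (rule has_field_derivative_transform_within_open[OF _ assms(1) that]) (simp add: e1)
    then show ?thesis by (simp add: numeral_2_eq_2 DERIV_imp_deriv)
  qed
  have "((deriv ^^ 2) y has_field_derivative y3 z) (at z)"
    using d2[OF z] by (rule has_field_derivative_transform_within_open[OF _ assms(1) z]) (simp add: e2)
  then have "deriv ((deriv ^^ 2) y) z = y3 z" by (rule DERIV_imp_deriv)
  then show "(deriv ^^ 3) y z = y3 z" by (simp add: numeral_3_eq_3 numeral_2_eq_2)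
  show "deriv y z = y1 z" "(deriv ^^ 2) y z = y2 z" using e1 e2 z by auto
qed

lemma ode3I:
  assumes "open S"
    and "\<And>z. z \<in> S \<Longrightarrow> (y has_field_derivative y1 z) (at z)"
    and "\<And>z. z \<in> S \<Longrightarrow> (y1 has_field_derivative y2 z) (at z)"
    and "\<And>z. z \<in> S \<Longrightarrow> (y2 has_field_derivative y3 z) (at z)"
    and "\<And>z. z \<in> S \<Longrightarrow> y3 z + p1 z * y2 z + p2 z * y1 z + p3 z * y z = 0"
  shows "ode3 p1 p2 p3 S y"
  unfolding ode3_def using higher_deriv_chain[OF assms(1) _ assms(2-4)] assms(5)
  by (metis assms(1,2) holomorphic_on_open)

lemma ode3_derivs:
  assumes "ode3 p1 p2 p3 S y" "open S" "z \<in> S"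
  shows "(y has_field_derivative deriv y z) (at z)"
    and "(deriv y has_field_derivative (deriv ^^ 2) y z) (at z)"
    and "((deriv ^^ 2) y has_field_derivative (deriv ^^ 3) y z) (at z)"
    and "(deriv ^^ 3) y z + p1 z * (deriv ^^ 2) y z + p2 z * deriv y z + p3 z * y z = 0"
proof -
  have h: "y holomorphic_on S" using assms by (simp add: ode3_def)
  show "(y has_field_derivative deriv y z) (at z)"
    using h assms holomorphic_derivI by blast
  show "(deriv y has_field_derivative (deriv ^^ 2) y z) (at z)"
    using has_field_derivative_higher_deriv[OF h assms(2,3), of 1] by (simp add: numeral_2_eq_2)
  show "((deriv ^^ 2) y has_field_derivative (deriv ^^ 3) y z) (at z)"
    using has_field_derivative_higher_deriv[OF h assms(2,3), of 2] by (simp add: numeral_3_eq_3)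
qed (use assms in \<open>auto simp: ode3_def\<close>)

lemma ode3_subset: "ode3 p1 p2 p3 S y \<Longrightarrow> T \<subseteq> S \<Longrightarrow> ode3 p1 p2 p3 T y"
  unfolding ode3_def by (meson holomorphic_on_subset subsetD)

lemma ode3_cong:
  assumes "open S" "\<And>z. z \<in> S \<Longrightarrow> p1 z = q1 z" "\<And>z. z \<in> S \<Longrightarrow> p2 z = q2 z"
    "\<And>z. z \<in> S \<Longrightarrow> p3 z = q3 z" "\<And>z. z \<in> S \<Longrightarrow> x z = y z" "ode3 p1 p2 p3 S x"
  shows "ode3 q1 q2 q3 S y"
proof -
  have hx: "x holomorphic_on S" using assms by (simp add: ode3_def)
  then have hy: "y holomorphic_on S" using assms(5) holomorphic_transform by metis
  have "(deriv ^^ i) y z = (deriv ^^ i) x z" if "z \<in> S" for i z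
    using higher_deriv_transform_within_open[OF hy hx assms(1) that] assms(5) by metis
  from this[of _ 1] this[of _ 2] this[of _ 3] show ?thesis
    using assms hy unfolding ode3_def by auto
qed

lemma ode3_pointwise:
  assumes "open S" "\<And>z. z \<in> S \<Longrightarrow> \<exists>U. open U \<and> z \<in> U \<and> ode3 p1 p2 p3 U y"
  shows "ode3 p1 p2 p3 S y"
proof -
  have "y field_differentiable at z" if "z \<in> S" for z
    using assms(2)[OF that] holomorphic_on_imp_differentiable_at unfolding ode3_def by blast
  then show ?thesis
    using assms unfolding ode3_def by (metis field_differentiable_at_within holomorphic_on_def)
qed

lemma ode3_lincomb:
  assumes "open S" "ode3 p1 p2 p3 S x" "ode3 p1 p2 p3 S y"
  shows "ode3 p1 p2 p3 S (\<lambda>z. c * x z + d * y z)"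
proof (rule ode3I[OF assms(1)])
  fix z assume z: "z \<in> S"
  note X = ode3_derivs[OF assms(2,1) z] and Y = ode3_derivs[OF assms(3,1) z]
  show "((\<lambda>z. c * x z + d * y z) has_field_derivative c * deriv x z + d * deriv y z) (at z)"
    by (intro DERIV_add DERIV_cmult X Y)
  show "((\<lambda>z. c * deriv x z + d * deriv y z) has_field_derivative
      c * (deriv ^^ 2) x z + d * (deriv ^^ 2) y z) (at z)"
    by (intro DERIV_add DERIV_cmult X Y)
  show "((\<lambda>z. c * (deriv ^^ 2) x z + d * (deriv ^^ 2) y z) has_field_derivative
      c * (deriv ^^ 3) x z + d * (deriv ^^ 3) y z) (at z)"
    by (intro DERIV_add DERIV_cmult X Y)
  have "c * (deriv ^^ 3) x z + d * (deriv ^^ 3) y z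
      + p1 z * (c * (deriv ^^ 2) x z + d * (deriv ^^ 2) y z)
      + p2 z * (c * deriv x z + d * deriv y z) + p3 z * (c * x z + d * y z)
      = c * ((deriv ^^ 3) x z + p1 z * (deriv ^^ 2) x z + p2 z * deriv x z + p3 z * x z)
      + d * ((deriv ^^ 3) y z + p1 z * (deriv ^^ 2) y z + p2 z * deriv y z + p3 z * y z)"
    by (simp add: algebra_simps)
  then show "c * (deriv ^^ 3) x z + d * (deriv ^^ 3) y z
      + p1 z * (c * (deriv ^^ 2) x z + d * (deriv ^^ 2) y z)
      + p2 z * (c * deriv x z + d * deriv y z) + p3 z * (c * x z + d * y z) = 0"
    using X(4) Y(4) by simp
qed

text \<open>Differentiating the equation repeatedly with Leibniz' rule expresses every derivative of a
  solution at a point by the first three, so vanishing initial values force all derivatives to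
  vanish.\<close>

lemma ode3_zero_initial:
  assumes "open S" "connected S" and p: "p1 holomorphic_on S" "p2 holomorphic_on S" "p3 holomorphic_on S"
    and y: "ode3 p1 p2 p3 S y" and b: "b \<in> S"
    and init: "y b = 0" "deriv y b = 0" "(deriv ^^ 2) y b = 0" and z: "z \<in> S"
  shows "y z = 0"
proof -
  have hy: "y holomorphic_on S" using y by (simp add: ode3_def)
  have hd: "(deriv ^^ j) y holomorphic_on S" for j
    by (rule holomorphic_higher_deriv[OF hy assms(1)])
  have hd1: "deriv y holomorphic_on S" using hd[of 1] by simp
  have eq: "(deriv ^^ n) ((deriv ^^ 3) y) b
      = (deriv ^^ n) (\<lambda>z. - (p1 z * (deriv ^^ 2) y z + p2 z * deriv y z + p3 z * y z)) b" for n
  proof (rule higher_deriv_transform_within_open[OF hd _ assms(1) b])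
    show "(\<lambda>z. - (p1 z * (deriv ^^ 2) y z + p2 z * deriv y z + p3 z * y z)) holomorphic_on S"
      by (intro holomorphic_intros p hd hd1 hy)
    show "(deriv ^^ 3) y w = - (p1 w * (deriv ^^ 2) y w + p2 w * deriv y w + p3 w * y w)"
      if "w \<in> S" for w
    proof -
      have "(deriv ^^ 3) y w + (p1 w * (deriv ^^ 2) y w + p2 w * deriv y w + p3 w * y w) = 0"
        using ode3_derivs(4)[OF y assms(1) that] by (simp add: add.assoc)
      then show ?thesis by (rule eq_neg_iff_add_eq_0[THEN iffD2])
    qed
  qed
  have der: "(deriv ^^ n) y b = 0" for n
  proof (induction n rule: less_induct)
    case (less n)
    consider "n = 0" | "n = 1" | "n = 2" | m where "n = m + 3"
      by (metis One_nat_def add.commute le_Suc_ex less_2_cases_iff linorder_not_less numeral_2_eq_2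
          numeral_3_eq_3 not_less_eq_eq less_Suc_eq)
    then show ?case
    proof cases
      case (4 m)
      have z0: "(deriv ^^ m) (\<lambda>w. p w * (deriv ^^ j) y w) b = 0" if "p holomorphic_on S" "j < 3" for p j
      proof -
        have "(deriv ^^ (m - i)) ((deriv ^^ j) y) b = 0" for i
        proof -
          have "(deriv ^^ (m - i + j)) y b = 0" using less 4 that by simp
          then show ?thesis by (simp add: funpow_add)
        qed
        then show ?thesis
          by (subst higher_deriv_mult[OF that(1) hd assms(1) b]) simp
      qed
      have "(deriv ^^ n) y b = (deriv ^^ m) ((deriv ^^ 3) y) b"
        unfolding 4 by (simp only: funpow_add o_apply)
      also have "\<dots> = - ((deriv ^^ m) (\<lambda>z. p1 z * (deriv ^^ 2) y z + p2 z * deriv y z + p3 z * y z) b)"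
        unfolding eq
        by (rule higher_deriv_uminus[OF _ assms(1) b]) (intro holomorphic_intros p hd hd1 hy)
      also have "(deriv ^^ m) (\<lambda>z. p1 z * (deriv ^^ 2) y z + p2 z * deriv y z + p3 z * y z) b
         = (deriv ^^ m) (\<lambda>z. p1 z * (deriv ^^ 2) y z) b + (deriv ^^ m) (\<lambda>z. p2 z * deriv y z) b
           + (deriv ^^ m) (\<lambda>z. p3 z * y z) b"
        by (subst higher_deriv_add[OF _ _ assms(1) b];
            (intro holomorphic_intros p hd hd1 hy)?)+ simp
      also have "\<dots> = 0"
        using z0[OF p(1), of 2] z0[OF p(2), of 1] z0[OF p(3), of 0] by simp
      finally show ?thesis by simp
    qed (use init in auto)
  qed
  show ?thesis
    by (rule holomorphic_fun_eq_0_on_connected[OF hy assms(1,2) der b z])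
qed

lemma ode3_unique:
  assumes "open S" "connected S" "p1 holomorphic_on S" "p2 holomorphic_on S" "p3 holomorphic_on S"
    and "ode3 p1 p2 p3 S x" "ode3 p1 p2 p3 S y" and "b \<in> S"
    and "x b = y b" "deriv x b = deriv y b" "(deriv ^^ 2) x b = (deriv ^^ 2) y b" and "z \<in> S"
  shows "x z = y z"
proof -
  have o: "ode3 p1 p2 p3 S (\<lambda>z. 1 * x z + (-1) * y z)"
    by (rule ode3_lincomb) (use assms in auto)
  have h: "x holomorphic_on S" "y holomorphic_on S" using assms by (auto simp: ode3_def)
  have "(deriv ^^ n) (\<lambda>z. x z - y z) b = (deriv ^^ n) x b - (deriv ^^ n) y b" for n
    using higher_deriv_diff[OF h assms(1,8)] .
  from this[of 0] this[of 1] this[of 2] show ?thesis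
    using ode3_zero_initial[OF assms(1-5) o assms(8) _ _ _ assms(12)] assms by simp
qed


lemma norm_primitive_le:
  assumes "convex K" "b \<in> K" "z \<in> K"
    and F: "\<And>w. w \<in> K \<Longrightarrow> (F has_field_derivative f w) (at w)" and F0: "F b = 0"
    and bound: "\<And>w. w \<in> K \<Longrightarrow> norm (f w) \<le> C * norm (w - b) ^ n"
  shows "norm (F z) \<le> C * norm (z - b) ^ Suc n / real (Suc n)"
proof -
  define p where "p = (\<lambda>t::real. b + of_real t * (z - b))"
  define m where "m = norm (z - b)"
  have pK: "p t \<in> K" if "0 \<le> t" "t \<le> 1" for t
  proof -
    have "p t = (1 - t) *\<^sub>R b + t *\<^sub>R z"
      by (simp add: p_def scaleR_conv_of_real algebra_simps)
    then show ?thesis using assms(1-3) that by (simp add: convexD_alt)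
  qed
  have p': "(p has_vector_derivative (z - b)) (at t)" for t
    unfolding p_def by (auto intro!: derivative_eq_intros simp: has_vector_derivative_def scaleR_conv_of_real)
  have Fp': "((\<lambda>t. F (p t)) has_vector_derivative (z - b) * f (p t)) (at t)" if "0 \<le> t" "t \<le> 1" for t
    using field_vector_diff_chain_at[OF p' F[OF pK[OF that]]] by (simp add: o_def)
  have \<phi>': "((\<lambda>t. C * m ^ Suc n / real (Suc n) * t ^ Suc n) has_vector_derivative
      C * m ^ Suc n * t ^ n) (at t)" for t
    unfolding has_real_derivative_iff_has_vector_derivative[symmetric]
    by (rule derivative_eq_intros refl | simp add: field_simps del: of_nat_Suc)+
  have "norm (F (p 1) - F (p 0)) \<le> C * m ^ Suc n / real (Suc n) * 1 ^ Suc n - C * m ^ Suc n / real (Suc n) * 0 ^ Suc n"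
  proof (rule differentiable_bound_general[OF _ _ _ Fp' \<phi>'])
    show "continuous_on {0..1} (\<lambda>t. F (p t))"
      by (rule continuous_at_imp_continuous_on) (use Fp' has_vector_derivative_continuous in force)
    show "continuous_on {0..1} (\<lambda>t. C * m ^ Suc n / real (Suc n) * t ^ Suc n)"
      by (intro continuous_intros) auto
    fix t :: real assume t: "0 < t" "t < 1"
    have "norm (f (p t)) \<le> C * norm (p t - b) ^ n" using bound pK t by simp
    also have "norm (p t - b) = t * m" using t by (simp add: p_def m_def norm_mult)
    finally have "m * norm (f (p t)) \<le> m * (C * (t * m) ^ n)" by (simp add: m_def mult_left_mono)
    then show "norm ((z - b) * f (p t)) \<le> C * m ^ Suc n * t ^ n"
      by (simp add: norm_mult m_def power_mult_distrib mult_ac)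
  qed auto
  then show ?thesis using F0 by (simp add: p_def m_def)
qed

text \<open>Successive approximation converges on all of a convex domain, not only near \<open>b\<close>, because the
  equation is linear.\<close>

lemma ode3_solution_exists:
  fixes S :: "complex set"
  assumes S: "open S" "convex S" and b: "b \<in> S"
    and p: "p1 holomorphic_on S" "p2 holomorphic_on S" "p3 holomorphic_on S"
  obtains y where "ode3 p1 p2 p3 S y" "y b = c0" "deriv y b = c1" "(deriv ^^ 2) y b = c2"
proof -
  define I where "I = (\<lambda>f. SOME F. F b = 0 \<and> (\<forall>z\<in>S. (F has_field_derivative f z) (at z)))"
  have I: "I f b = 0 \<and> (\<forall>z\<in>S. (I f has_field_derivative f z) (at z))" if f: "f holomorphic_on S" for f
  proof -
    obtain g where g: "\<And>x. x \<in> S \<Longrightarrow> (g has_field_derivative f x) (at x within S)"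
      using holomorphic_convex_primitive'[OF S(2,1) f] by blast
    have "\<exists>F. F b = 0 \<and> (\<forall>z\<in>S. (F has_field_derivative f z) (at z))"
    proof (intro exI[of _ "\<lambda>z. g z - g b"] conjI ballI)
      show "((\<lambda>z. g z - g b) has_field_derivative f z) (at z)" if "z \<in> S" for z
        using DERIV_diff[OF g[OF that, unfolded at_within_open[OF that S(1)]] DERIV_const[of "g b"]] by simp
    qed simp
    then show ?thesis unfolding I_def by (rule someI_ex)
  qed
  have IS: "(I f has_field_derivative f z) (at z)" if "f holomorphic_on S" "z \<in> S" for f z
    using I that by blast
  have I0: "I f b = 0" if "f holomorphic_on S" for f
    using I that by blast
  have Ih: "I f holomorphic_on S" if "f holomorphic_on S" for f
    using IS[OF that] S(1) by (meson holomorphic_on_open)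
  \<comment> \<open>The Volterra equation for the third derivative \<open>w\<close> is \<open>w = W 0 + K w\<close> with \<open>K\<close> built from
    iterated primitives; \<open>w\<close> is the Neumann series \<open>\<Sum>n. W n\<close>.\<close>
  define q where "q = (\<lambda>z. c0 + c1 * (z - b) + c2 / 2 * (z - b) ^ 2)"
  define q1 where "q1 = (\<lambda>z. c1 + c2 * (z - b))"
  define W where "W = rec_nat (\<lambda>z. - (p1 z * c2 + p2 z * q1 z + p3 z * q z))
     (\<lambda>_ w z. - (p1 z * I w z + p2 z * I (I w) z + p3 z * I (I (I w)) z))"
  have W0: "W 0 = (\<lambda>z. - (p1 z * c2 + p2 z * q1 z + p3 z * q z))"
    and WS: "W (Suc n) = (\<lambda>z. - (p1 z * I (W n) z + p2 z * I (I (W n)) z + p3 z * I (I (I (W n))) z))" for n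
    by (simp_all add: W_def)
  have Wh: "W n holomorphic_on S" for n
  proof (induction n)
    case 0 show ?case unfolding W0 q1_def q_def by (intro holomorphic_intros p)
  next
    case (Suc n) show ?case unfolding WS by (intro holomorphic_intros p Ih Suc)
  qed
  define P where "P = (\<lambda>n z. I (I (I (W n))) z)"
  define Y where "Y = (\<lambda>n z. q z + (\<Sum>k<n. P k z))"
  define Y1 where "Y1 = (\<lambda>n z. q1 z + (\<Sum>k<n. I (I (W k)) z))"
  define Y2 where "Y2 = (\<lambda>n z. c2 + (\<Sum>k<n. I (W k) z))"
  have dY: "(Y n has_field_derivative Y1 n z) (at z)" if "z \<in> S" for n z
    unfolding Y_def Y1_def P_def q_def q1_def
    by (auto intro!: derivative_eq_intros IS[OF Ih[OF Ih[OF Wh]] that])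
  have dY1: "(Y1 n has_field_derivative Y2 n z) (at z)" if "z \<in> S" for n z
    unfolding Y1_def Y2_def q1_def
    by (auto intro!: derivative_eq_intros IS[OF Ih[OF Wh] that])
  have dY2: "(Y2 n has_field_derivative (\<Sum>k<n. W k z)) (at z)" if "z \<in> S" for n z
    unfolding Y2_def by (auto intro!: derivative_eq_intros IS[OF Wh that])
  note chain = higher_deriv_chain[OF S(1) _ dY dY1 dY2]
  have Yh: "Y n holomorphic_on S" for n
    using chain(1) b by blast
  have rec: "(deriv ^^ 3) (Y (Suc n)) z =
      - (p1 z * (deriv ^^ 2) (Y n) z + p2 z * deriv (Y n) z + p3 z * Y n z)" if z: "z \<in> S" for n z
  proof -
    have "(deriv ^^ 3) (Y (Suc n)) z = W 0 z + (\<Sum>k<n. W (Suc k) z)"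
      using chain(4)[OF z, of "Suc n"] by (simp add: sum.lessThan_Suc_shift del: sum.lessThan_Suc)
    also have "\<dots> = - (p1 z * Y2 n z + p2 z * Y1 n z + p3 z * Y n z)"
      by (simp add: W0 WS Y2_def Y1_def Y_def P_def algebra_simps sum.distrib sum_negf sum_subtractf sum_distrib_left)
    finally show ?thesis using chain(2,3)[OF z, of n] by simp
  qed
  define y where "y = (\<lambda>z. q z + (\<Sum>k. P k z))"
  have lim: "\<exists>U. open U \<and> z \<in> U \<and> U \<subseteq> S \<and> uniform_limit U Y y sequentially" if z: "z \<in> S" for z
  proof -
    obtain r where r: "r > 0" "cball z r \<subseteq> S" using S(1) z by (meson open_contains_cball)
    define K where "K = convex hull (insert b (cball z r))"
    have "compact K" unfolding K_def by (intro compact_convex_hull compact_insert compact_cball)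
    have "convex K" unfolding K_def by simp
    have "K \<subseteq> S" unfolding K_def using S(2) r b by (simp add: hull_minimal)
    have bK: "b \<in> K" unfolding K_def by (simp add: hull_inc)
    have zK: "cball z r \<subseteq> K" unfolding K_def by (meson hull_subset insert_subset order_trans subset_insertI)
    have bd: "\<exists>M. \<forall>w\<in>K. norm (f w) \<le> M" if "f holomorphic_on S" for f
      using compact_imp_bounded[OF compact_continuous_image[OF _ \<open>compact K\<close>], of f]
        holomorphic_on_imp_continuous_on[OF that] continuous_on_subset \<open>K \<subseteq> S\<close>
      unfolding bounded_iff by blast
    obtain M1 M2 M3 where M: "\<forall>w\<in>K. norm (p1 w) \<le> M1" "\<forall>w\<in>K. norm (p2 w) \<le> M2" "\<forall>w\<in>K. norm (p3 w) \<le> M3"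
      using bd p by metis
    obtain C where C: "\<forall>w\<in>K. norm (W 0 w) \<le> C" using bd[OF Wh] by blast
    have "(\<lambda>w. w - b) holomorphic_on S" by (intro holomorphic_intros)
    then obtain D where D: "\<forall>w\<in>K. norm (w - b) \<le> D" using bd by blast
    have "C \<ge> 0" using C bK norm_ge_zero order_trans by blast
    have "D \<ge> 0" using D bK by force
    have "M1 \<ge> 0" "M2 \<ge> 0" "M3 \<ge> 0" using M bK norm_ge_zero order_trans by blast+
    define B where "B = M1 + M2 * D + M3 * D ^ 2"
    have "B \<ge> 0" unfolding B_def using \<open>M1 \<ge> 0\<close> \<open>M2 \<ge> 0\<close> \<open>M3 \<ge> 0\<close> \<open>D \<ge> 0\<close> by simp
    \<comment> \<open>The primitive of a bounded function gains a factor \<open>norm (w - b)\<close> over its bound.\<close>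
    have step: "norm (I f w) \<le> E * norm (w - b) ^ Suc n / real (Suc n)"
      if "f holomorphic_on S" "w \<in> K" "\<And>v. v \<in> K \<Longrightarrow> norm (f v) \<le> E * norm (v - b) ^ n" for f w E n
      by (rule norm_primitive_le[OF \<open>convex K\<close> bK that(2) IS[OF that(1)] I0[OF that(1)] that(3)])
         (use \<open>K \<subseteq> S\<close> in auto)
    have more: "norm (I f w) \<le> D * E * norm (w - b) ^ n"
      if "f holomorphic_on S" "w \<in> K" "E \<ge> 0" "\<And>v. v \<in> K \<Longrightarrow> norm (f v) \<le> E * norm (v - b) ^ n" for f w E n
    proof -
      have "norm (I f w) \<le> E * norm (w - b) ^ Suc n / real (Suc n)" using step that by blast
      also have "\<dots> \<le> E * norm (w - b) ^ Suc n / 1"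
        using that(3) by (intro divide_left_mono mult_nonneg_nonneg) auto
      also have "\<dots> = norm (w - b) * (E * norm (w - b) ^ n)" by simp
      also have "\<dots> \<le> D * (E * norm (w - b) ^ n)"
        using that D by (intro mult_right_mono mult_nonneg_nonneg) auto
      finally show ?thesis by (simp add: mult_ac)
    qed
    have Wb: "norm (W n w) \<le> C * B ^ n / fact n * norm (w - b) ^ n" if "w \<in> K" for n w
      using that
    proof (induction n arbitrary: w)
      case 0 then show ?case using C by simp
    next
      case (Suc n)
      define E where "E = C * B ^ n / fact n / real (Suc n)"
      have "E \<ge> 0" unfolding E_def using \<open>C \<ge> 0\<close> \<open>B \<ge> 0\<close> by simp
      have a1: "norm (I (W n) v) \<le> E * norm (v - b) ^ Suc n" if "v \<in> K" for v
        using step[OF Wh that Suc.IH] by (simp add: E_def)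
      have a2: "norm (I (I (W n)) v) \<le> D * E * norm (v - b) ^ Suc n" if "v \<in> K" for v
        using more[OF Ih[OF Wh] that \<open>E \<ge> 0\<close> a1] by simp
      have a3: "norm (I (I (I (W n))) v) \<le> D * (D * E) * norm (v - b) ^ Suc n" if "v \<in> K" for v
        using more[OF Ih[OF Ih[OF Wh]] that _ a2] \<open>E \<ge> 0\<close> \<open>D \<ge> 0\<close> by simp
      have "norm (W (Suc n) w) \<le> norm (p1 w * I (W n) w) + norm (p2 w * I (I (W n)) w) + norm (p3 w * I (I (I (W n))) w)"
        unfolding WS norm_minus_cancel by (meson norm_triangle_le norm_triangle_ineq add_right_mono order_trans)
      also have "\<dots> \<le> M1 * (E * norm (w - b) ^ Suc n) + M2 * (D * E * norm (w - b) ^ Suc n)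
           + M3 * (D * (D * E) * norm (w - b) ^ Suc n)"
        unfolding norm_mult using M a1 a2 a3 Suc.prems \<open>M1 \<ge> 0\<close> \<open>M2 \<ge> 0\<close> \<open>M3 \<ge> 0\<close>
        by (intro add_mono mult_mono) auto
      also have "\<dots> = E * B * norm (w - b) ^ Suc n"
        by (simp add: B_def algebra_simps power2_eq_square)
      finally show ?case by (simp add: E_def mult_ac)
    qed
    have Pb: "norm (P n w) \<le> C * D ^ 3 * ((B * D) ^ n / fact n)" if "w \<in> K" for n w
    proof -
      define E where "E = C * B ^ n / fact n"
      have "E \<ge> 0" unfolding E_def using \<open>C \<ge> 0\<close> \<open>B \<ge> 0\<close> by simp
      have a1: "norm (I (W n) v) \<le> D * E * norm (v - b) ^ n" if "v \<in> K" for v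
        by (rule more[OF Wh that \<open>E \<ge> 0\<close>]) (use Wb in \<open>simp add: E_def\<close>)
      have a2: "norm (I (I (W n)) v) \<le> D * (D * E) * norm (v - b) ^ n" if "v \<in> K" for v
        by (rule more[OF Ih[OF Wh] that _ a1]) (use \<open>D \<ge> 0\<close> \<open>E \<ge> 0\<close> in auto)
      have "norm (P n w) \<le> D * (D * (D * E)) * norm (w - b) ^ n"
        unfolding P_def
        by (rule more[OF Ih[OF Ih[OF Wh]] that _ a2]) (use \<open>D \<ge> 0\<close> \<open>E \<ge> 0\<close> in auto)
      also have "\<dots> \<le> D * (D * (D * E)) * D ^ n"
        using D that \<open>D \<ge> 0\<close> \<open>E \<ge> 0\<close> by (intro mult_left_mono power_mono) auto
      finally show ?thesis by (simp add: E_def power_mult_distrib power3_eq_cube mult_ac)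
    qed
    have "summable (\<lambda>n. C * D ^ 3 * ((B * D) ^ n / fact n))"
      using summable_exp[of "B * D"] by (intro summable_mult) (simp add: field_simps)
    then have "uniform_limit K (\<lambda>n w. \<Sum>k<n. P k w) (\<lambda>w. \<Sum>k. P k w) sequentially"
      using Pb by (intro Weierstrass_m_test) auto
    then have "uniform_limit K Y y sequentially"
      unfolding Y_def y_def by (intro uniform_limit_add uniform_limit_const)
    then have "uniform_limit (ball z r) Y y sequentially"
      using zK ball_subset_cball uniform_limit_on_subset by blast
    then show ?thesis using r by (intro exI[of _ "ball z r"]) auto
  qed
  have yh: "y holomorphic_on S"
  proof (rule holomorphic_uniform_sequence[OF S(1) Yh])
    fix z assume "z \<in> S"
    then obtain U where U: "open U" "z \<in> U" "U \<subseteq> S" "uniform_limit U Y y sequentially"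
      using lim by blast
    then obtain d where "d > 0" "cball z d \<subseteq> U" by (meson open_contains_cball)
    then show "\<exists>d>0. cball z d \<subseteq> S \<and> uniform_limit (cball z d) Y y sequentially"
      using U uniform_limit_on_subset by blast
  qed
  have dl: "(\<lambda>n. (deriv ^^ m) (Y n) z) \<longlonglongrightarrow> (deriv ^^ m) y z" if z: "z \<in> S" for m z
  proof -
    obtain U where U: "open U" "z \<in> U" "U \<subseteq> S" "uniform_limit U Y y sequentially"
      using lim[OF z] by blast
    show ?thesis
      by (rule higher_deriv_complex_uniform_limit[OF U(4) _ _ U(1,2)])
         (use holomorphic_on_subset[OF Yh U(3)] in \<open>simp_all add: always_eventually\<close>)
  qed
  have "ode3 p1 p2 p3 S y"
    unfolding ode3_def
  proof (intro conjI ballI yh)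
    fix z assume z: "z \<in> S"
    have "(\<lambda>n. (deriv ^^ 3) (Y (Suc n)) z) \<longlonglongrightarrow> (deriv ^^ 3) y z"
      using dl[OF z] by (rule LIMSEQ_Suc)
    moreover have "(\<lambda>n. (deriv ^^ 3) (Y (Suc n)) z) \<longlonglongrightarrow>
        - (p1 z * (deriv ^^ 2) y z + p2 z * deriv y z + p3 z * y z)"
      unfolding rec[OF z]
      using dl[OF z, of 2] dl[OF z, of 1] dl[OF z, of 0] by (intro tendsto_intros) auto
    ultimately have "(deriv ^^ 3) y z = - (p1 z * (deriv ^^ 2) y z + p2 z * deriv y z + p3 z * y z)"
      by (rule LIMSEQ_unique)
    then show "(deriv ^^ 3) y z + p1 z * (deriv ^^ 2) y z + p2 z * deriv y z + p3 z * y z = 0"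
      by (simp add: algebra_simps)
  qed
  moreover have "y b = c0"
  proof -
    have "Y n b = c0" for n by (simp add: Y_def q_def P_def I0[OF Ih[OF Ih[OF Wh]]])
    then show ?thesis using dl[OF b, of 0] by (simp add: LIMSEQ_const_iff)
  qed
  moreover have "deriv y b = c1"
  proof -
    have "deriv (Y n) b = c1" for n
      using chain(2)[OF b, of n] I0[OF Ih[OF Wh]] by (simp add: Y1_def q1_def)
    then show ?thesis using dl[OF b, of 1] by (simp add: LIMSEQ_const_iff)
  qed
  moreover have "(deriv ^^ 2) y b = c2"
  proof -
    have "(deriv ^^ 2) (Y n) b = c2" for n
      using chain(3)[OF b, of n] I0[OF Wh] by (simp add: Y2_def)
    then show ?thesis using dl[OF b, of 2] by (simp add: LIMSEQ_const_iff)
  qed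
  ultimately show ?thesis by (rule that)
qed

section \<open>Equations of Euler type in a logarithmic coordinate\<close>

definition half_plane :: "real \<Rightarrow> complex set" where
  "half_plane c = {s. Re s < c}"

text \<open>A Fuchsian singularity at \<open>x = 0\<close>, written in terms of the operator \<open>x d/dx\<close>, that is, of the
  derivative with respect to \<open>s\<close> where \<open>x = exp s\<close>. Multivalued solutions become single-valued
  functions of \<open>s\<close>, and the local monodromy is the shift by \<open>2 \<pi> \<i>\<close>.\<close>

definition euler_ode ::
    "(complex \<Rightarrow> complex) \<Rightarrow> (complex \<Rightarrow> complex) \<Rightarrow> (complex \<Rightarrow> complex) \<Rightarrow> real \<Rightarrow>
     (complex \<Rightarrow> complex) \<Rightarrow> bool" where
  "euler_ode A1 A2 A3 c y \<longleftrightarrow>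
     ode3 (\<lambda>s. A1 (exp s)) (\<lambda>s. A2 (exp s)) (\<lambda>s. A3 (exp s)) (half_plane c) y"

lemma open_half_plane: "open (half_plane c)"
  and convex_half_plane: "convex (half_plane c)"
  and connected_half_plane: "connected (half_plane c)"
proof -
  show "open (half_plane c)" by (simp add: half_plane_def open_halfspace_Re_lt)
  show "convex (half_plane c)" by (simp add: half_plane_def convex_halfspace_Re_lt)
  then show "connected (half_plane c)" by (rule convex_connected)
qed

lemma half_plane_add_2pi: "s + 2 * of_real pi * \<i> \<in> half_plane c \<longleftrightarrow> s \<in> half_plane c"
  by (simp add: half_plane_def)

lemma exp_in_punctured_ball: "exp s \<in> ball 0 (exp c) - {0} \<longleftrightarrow> s \<in> half_plane c"
  by (simp add: half_plane_def)

lemma Ln_in_half_plane: "x \<in> ball 0 (exp c) - {0} \<Longrightarrow> Ln x \<in> half_plane c"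
  by (subst exp_in_punctured_ball[symmetric]) auto

lemma exp_add_2pi: "exp (s + 2 * of_real pi * \<i>) = exp s"
  by (simp add: exp_add)

lemma periodic_int:
  assumes per: "\<And>s. s \<in> half_plane c \<Longrightarrow> g (s + 2 * of_real pi * \<i>) = g s"
    and "s \<in> half_plane c" "t \<in> half_plane c" "exp s = exp t"
  shows "g s = g t"
proof -
  have nat: "g (u + of_nat n * (2 * of_real pi * \<i>)) = g u" if "u \<in> half_plane c" for u n
  proof (induction n)
    case (Suc n)
    have "u + of_nat n * (2 * of_real pi * \<i>) \<in> half_plane c"
      using that by (simp add: half_plane_def)
    then show ?case using per[of "u + of_nat n * (2 * of_real pi * \<i>)"] Suc
      by (simp add: algebra_simps)
  qed simp
  obtain n :: int where n: "s = t + of_int n * (2 * of_real pi * \<i>)"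
    using assms(4) unfolding exp_eq by (auto simp: mult_ac)
  show ?thesis
  proof (cases "n \<ge> 0")
    case True
    then have "s = t + of_nat (nat n) * (2 * of_real pi * \<i>)"
      using n by (simp add: of_nat_nat)
    then show ?thesis using nat[OF assms(3), of "nat n"] by simp
  next
    case False
    then have "of_int n = - (of_nat (nat (-n)) :: complex)"
      by (simp add: of_nat_nat)
    then have "t = s + of_nat (nat (-n)) * (2 * of_real pi * \<i>)" using n by simp
    then show ?thesis using nat[OF assms(2), of "nat (-n)"] by simp
  qed
qed

lemma local_log:
  fixes x :: complex
  assumes "x \<noteq> 0" "exp t = x"
  obtains l where "l holomorphic_on ball x (norm x)" "l x = t"
    "\<And>w. w \<in> ball x (norm x) \<Longrightarrow> exp (l w) = w"
proof
  define l where "l = (\<lambda>w. Ln (w / x) + t)"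
  have nz: "w / x \<notin> \<real>\<^sub>\<le>\<^sub>0" if "w \<in> ball x (norm x)" for w
  proof -
    have "w / x - 1 = (w - x) / x" using assms(1) by (simp add: diff_divide_distrib)
    then have "norm (w / x - 1) = norm (w - x) / norm x" by (simp add: norm_divide)
    also have "\<dots> < 1" using that assms(1) by (simp add: dist_norm norm_minus_commute)
    finally have "norm (w / x - 1) < 1" .
    then have "Re (w / x) > 0"
      using abs_Re_le_cmod[of "w / x - 1"] by simp
    then show ?thesis using complex_nonpos_Reals_iff by force
  qed
  show "l holomorphic_on ball x (norm x)"
    unfolding l_def using nz assms(1) by (intro holomorphic_intros) auto
  show "l x = t" using assms by (simp add: l_def)
  show "exp (l w) = w" if "w \<in> ball x (norm x)" for w
  proof -
    have "w / x \<noteq> 0" using nz[OF that] by auto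
    then show ?thesis using assms by (simp only: l_def exp_add exp_Ln) simp
  qed
qed

lemma local_log_at:
  fixes z z0 :: complex
  assumes "exp s = z - z0"
  obtains U l where "open U" "z \<in> U" "z0 \<notin> U" "l holomorphic_on U" "l z = s"
    "\<And>w. w \<in> U \<Longrightarrow> exp (l w) = w - z0"
proof -
  have nz: "z - z0 \<noteq> 0" using assms by (metis exp_not_eq_zero)
  obtain l where l: "l holomorphic_on ball (z - z0) (norm (z - z0))" "l (z - z0) = s"
      "\<And>w. w \<in> ball (z - z0) (norm (z - z0)) \<Longrightarrow> exp (l w) = w"
    using local_log[OF nz assms] by blast
  define U where "U = ball z (norm (z - z0))"
  have "(\<lambda>w. l (w - z0)) holomorphic_on U"
    using holomorphic_on_compose_gen[of "\<lambda>w. w - z0" U, OF _ l(1)]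
    by (force simp: o_def dist_norm algebra_simps U_def intro: holomorphic_intros)
  moreover have "exp (l (w - z0)) = w - z0" if "w \<in> U" for w
    using l(3)[of "w - z0"] that by (simp add: U_def dist_norm algebra_simps)
  ultimately show ?thesis
    using that[of U "\<lambda>w. l (w - z0)"] nz l(2) by (auto simp: U_def dist_norm)
qed

text \<open>On the half-plane the exponential is a universal covering of the punctured disc, so periodic
  holomorphic functions are pulled back from the disc.\<close>

lemma periodic_descends:
  assumes hol: "g holomorphic_on half_plane c"
    and per: "\<And>s. s \<in> half_plane c \<Longrightarrow> g (s + 2 * of_real pi * \<i>) = g s"
  shows "(\<lambda>x. g (Ln x)) holomorphic_on (ball 0 (exp c) - {0})"
    and "\<And>s. s \<in> half_plane c \<Longrightarrow> g s = g (Ln (exp s))"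
proof -
  show *: "g s = g (Ln (exp s))" if "s \<in> half_plane c" for s
    by (rule periodic_int[of c g]) (use per that exp_in_punctured_ball Ln_in_half_plane in auto)
  show "(\<lambda>x. g (Ln x)) holomorphic_on (ball 0 (exp c) - {0})"
  proof -
    have "\<exists>U. open U \<and> x \<in> U \<and> (\<lambda>x. g (Ln x)) holomorphic_on U" if x: "x \<in> ball 0 (exp c) - {0}" for x
    proof -
      have "x \<noteq> 0" using x by auto
      obtain l where l: "l holomorphic_on ball x (norm x)" "l x = Ln x"
          "\<And>w. w \<in> ball x (norm x) \<Longrightarrow> exp (l w) = w"
        using local_log[OF \<open>x \<noteq> 0\<close> exp_Ln[OF \<open>x \<noteq> 0\<close>]] by blast
      define U where "U = ball x (norm x) \<inter> (ball 0 (exp c) - {0})"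
      have lU: "l w \<in> half_plane c" if "w \<in> U" for w
        using that l(3)[of w] by (subst exp_in_punctured_ball[symmetric]) (auto simp: U_def)
      have "(\<lambda>w. g (l w)) holomorphic_on U"
        using holomorphic_on_compose_gen[OF holomorphic_on_subset[OF l(1)] hol, of U] lU
        by (force simp: o_def U_def)
      moreover have "g (l w) = g (Ln w)" if "w \<in> U" for w
        using *[OF lU[OF that]] l(3) that by (simp add: U_def)
      ultimately have "(\<lambda>x. g (Ln x)) holomorphic_on U" by (simp cong: holomorphic_cong)
      then show ?thesis using x \<open>x \<noteq> 0\<close> by (intro exI[of _ U]) (auto simp: U_def)
    qed
    then have "(\<lambda>x. g (Ln x)) field_differentiable at x" if "x \<in> ball 0 (exp c) - {0}" for x
      using that holomorphic_on_imp_differentiable_at by blast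
    then show ?thesis
      unfolding holomorphic_on_def using field_differentiable_at_within by blast
  qed
qed

lemma factor_at_zero:
  assumes f: "f holomorphic_on S" and S: "open S" "connected S" and z0: "z0 \<in> S"
    and nz: "w \<in> S" "f w \<noteq> 0"
  obtains m h where "h holomorphic_on S" "h z0 \<noteq> 0" "\<And>z. z \<in> S \<Longrightarrow> f z = (z - z0) ^ m * h z"
proof (cases "f z0 = 0")
  case False
  then show ?thesis using that[of f 0] f by simp
next
  case True
  have nc: "\<not> f constant_on S" using True nz z0 unfolding constant_on_def by force
  obtain g r n where g: "0 < n" "0 < r" "ball z0 r \<subseteq> S" "g holomorphic_on ball z0 r"
      "\<And>w. w \<in> ball z0 r \<Longrightarrow> f w = (w - z0) ^ n * g w" "\<And>w. w \<in> ball z0 r \<Longrightarrow> g w \<noteq> 0"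
    by (rule holomorphic_factor_zero_nonconstant[OF f S z0 True nc], rule that; assumption)
  define h where "h = (\<lambda>z. if z \<in> ball z0 r then g z else f z / (z - z0) ^ n)"
  have "h holomorphic_on (ball z0 r)"
    using g(4) by (rule holomorphic_transform) (simp add: h_def)
  moreover have "h holomorphic_on (S - {z0})"
  proof (rule holomorphic_transform)
    show "(\<lambda>z. f z / (z - z0) ^ n) holomorphic_on (S - {z0})"
      by (intro holomorphic_intros holomorphic_on_subset[OF f]) auto
  qed (use g in \<open>auto simp: h_def\<close>)
  ultimately have "h holomorphic_on (ball z0 r \<union> (S - {z0}))"
    using S by (intro holomorphic_on_Un) auto
  moreover have "ball z0 r \<union> (S - {z0}) = S" using g z0 by auto
  ultimately show ?thesis
    using that[of h n] g by (auto simp: h_def)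
qed

lemma euler_ode_shift:
  assumes "euler_ode A1 A2 A3 c y"
  shows "euler_ode A1 A2 A3 c (\<lambda>s. y (s + 2 * of_real pi * \<i>))"
  unfolding euler_ode_def
proof (rule ode3I[OF open_half_plane])
  fix s assume s: "s \<in> half_plane c"
  note D = ode3_derivs[OF assms[unfolded euler_ode_def] open_half_plane half_plane_add_2pi[THEN iffD2, OF s]]
  show "((\<lambda>s. y (s + 2 * of_real pi * \<i>)) has_field_derivative deriv y (s + 2 * of_real pi * \<i>)) (at s)"
    using D(1) by (simp add: DERIV_shift)
  show "((\<lambda>s. deriv y (s + 2 * of_real pi * \<i>)) has_field_derivative (deriv ^^ 2) y (s + 2 * of_real pi * \<i>)) (at s)"
    using D(2) by (simp add: DERIV_shift)
  show "((\<lambda>s. (deriv ^^ 2) y (s + 2 * of_real pi * \<i>)) has_field_derivative (deriv ^^ 3) y (s + 2 * of_real pi * \<i>)) (at s)"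
    using D(3) by (simp add: DERIV_shift)
  show "(deriv ^^ 3) y (s + 2 * of_real pi * \<i>) + A1 (exp s) * (deriv ^^ 2) y (s + 2 * of_real pi * \<i>) +
      A2 (exp s) * deriv y (s + 2 * of_real pi * \<i>) + A3 (exp s) * y (s + 2 * of_real pi * \<i>) = 0"
    using D(4) by (simp add: exp_add_2pi)
qed

lemma DERIV_exp_mult_exp:
  assumes "f holomorphic_on ball 0 (exp c)" "s \<in> half_plane c"
  shows "((\<lambda>s. exp (k * s) * f (exp s)) has_field_derivative
          exp (k * s) * (k * f (exp s) + exp s * deriv f (exp s))) (at s)"
proof -
  have "exp s \<in> ball 0 (exp c)" using assms(2) exp_in_punctured_ball by blast
  then have "(f has_field_derivative deriv f (exp s)) (at (exp s))"
    using assms(1) holomorphic_derivI open_ball by blast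
  then have "((\<lambda>s. f (exp s)) has_field_derivative deriv f (exp s) * exp s) (at s)"
    using DERIV_chain2[OF _ DERIV_exp] by blast
  then show ?thesis
    by (auto intro!: derivative_eq_intros simp: algebra_simps)
qed

text \<open>The factor \<open>exp (k s)\<close> drops out of the equation; what is left is a holomorphic function of
  \<open>x = exp s\<close> whose value at \<open>x = 0\<close> is \<open>h 0\<close> times the indicial polynomial at \<open>k\<close>.\<close>

lemma indicial_equation:
  assumes A: "A1 holomorphic_on ball 0 (exp c)" "A2 holomorphic_on ball 0 (exp c)"
      "A3 holomorphic_on ball 0 (exp c)"
    and y: "euler_ode A1 A2 A3 c y"
    and h: "h holomorphic_on ball 0 (exp c)" "h 0 \<noteq> 0"
    and yh: "\<And>s. s \<in> half_plane c \<Longrightarrow> y s = exp (k * s) * h (exp s)"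
  shows "k ^ 3 + A1 0 * k ^ 2 + A2 0 * k + A3 0 = 0"
proof -
  define \<theta> where "\<theta> = (\<lambda>f (x::complex). k * f x + x * deriv f x)"
  have \<theta>h: "\<theta> f holomorphic_on ball 0 (exp c)" if "f holomorphic_on ball 0 (exp c)" for f
    unfolding \<theta>_def using that by (intro holomorphic_intros) auto
  note hh = h(1) \<theta>h[OF h(1)] \<theta>h[OF \<theta>h[OF h(1)]]
  have d: "((\<lambda>s. exp (k * s) * f (exp s)) has_field_derivative exp (k * s) * \<theta> f (exp s)) (at s)"
    if "f holomorphic_on ball 0 (exp c)" "s \<in> half_plane c" for f s
    using DERIV_exp_mult_exp[OF that] by (simp add: \<theta>_def)
  have sol: "euler_ode A1 A2 A3 c (\<lambda>s. exp (k * s) * h (exp s))"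
    unfolding euler_ode_def
    by (rule ode3_cong[OF open_half_plane _ _ _ yh y[unfolded euler_ode_def]]) auto
  have *: "exp (k * s) * (\<theta> (\<theta> (\<theta> h)) (exp s) + A1 (exp s) * \<theta> (\<theta> h) (exp s) +
      A2 (exp s) * \<theta> h (exp s) + A3 (exp s) * h (exp s)) = 0" if s: "s \<in> half_plane c" for s
  proof -
    define y' where "y' = (\<lambda>s. exp (k * s) * h (exp s))"
    note d1 = d[OF hh(1), folded y'_def]
    have C: "deriv y' s = exp (k * s) * \<theta> h (exp s)"
        "(deriv ^^ 2) y' s = exp (k * s) * \<theta> (\<theta> h) (exp s)"
        "(deriv ^^ 3) y' s = exp (k * s) * \<theta> (\<theta> (\<theta> h)) (exp s)"
      using higher_deriv_chain(2-4)[OF open_half_plane s d1 d[OF hh(2)] d[OF hh(3)]] by auto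
    have "y' s = exp (k * s) * h (exp s)" by (simp add: y'_def)
    then show ?thesis
      using ode3_derivs(4)[OF sol[unfolded euler_ode_def, folded y'_def] open_half_plane s] unfolding C
      by (simp add: algebra_simps)
  qed
  define \<phi> where "\<phi> = (\<lambda>x. \<theta> (\<theta> (\<theta> h)) x + A1 x * \<theta> (\<theta> h) x + A2 x * \<theta> h x + A3 x * h x)"
  have z: "\<phi> x = 0" if "x \<in> ball 0 (exp c) - {0}" for x
    using *[OF Ln_in_half_plane[OF that]] that by (simp add: \<phi>_def)
  have "\<phi> holomorphic_on ball 0 (exp c)"
    unfolding \<phi>_def by (intro holomorphic_intros A hh \<theta>h)
  then have "continuous_on (ball 0 (exp c)) \<phi>" by (rule holomorphic_on_imp_continuous_on)
  then have "isCont \<phi> 0" by (simp add: continuous_on_eq_continuous_at)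
  then have "\<phi> \<midarrow>0\<rightarrow> \<phi> 0" by (simp add: isCont_def)
  moreover have "\<phi> \<midarrow>0\<rightarrow> 0"
    by (rule Lim_transform_within_open[OF tendsto_const open_ball[of 0 "exp c"]]) (use z in auto)
  ultimately have "\<phi> 0 = 0" by (rule LIM_unique)
  then have "h 0 * (k ^ 3 + A1 0 * k ^ 2 + A2 0 * k + A3 0) = 0"
    by (simp add: \<phi>_def \<theta>_def algebra_simps power2_eq_square power3_eq_cube)
  then show ?thesis using h(2) by simp
qed


text \<open>A Gronwall estimate along horizontal rays: the coefficients are bounded near the origin, so the
  squared length of \<open>(y, y', y'')\<close> grows at most exponentially as \<open>Re s\<close> decreases, that is,
  polynomially in \<open>1 / norm (exp s)\<close>.\<close>

lemma euler_ode_moderate_growth: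
  assumes A: "A1 holomorphic_on ball 0 (exp c)" "A2 holomorphic_on ball 0 (exp c)"
      "A3 holomorphic_on ball 0 (exp c)"
    and y: "euler_ode A1 A2 A3 c y"
  obtains C and N :: nat where
    "\<And>s. Re s \<le> c - 1 \<Longrightarrow> \<bar>Im s\<bar> \<le> pi \<Longrightarrow> norm (y s) ^ 2 \<le> C * exp (- real N * Re s)"
proof -
  define c1 where "c1 = c - 1"
  have bd: "\<exists>M::nat. \<forall>x\<in>cball 0 (exp c1). norm (f x) \<le> real M" if "f holomorphic_on ball 0 (exp c)" for f :: "complex \<Rightarrow> complex"
  proof -
    have "exp c1 < exp c" by (simp add: c1_def)
    then have "cball 0 (exp c1) \<subseteq> ball (0::complex) (exp c)"
      by (simp add: cball_subset_ball_iff del: exp_less_cancel_iff)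
    then have "continuous_on (cball 0 (exp c1)) f"
      using holomorphic_on_imp_continuous_on[OF that] continuous_on_subset by blast
    then have "bounded (f ` cball 0 (exp c1))"
      by (intro compact_imp_bounded compact_continuous_image) auto
    then obtain B where "\<forall>x\<in>cball 0 (exp c1). norm (f x) \<le> B" by (auto simp: bounded_iff)
    moreover obtain M :: nat where "B \<le> real M" using real_arch_simple by blast
    ultimately show ?thesis by (meson order_trans)
  qed
  obtain M1 where M1: "\<forall>x\<in>cball 0 (exp c1). norm (A1 x) \<le> real M1" using bd[OF A(1)] by blast
  obtain M2 where M2: "\<forall>x\<in>cball 0 (exp c1). norm (A2 x) \<le> real M2" using bd[OF A(2)] by blast
  obtain M3 where M3: "\<forall>x\<in>cball 0 (exp c1). norm (A3 x) \<le> real M3" using bd[OF A(3)] by blast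
  have M: "\<forall>x\<in>cball 0 (exp c1). norm (A1 x) \<le> real M1"
      "\<forall>x\<in>cball 0 (exp c1). norm (A2 x) \<le> real M2" "\<forall>x\<in>cball 0 (exp c1). norm (A3 x) \<le> real M3"
    by (fact M1 M2 M3)+
  define M where "M = real M1 + real M2 + real M3"
  define N where "N = 2 + 4 * (M1 + M2 + M3)"
  have N: "real N = 2 + 4 * M" by (simp add: N_def M_def)
  define y1 where "y1 = deriv y"
  define y2 where "y2 = (deriv ^^ 2) y"
  define y3 where "y3 = (deriv ^^ 3) y"
  note D = ode3_derivs[OF y[unfolded euler_ode_def] open_half_plane, folded y1_def y2_def y3_def]
  have hol: "y holomorphic_on half_plane c" "y1 holomorphic_on half_plane c" "y2 holomorphic_on half_plane c"
    unfolding holomorphic_on_open[OF open_half_plane] using D(1-3) by blast+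
  define V where "V = (\<lambda>s. norm (y s) ^ 2 + norm (y1 s) ^ 2 + norm (y2 s) ^ 2)"
  define seg where "seg = (\<lambda>\<tau>. Complex c1 \<tau>) ` {-pi..pi}"
  have "compact seg" unfolding seg_def
    by (intro compact_continuous_image continuous_intros) (auto simp: Complex_eq intro!: continuous_intros)
  have "seg \<subseteq> half_plane c" by (auto simp: seg_def half_plane_def c1_def)
  have "continuous_on seg V" unfolding V_def
    using hol holomorphic_on_imp_continuous_on continuous_on_subset \<open>seg \<subseteq> half_plane c\<close>
    by (intro continuous_intros) blast+
  then have "bounded (V ` seg)"
    using \<open>compact seg\<close> by (intro compact_imp_bounded compact_continuous_image) auto
  then obtain B where B: "\<And>\<tau>. \<bar>\<tau>\<bar> \<le> pi \<Longrightarrow> V (Complex c1 \<tau>) \<le> B"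
    unfolding bounded_iff seg_def by (force simp: abs_le_iff)
  have lower: "inner (y s) (y1 s) * 2 + inner (y1 s) (y2 s) * 2 + inner (y2 s) (y3 s) * 2 \<ge> - real N * V s"
    if s: "Re s \<le> c1" for s
  proof -
    have sc: "s \<in> half_plane c" using s by (simp add: half_plane_def c1_def)
    have "exp s \<in> cball 0 (exp c1)" using s by simp
    then have a: "norm (A1 (exp s)) \<le> M" "norm (A2 (exp s)) \<le> M" "norm (A3 (exp s)) \<le> M"
      using M(1)[rule_format, of "exp s"] M(2)[rule_format, of "exp s"] M(3)[rule_format, of "exp s"]
      unfolding M_def by linarith+
    define n0 n1 n2 where "n0 = norm (y s)" and "n1 = norm (y1 s)" and "n2 = norm (y2 s)"
    have nn: "n0 \<ge> 0" "n1 \<ge> 0" "n2 \<ge> 0" "M \<ge> 0" by (simp_all add: n0_def n1_def n2_def M_def)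
    have y3: "y3 s = - (A1 (exp s) * y2 s + A2 (exp s) * y1 s + A3 (exp s) * y s)"
      by (rule eq_neg_iff_add_eq_0[THEN iffD2]) (use D(4)[OF sc] in \<open>simp add: add.assoc\<close>)
    have n3: "norm (y3 s) \<le> M * n2 + M * n1 + M * n0"
      unfolding y3 norm_minus_cancel n0_def n1_def n2_def
      by (intro norm_triangle_le add_mono) (auto simp: norm_mult intro!: mult_right_mono a)
    have "\<bar>inner (y s) (y1 s)\<bar> \<le> n0 * n1" "\<bar>inner (y1 s) (y2 s)\<bar> \<le> n1 * n2"
      unfolding n0_def n1_def n2_def by (rule Cauchy_Schwarz_ineq2)+
    moreover have "\<bar>inner (y2 s) (y3 s)\<bar> \<le> n2 * (M * n2 + M * n1 + M * n0)"
      using Cauchy_Schwarz_ineq2[of "y2 s" "y3 s"] mult_left_mono[OF n3 nn(3)] by (simp add: n2_def)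
    moreover have "2 * (n0 * n1) \<le> n0 ^ 2 + n1 ^ 2" "2 * (n1 * n2) \<le> n1 ^ 2 + n2 ^ 2"
      using sum_squares_bound[of n0 n1] sum_squares_bound[of n1 n2] by (simp_all add: power2_eq_square)
    moreover have "2 * (n2 * (M * n2 + M * n1 + M * n0)) \<le> M * (4 * n2 ^ 2 + n1 ^ 2 + n0 ^ 2)"
    proof -
      have "2 * (n2 * (n2 + n1 + n0)) \<le> 4 * n2 ^ 2 + n1 ^ 2 + n0 ^ 2"
        using sum_squares_bound[of n2 n1] sum_squares_bound[of n2 n0]
        by (simp add: power2_eq_square algebra_simps)
      then have "M * (2 * (n2 * (n2 + n1 + n0))) \<le> M * (4 * n2 ^ 2 + n1 ^ 2 + n0 ^ 2)"
        using nn by (intro mult_left_mono)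
      then show ?thesis by (simp add: algebra_simps)
    qed
    moreover have "M * (4 * n2 ^ 2 + n1 ^ 2 + n0 ^ 2) + (n0 ^ 2 + n1 ^ 2) + (n1 ^ 2 + n2 ^ 2) \<le> real N * V s"
    proof -
      have "0 \<le> M * (3 * n1 ^ 2 + 3 * n0 ^ 2)" "0 \<le> n0 ^ 2 + n2 ^ 2" using nn by simp_all
      then show ?thesis unfolding N V_def n0_def[symmetric] n1_def[symmetric] n2_def[symmetric]
        by (simp add: algebra_simps)
    qed
    ultimately show ?thesis by linarith
  qed
  have main: "V (Complex \<sigma> \<tau>) \<le> exp (real N * c1) * B * exp (- real N * \<sigma>)" if "\<sigma> \<le> c1" "\<bar>\<tau>\<bar> \<le> pi" for \<sigma> \<tau>
  proof -
    define p where "p = (\<lambda>t. Complex t \<tau>)"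
    have p': "(p has_vector_derivative 1) (at t)" for t
      unfolding p_def Complex_eq by (auto intro!: derivative_eq_intros)
    have comp: "((\<lambda>t. f (p t)) has_vector_derivative g (p t)) (at t)"
      if "t \<le> c1" "\<And>z. z \<in> half_plane c \<Longrightarrow> (f has_field_derivative g z) (at z)" for f g t
      using field_vector_diff_chain_at[OF p'[of t], of f "g (p t)"] that
      by (simp add: o_def p_def half_plane_def c1_def)
    have sq: "((\<lambda>t. norm (f (p t)) ^ 2) has_real_derivative 2 * inner (f (p t)) (g (p t))) (at t)"
      if "t \<le> c1" "\<And>z. z \<in> half_plane c \<Longrightarrow> (f has_field_derivative g z) (at z)" for f g t
      using bounded_bilinear.has_vector_derivative[OF bounded_bilinear_inner comp[OF that] comp[OF that]]
      by (simp add: has_real_derivative_iff_has_vector_derivative power2_norm_eq_inner inner_commute)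
    define W where "W = (\<lambda>t. V (p t) * exp (real N * t))"
    have W': "(W has_real_derivative (2 * inner (y (p t)) (y1 (p t)) + 2 * inner (y1 (p t)) (y2 (p t))
         + 2 * inner (y2 (p t)) (y3 (p t)) + real N * V (p t)) * exp (real N * t)) (at t)" if "t \<le> c1" for t
    proof -
      have "((\<lambda>t. V (p t)) has_real_derivative 2 * inner (y (p t)) (y1 (p t)) + 2 * inner (y1 (p t)) (y2 (p t))
         + 2 * inner (y2 (p t)) (y3 (p t))) (at t)"
        unfolding V_def by (intro DERIV_add sq[OF that] D(1-3))
      then show ?thesis unfolding W_def
        by (auto intro!: derivative_eq_intros simp: algebra_simps)
    qed
    have "W \<sigma> \<le> W c1"
    proof (rule DERIV_nonneg_imp_nondecreasing[OF that(1)])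
      fix t assume t: "\<sigma> \<le> t" "t \<le> c1"
      have "0 \<le> 2 * inner (y (p t)) (y1 (p t)) + 2 * inner (y1 (p t)) (y2 (p t))
         + 2 * inner (y2 (p t)) (y3 (p t)) + real N * V (p t)"
        using lower[of "p t"] t by (simp add: p_def)
      then show "\<exists>d. (W has_real_derivative d) (at t) \<and> 0 \<le> d"
        using W'[OF t(2)] by (meson exp_ge_zero mult_nonneg_nonneg)
    qed
    also have "W c1 \<le> B * exp (real N * c1)"
      using B[OF that(2)] by (simp add: W_def p_def)
    finally have "V (Complex \<sigma> \<tau>) * exp (real N * \<sigma>) \<le> B * exp (real N * c1)"
      by (simp add: W_def p_def)
    then show ?thesis by (simp add: exp_minus field_simps)
  qed
  show ?thesis
  proof (rule that)
    fix s assume "Re s \<le> c - 1" "\<bar>Im s\<bar> \<le> pi"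
    then have "V s \<le> exp (real N * c1) * B * exp (- real N * Re s)"
      using main[of "Re s" "Im s"] by (simp add: c1_def)
    moreover have "norm (y s) ^ 2 \<le> V s" by (simp add: V_def)
    ultimately show "norm (y s) ^ 2 \<le> exp (real N * c1) * B * exp (- real N * Re s)" by linarith
  qed
qed

text \<open>Dividing by a power \<open>exp (\<alpha> s)\<close> with the right multiplier leaves a function of \<open>exp s\<close> on the
  punctured disc; moderate growth rules out an essential singularity at the origin.\<close>

lemma multiplicative_solution:
  assumes A: "A1 holomorphic_on ball 0 (exp c)" "A2 holomorphic_on ball 0 (exp c)"
      "A3 holomorphic_on ball 0 (exp c)"
    and y: "euler_ode A1 A2 A3 c y"
    and mult: "\<And>s. s \<in> half_plane c \<Longrightarrow> y (s + 2 * of_real pi * \<i>) = \<mu> * y s"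
    and nz: "s0 \<in> half_plane c" "y s0 \<noteq> 0"
  obtains k h where "h holomorphic_on ball 0 (exp c)" "h 0 \<noteq> 0"
    "\<And>s. s \<in> half_plane c \<Longrightarrow> y s = exp (k * s) * h (exp s)"
    "exp (2 * of_real pi * \<i> * k) = \<mu>"
    "k ^ 3 + A1 0 * k ^ 2 + A2 0 * k + A3 0 = 0"
proof -
  have hol: "y holomorphic_on half_plane c" using y by (simp add: euler_ode_def ode3_def)
  have "\<mu> \<noteq> 0"
  proof
    assume "\<mu> = 0"
    then have "y s = 0" if "s \<in> half_plane c" for s
      using mult[of "s - 2 * of_real pi * \<i>"] that by (simp add: half_plane_def)
    then show False using nz by auto
  qed
  define \<alpha> where "\<alpha> = Ln \<mu> / (2 * of_real pi * \<i>)"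
  have \<alpha>: "exp (2 * of_real pi * \<i> * \<alpha>) = \<mu>" using \<open>\<mu> \<noteq> 0\<close> by (simp add: \<alpha>_def)
  define g where "g = (\<lambda>s. exp (- \<alpha> * s) * y s)"
  have "g holomorphic_on half_plane c" unfolding g_def by (intro holomorphic_intros hol)
  moreover have "g (s + 2 * of_real pi * \<i>) = g s" if "s \<in> half_plane c" for s
    using mult[OF that] \<open>\<mu> \<noteq> 0\<close> \<alpha> by (simp add: g_def algebra_simps exp_add exp_minus exp_diff)
  ultimately have G: "(\<lambda>x. g (Ln x)) holomorphic_on (ball 0 (exp c) - {0})"
    and gG: "\<And>s. s \<in> half_plane c \<Longrightarrow> g s = g (Ln (exp s))"
    using periodic_descends[of g c] by blast+
  obtain C and N :: nat where CN:
      "\<And>s. Re s \<le> c - 1 \<Longrightarrow> \<bar>Im s\<bar> \<le> pi \<Longrightarrow> norm (y s) ^ 2 \<le> C * exp (- real N * Re s)"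
    using euler_ode_moderate_growth[OF A y] by blast
  obtain n :: nat where n: "\<bar>Re \<alpha>\<bar> + real N \<le> real n" using real_arch_simple by blast
  define H where "H = (\<lambda>x. x ^ n * g (Ln x))"
  have "H holomorphic_on (ball 0 (exp c) - {0})" unfolding H_def by (intro holomorphic_intros G)
  moreover have "\<exists>B. eventually (\<lambda>x. norm (H x) \<le> B) (at 0)"
  proof -
    define E where "E = exp (2 * \<bar>Im \<alpha>\<bar> * pi) * C"
    have "norm (H x) ^ 2 \<le> E" if x: "x \<noteq> 0" "norm x < exp (min (c - 1) 0)" for x
    proof -
      define s where "s = Ln x"
      have s: "exp s = x" "\<bar>Im s\<bar> \<le> pi" using x Im_Ln_le_pi[of x] mpi_less_Im_Ln[of x] by (auto simp: s_def)
      have "norm x = exp (Re s)" using s(1) by (metis norm_exp_eq_Re)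
      then have R: "Re s \<le> c - 1" "Re s \<le> 0" using x(2) by (auto simp: min_def split: if_splits)
      have "norm (H x) = exp (real n * Re s) * exp (Re (- \<alpha> * s)) * norm (y s)"
        using \<open>norm x = exp (Re s)\<close>
        by (simp add: H_def g_def s_def[symmetric] norm_mult norm_power exp_of_nat_mult mult.assoc)
      also have "exp (real n * Re s) * exp (Re (- \<alpha> * s)) = exp (real n * Re s + Re (- \<alpha> * s))"
        by (rule exp_add[symmetric])
      finally have "norm (H x) ^ 2 = exp (2 * (real n * Re s + Re (- \<alpha> * s))) * norm (y s) ^ 2"
        by (simp only: power_mult_distrib exp_double)
      also have "\<dots> \<le> exp (2 * (real n * Re s + Re (- \<alpha> * s))) * (C * exp (- real N * Re s))"
        using CN[OF R(1) s(2)] by (intro mult_left_mono) auto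
      also have "\<dots> = C * exp (2 * (real n * Re s + Re (- \<alpha> * s)) - real N * Re s)"
        unfolding diff_conv_add_uminus exp_add minus_mult_left by (simp only: mult_ac)
      also have "\<dots> \<le> C * exp (2 * \<bar>Im \<alpha>\<bar> * pi)"
      proof -
        have "0 \<le> C"
        proof -
          have "0 \<le> C * exp (- real N * Re s)"
            using CN[OF R(1) s(2)] zero_le_power2 order_trans by blast
          then show ?thesis by (simp add: zero_le_mult_iff)
        qed
        have "Re (- \<alpha> * s) \<le> - Re \<alpha> * Re s + \<bar>Im \<alpha>\<bar> * pi"
        proof -
          have "Im \<alpha> * Im s \<le> \<bar>Im \<alpha>\<bar> * \<bar>Im s\<bar>" by (metis abs_ge_self abs_mult)
          also have "\<dots> \<le> \<bar>Im \<alpha>\<bar> * pi" using s(2) by (intro mult_left_mono) auto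
          finally show ?thesis by simp
        qed
        moreover have "2 * (real n - Re \<alpha>) * Re s - real N * Re s \<le> 0"
        proof -
          have "real N \<ge> 0" "Re \<alpha> \<le> \<bar>Re \<alpha>\<bar>" by simp_all
          then have "0 \<le> 2 * (real n - Re \<alpha>) - real N" using n by argo
          then have "(2 * (real n - Re \<alpha>) - real N) * Re s \<le> 0" using R(2) by (simp add: mult_nonneg_nonpos)
          then show ?thesis by (simp add: algebra_simps)
        qed
        ultimately have "2 * (real n * Re s + Re (- \<alpha> * s)) - real N * Re s \<le> 2 * \<bar>Im \<alpha>\<bar> * pi"
          by (simp add: algebra_simps)
        then show ?thesis using \<open>0 \<le> C\<close> by (intro mult_left_mono) auto
      qed
      finally show ?thesis by (simp add: E_def mult.commute)
    qed
    then have "norm (H x) \<le> sqrt E" if "x \<noteq> 0" "norm x < exp (min (c - 1) 0)" for x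
      using that real_le_rsqrt by blast
    then have "eventually (\<lambda>x. norm (H x) \<le> sqrt E) (at 0)"
      unfolding eventually_at by (intro exI[of _ "exp (min (c - 1) 0)"]) auto
    then show ?thesis by blast
  qed
  ultimately obtain H0 where H0: "H0 holomorphic_on ball 0 (exp c)" "\<And>x. x \<in> ball 0 (exp c) - {0} \<Longrightarrow> H0 x = H x"
    using holomorphic_on_extend_bounded[of H "ball 0 (exp c)" 0] by auto
  have yH: "y s = exp ((\<alpha> - of_nat n) * s) * H0 (exp s)" if s: "s \<in> half_plane c" for s
  proof -
    have "H0 (exp s) = exp s ^ n * g s"
      using H0(2)[of "exp s"] s exp_in_punctured_ball gG[OF s] by (auto simp: H_def)
    then show ?thesis
      by (simp add: g_def exp_of_nat_mult[symmetric] mult_exp_exp algebra_simps flip: mult.assoc)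
  qed
  have "H0 (exp s0) \<noteq> 0" using yH nz by auto
  moreover have "exp s0 \<in> ball 0 (exp c)" using nz exp_in_punctured_ball by blast
  ultimately obtain m h where h: "h holomorphic_on ball 0 (exp c)" "h 0 \<noteq> 0"
      "\<And>x. x \<in> ball 0 (exp c) \<Longrightarrow> H0 x = (x - 0) ^ m * h x"
    using factor_at_zero[OF H0(1) open_ball connected_ball centre_in_ball[THEN iffD2, OF exp_gt_zero],
      of "exp s0"] by blast
  define k where "k = \<alpha> - of_nat n + of_nat m"
  have yk: "y s = exp (k * s) * h (exp s)" if s: "s \<in> half_plane c" for s
  proof -
    have "H0 (exp s) = exp s ^ m * h (exp s)" using h(3)[of "exp s"] s exp_in_punctured_ball by auto
    then show ?thesis using yH[OF s]
      by (simp add: k_def exp_of_nat_mult[symmetric] mult_exp_exp algebra_simps flip: mult.assoc)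
  qed
  have "exp (2 * of_real pi * \<i> * k) = exp (2 * of_real pi * \<i> * \<alpha>) * exp (2 * of_real pi * \<i> * of_int (int m - int n))"
    by (simp add: k_def algebra_simps mult_exp_exp)
  also have "exp (2 * of_real pi * \<i> * of_int (int m - int n)) = 1"
    using exp_integer_2pi[of "of_int (int m - int n)"] by (simp add: mult_ac)
  finally have "exp (2 * of_real pi * \<i> * k) = \<mu>" using \<alpha> by simp
  then show ?thesis
    using that[OF h(1,2) yk _ indicial_equation[OF A y h(1,2) yk]] by blast
qed

text \<open>Applying \<open>y(s + 2 \<pi> \<i>) - \<mu> y(s)\<close> kills one summand and rescales the others, so that
  the summands are again solutions.\<close>

lemma eigencomponents_are_solutions:
  assumes "finite L"
    and "\<And>l s. l \<in> L \<Longrightarrow> s \<in> half_plane c \<Longrightarrow> u l (s + 2 * of_real pi * \<i>) = l * u l s"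
    and "euler_ode A1 A2 A3 c (\<lambda>s. \<Sum>l\<in>L. u l s)" and "l \<in> L"
  shows "euler_ode A1 A2 A3 c (u l)"
  using assms
proof (induction L arbitrary: u l rule: finite_induct)
  case (insert m L)
  define y where "y = (\<lambda>s. \<Sum>l\<in>insert m L. u l s)"
  define v where "v = (\<lambda>l s. (l - m) * u l s)"
  have y: "ode3 (\<lambda>s. A1 (exp s)) (\<lambda>s. A2 (exp s)) (\<lambda>s. A3 (exp s)) (half_plane c) y"
    using insert.prems(2) by (simp add: euler_ode_def y_def)
  have a: "ode3 (\<lambda>s. A1 (exp s)) (\<lambda>s. A2 (exp s)) (\<lambda>s. A3 (exp s)) (half_plane c)
      (\<lambda>s. 1 * y (s + 2 * of_real pi * \<i>) + (- m) * y s)"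
    by (rule ode3_lincomb[OF open_half_plane _ y])
       (use euler_ode_shift[of A1 A2 A3 c y] y in \<open>simp add: euler_ode_def\<close>)
  have b: "1 * y (s + 2 * of_real pi * \<i>) + (- m) * y s = (\<Sum>l\<in>L. v l s)" if "s \<in> half_plane c" for s
    using insert.hyps insert.prems(1) that
    by (simp add: y_def v_def sum_distrib_left sum_subtractf sum_negf algebra_simps cong: sum.cong)
  have "euler_ode A1 A2 A3 c (\<lambda>s. \<Sum>l\<in>L. v l s)"
    unfolding euler_ode_def by (rule ode3_cong[OF open_half_plane _ _ _ b a]) auto
  moreover have "v l (s + 2 * of_real pi * \<i>) = l * v l s" if "l \<in> L" "s \<in> half_plane c" for l s
    using insert.prems(1)[of l s] that by (simp add: v_def)
  ultimately have v: "euler_ode A1 A2 A3 c (v l)" if "l \<in> L" for l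
    using insert.IH[of v l] that by blast
  have uL: "euler_ode A1 A2 A3 c (u l)" if "l \<in> L" for l
  proof -
    have "l \<noteq> m" using that insert.hyps by auto
    then have e: "(\<lambda>s. (1 / (l - m)) * v l s + 0 * v l s) = u l" by (auto simp: v_def)
    show ?thesis
      using ode3_lincomb[OF open_half_plane v[OF that, unfolded euler_ode_def] v[OF that, unfolded euler_ode_def],
        of "1 / (l - m)" 0] unfolding e euler_ode_def .
  qed
  have sumL: "ode3 (\<lambda>s. A1 (exp s)) (\<lambda>s. A2 (exp s)) (\<lambda>s. A3 (exp s)) (half_plane c) (\<lambda>s. \<Sum>l\<in>L'. u l s)"
    if "finite L'" "L' \<subseteq> L" for L'
    using that
  proof (induction L' rule: finite_induct)
    case empty
    show ?case by (simp add: ode3_def)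
  next
    case (insert l L')
    then show ?case
      using ode3_lincomb[OF open_half_plane uL[of l, unfolded euler_ode_def] insert.IH, of 1 1] by simp
  qed
  have e: "(\<lambda>s. 1 * y s + (-1) * (\<Sum>l\<in>L. u l s)) = u m"
    using insert.hyps by (auto simp: y_def)
  have "euler_ode A1 A2 A3 c (u m)"
    using ode3_lincomb[OF open_half_plane y sumL[OF insert.hyps(1) subset_refl], of 1 "-1"]
    unfolding e euler_ode_def .
  then show ?case using uL insert.prems(3) by auto
qed simp

text \<open>Grouping the summands by their multipliers gives a finite sum of solutions, each of which has a
  multiplier. The multiplier of a nonzero one comes from a root of the indicial equation.\<close>

lemma multiplier_from_power_sum:
  assumes A: "A1 holomorphic_on ball 0 (exp c)" "A2 holomorphic_on ball 0 (exp c)"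
      "A3 holomorphic_on ball 0 (exp c)"
    and y: "euler_ode A1 A2 A3 c y" and "finite E"
    and sum: "\<And>s. s \<in> half_plane c \<Longrightarrow> y s = (\<Sum>\<alpha>\<in>E. exp (\<alpha> * s) * f \<alpha> (exp s))"
    and roots: "\<And>k. k ^ 3 + A1 0 * k ^ 2 + A2 0 * k + A3 0 = 0 \<Longrightarrow> exp (2 * of_real pi * \<i> * k) = \<mu>"
    and s: "s \<in> half_plane c"
  shows "y (s + 2 * of_real pi * \<i>) = \<mu> * y s"
proof -
  define e where "e = (\<lambda>\<alpha>. exp (2 * of_real pi * \<i> * \<alpha>))"
  define u where "u = (\<lambda>l s. \<Sum>\<alpha> | \<alpha> \<in> E \<and> e \<alpha> = l. exp (\<alpha> * s) * f \<alpha> (exp s))"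
  have fin: "finite (e ` E)" using assms(5) by simp
  have ysum: "y s = (\<Sum>l\<in>e ` E. u l s)" if "s \<in> half_plane c" for s
    unfolding sum[OF that] u_def using sum.image_gen[OF assms(5)] by blast
  have um: "u l (s + 2 * of_real pi * \<i>) = l * u l s" for l s
    unfolding u_def sum_distrib_left
    by (rule sum.cong) (auto simp: e_def exp_add exp_add_2pi algebra_simps)
  have "euler_ode A1 A2 A3 c (\<lambda>s. \<Sum>l\<in>e ` E. u l s)"
    unfolding euler_ode_def
    by (rule ode3_cong[OF open_half_plane _ _ _ ysum y[unfolded euler_ode_def]]) auto
  then have u: "euler_ode A1 A2 A3 c (u l)" if "l \<in> e ` E" for l
    using eigencomponents_are_solutions[OF fin, of c u A1 A2 A3 l] um that by blast
  have "u l (s + 2 * of_real pi * \<i>) = \<mu> * u l s" if l: "l \<in> e ` E" for l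
  proof (cases "u l s = 0")
    case False
    obtain k where "exp (2 * of_real pi * \<i> * k) = l" "k ^ 3 + A1 0 * k ^ 2 + A2 0 * k + A3 0 = 0"
      using multiplicative_solution[OF A u[OF l] um s False] by blast
    then show ?thesis using roots um by auto
  qed (simp add: um)
  then show ?thesis
    using ysum[OF s] ysum[OF half_plane_add_2pi[THEN iffD2, OF s]] by (simp add: sum_distrib_left)
qed

section \<open>Bol's lemma and logarithmic charts\<close>

text \<open>A solution is a branch of a multivalued function and has no natural domain; being a solution is
  therefore a property of the germ at a point.\<close>

definition sol_at :: "(complex \<Rightarrow> complex) \<Rightarrow> (complex \<Rightarrow> complex) \<Rightarrow> (complex \<Rightarrow> complex) \<Rightarrow> complex \<Rightarrow> bool" where
  "sol_at Q2 Q3 Y z \<longleftrightarrow> (\<exists>U. open U \<and> z \<in> U \<and> ode3 (\<lambda>_. 0) Q2 Q3 U Y)"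

lemma sol_at_cong:
  assumes "sol_at Q2 Q3 X z" "eventually (\<lambda>w. X w = Y w) (nhds z)"
  shows "sol_at Q2 Q3 Y z"
proof -
  obtain U where U: "open U" "z \<in> U" "ode3 (\<lambda>_. 0) Q2 Q3 U X" using assms by (auto simp: sol_at_def)
  obtain V where V: "open V" "z \<in> V" "\<And>w. w \<in> V \<Longrightarrow> X w = Y w"
    using assms(2) unfolding eventually_nhds by blast
  have X: "ode3 (\<lambda>_. 0) Q2 Q3 (U \<inter> V) X" using ode3_subset[OF U(3), of "U \<inter> V"] by simp
  have "ode3 (\<lambda>_. 0) Q2 Q3 (U \<inter> V) Y"
    by (rule ode3_cong[OF open_Int[OF U(1) V(1)] refl refl refl _ X]) (use V(3) in simp)
  then show ?thesis unfolding sol_at_def using U(1,2) V(1,2) by blast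
qed

lemma sol_at_analytic: "sol_at Q2 Q3 Y z \<Longrightarrow> Y analytic_on {z}"
  unfolding sol_at_def ode3_def by (meson analytic_at)

text \<open>Bol's lemma: weight \<open>-2\<close> is the weight for which the third derivative of a slashed function is
  the slashed third derivative; the quasi-modular anomaly of \<open>Q3\<close> is cancelled by the term with
  \<open>Q2 y'\<close>.\<close>

lemma bol_transformation:
  fixes t :: complex
  defines "g \<equiv> \<lambda>z. - 1 / (z + t)"
  assumes Y: "sol_at Q2 Q3 Y (g z)" and z: "z + t \<noteq> 0"
    and an: "Q2 analytic_on {z}" "Q2 analytic_on {g z}"
    and Q2: "eventually (\<lambda>w. Q2 (g w) = (w + t) ^ 4 * Q2 w) (nhds z)"
    and Q3: "eventually (\<lambda>w. Q3 (g w) - deriv Q2 (g w) / 2 = (w + t) ^ 6 * (Q3 w - deriv Q2 w / 2)) (nhds z)"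
  shows "sol_at Q2 Q3 (\<lambda>w. (w + t) ^ 2 * Y (g w)) z"
proof -
  obtain V where V: "open V" "g z \<in> V" "ode3 (\<lambda>_. 0) Q2 Q3 V Y" using Y by (auto simp: sol_at_def)
  obtain V1 where V1: "open V1" "g z \<in> V1" "Q2 holomorphic_on V1" using an(2) unfolding analytic_at by blast
  obtain U1 where U1: "open U1" "z \<in> U1" "Q2 holomorphic_on U1" using an(1) unfolding analytic_at by blast
  obtain U2 where U2: "open U2" "z \<in> U2" "\<And>w. w \<in> U2 \<Longrightarrow> Q2 (g w) = (w + t) ^ 4 * Q2 w \<and>
      Q3 (g w) - deriv Q2 (g w) / 2 = (w + t) ^ 6 * (Q3 w - deriv Q2 w / 2)"
    using eventually_conj[OF Q2 Q3] unfolding eventually_nhds by blast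
  have cont: "continuous_on (- {- t}) g"
    unfolding g_def by (intro continuous_intros) (auto simp: add_eq_0_iff2)
  define W where "W = - {- t} \<inter> g -` (V \<inter> V1)"
  have "open W" unfolding W_def
    by (rule continuous_open_preimage[OF cont]) (use V(1) V1(1) in \<open>auto intro: open_Compl\<close>)
  define U where "U = U1 \<inter> U2 \<inter> W"
  have U: "open U" "z \<in> U"
    using U1 U2 \<open>open W\<close> V(2) V1(2) z by (auto simp: U_def W_def add_eq_0_iff2)
  have nz: "w + t \<noteq> 0" if "w \<in> U" for w using that by (auto simp: U_def W_def add_eq_0_iff2)
  have gV: "g w \<in> V" "g w \<in> V1" if "w \<in> U" for w using that by (auto simp: U_def W_def)
  have dg: "(g has_field_derivative 1 / (w + t) ^ 2) (at w)" if "w \<in> U" for w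
    unfolding g_def using nz[OF that] by (auto intro!: derivative_eq_intros simp: power2_eq_square)
  have comp: "((\<lambda>w. f (g w)) has_field_derivative f' / (w + t) ^ 2) (at w)"
    if "w \<in> U" "(f has_field_derivative f') (at (g w))" for f f' w
    using DERIV_chain2[of f f' g w, OF that(2) dg[OF that(1)]] by simp
  note D = ode3_derivs[OF V(3,1)]
  define Y1 where "Y1 = deriv Y"
  define Y2 where "Y2 = (deriv ^^ 2) Y"
  define Y3 where "Y3 = (deriv ^^ 3) Y"
  note D = D[folded Y1_def Y2_def Y3_def]
  have "ode3 (\<lambda>_. 0) Q2 Q3 U (\<lambda>w. (w + t) ^ 2 * Y (g w))"
  proof (rule ode3I[OF U(1)])
    fix w assume w: "w \<in> U"
    note nz = nz[OF w] and C = comp[OF w D(1)[OF gV(1)[OF w]]] comp[OF w D(2)[OF gV(1)[OF w]]]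
      comp[OF w D(3)[OF gV(1)[OF w]]]
    have dx: "((\<lambda>w. w + t) has_field_derivative 1) (at w)"
      by (auto intro!: derivative_eq_intros)
    have dx2: "((\<lambda>w. (w + t) ^ 2) has_field_derivative 2 * (w + t)) (at w)"
      by (auto intro!: derivative_eq_intros)
    have nz2: "(w + t) ^ 2 \<noteq> 0" using nz by simp
    have alg1: "2 * x * A + B / x ^ 2 * x ^ 2 = 2 * x * A + B" if "x \<noteq> 0" for x A B :: complex
      using that by simp
    have alg2: "2 * (1 * A + B / x ^ 2 * x) + C / x ^ 2 = 2 * A + 2 * B / x + C / x ^ 2"
      if "x \<noteq> 0" for x A B C :: complex
      using that by (simp add: field_simps power2_eq_square)
    have alg3: "2 * (A / x ^ 2) + (2 * (B / x ^ 2) * x - 2 * A * 1) / (x * x) + (C / x ^ 2 * x ^ 2 - B * (2 * x)) / (x ^ 2 * x ^ 2)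
        = C / x ^ 4" if "x \<noteq> 0" for x A B C :: complex
      using that by (simp add: field_simps power_numeral_reduce)
    show "((\<lambda>w. (w + t) ^ 2 * Y (g w)) has_field_derivative
        2 * (w + t) * Y (g w) + Y1 (g w)) (at w)"
      by (rule DERIV_cong[OF DERIV_mult[OF dx2 C(1)] alg1[OF nz]])
    have "((\<lambda>w. 2 * ((w + t) * Y (g w)) + Y1 (g w)) has_field_derivative
        2 * Y (g w) + 2 * Y1 (g w) / (w + t) + Y2 (g w) / (w + t) ^ 2) (at w)"
      by (rule DERIV_cong[OF DERIV_add[OF DERIV_cmult[OF DERIV_mult[OF dx C(1)]] C(2)] alg2[OF nz]])
    then show "((\<lambda>w. 2 * (w + t) * Y (g w) + Y1 (g w)) has_field_derivative
        2 * Y (g w) + 2 * Y1 (g w) / (w + t) + Y2 (g w) / (w + t) ^ 2) (at w)"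
      by (simp only: mult.assoc)
    show "((\<lambda>w. 2 * Y (g w) + 2 * Y1 (g w) / (w + t) + Y2 (g w) / (w + t) ^ 2) has_field_derivative
        Y3 (g w) / (w + t) ^ 4) (at w)"
      by (rule DERIV_cong[OF DERIV_add[OF DERIV_add[OF DERIV_cmult[OF C(1)]
            DERIV_divide[OF DERIV_cmult[OF C(2)] dx nz]] DERIV_divide[OF C(3) dx2 nz2]] alg3[OF nz]])
    have q2: "Q2 (g w) = (w + t) ^ 4 * Q2 w" using U2(3) w by (auto simp: U_def)
    \<comment> \<open>differentiating the transformation law of \<open>Q2\<close>\<close>
    have "((\<lambda>w. Q2 (g w)) has_field_derivative deriv Q2 (g w) / (w + t) ^ 2) (at w)"
      using comp[OF w holomorphic_derivI[OF V1(3,1) gV(2)[OF w]]] .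
    moreover have "((\<lambda>w. Q2 (g w)) has_field_derivative 4 * (w + t) ^ 3 * Q2 w + (w + t) ^ 4 * deriv Q2 w) (at w)"
    proof (rule has_field_derivative_transform_within_open[OF _ U(1) w])
      show "((\<lambda>w. (w + t) ^ 4 * Q2 w) has_field_derivative 4 * (w + t) ^ 3 * Q2 w + (w + t) ^ 4 * deriv Q2 w) (at w)"
        using holomorphic_derivI[OF U1(3,1), of w] w
        by (auto intro!: derivative_eq_intros simp: U_def)
    qed (use U2(3) in \<open>auto simp: U_def\<close>)
    ultimately have "deriv Q2 (g w) / (w + t) ^ 2 = 4 * (w + t) ^ 3 * Q2 w + (w + t) ^ 4 * deriv Q2 w"
      by (rule DERIV_unique)
    then have dq: "deriv Q2 (g w) = (w + t) ^ 2 * (4 * (w + t) ^ 3 * Q2 w + (w + t) ^ 4 * deriv Q2 w)"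
      using nz by (simp add: nonzero_divide_eq_eq mult.commute)
    have "Q3 (g w) - deriv Q2 (g w) / 2 = (w + t) ^ 6 * (Q3 w - deriv Q2 w / 2)"
      using U2(3) w by (auto simp: U_def)
    moreover have "a = x ^ 4 * (x ^ 2 * p + 2 * x * q)"
      if "a - x ^ 2 * (4 * x ^ 3 * q + x ^ 4 * d) / 2 = x ^ 6 * (p - d / 2)" for a x p q d :: complex
    proof -
      have "a = x ^ 6 * (p - d / 2) + x ^ 2 * (4 * x ^ 3 * q + x ^ 4 * d) / 2"
        using that by (simp only: diff_eq_eq)
      also have "\<dots> = x ^ 4 * (x ^ 2 * p + 2 * x * q)"
        by (simp add: field_simps power_numeral_reduce)
      finally show ?thesis .
    qed
    ultimately have q3: "Q3 (g w) = (w + t) ^ 4 * ((w + t) ^ 2 * Q3 w + 2 * (w + t) * Q2 w)"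
      unfolding dq by blast
    have alg5: "A = - (q * B + (x ^ 2 * p + 2 * x * q) * C) \<Longrightarrow>
        A + 0 * D + q * (2 * x * C + B) + p * (x ^ 2 * C) = 0" for A B C D x p q :: complex
      by hypsubst (simp add: algebra_simps)
    have alg4: "A + X * (q * B + p * D) = 0" if "A + 0 * C + X * q * B + X * p * D = 0"
      for A B C D X p q :: complex
      using that by (simp add: algebra_simps)
    have "Y3 (g w) + (w + t) ^ 4 * (Q2 w * Y1 (g w) + ((w + t) ^ 2 * Q3 w + 2 * (w + t) * Q2 w) * Y (g w)) = 0"
      by (rule alg4[of _ "Y2 (g w)"]) (use D(4)[OF gV(1)[OF w]] in \<open>simp only: q2 q3\<close>)
    moreover have "A / x = - B" if "A + x * B = 0" "x \<noteq> 0" for A B x :: complex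
      using that by (simp add: field_simps eq_neg_iff_add_eq_0)
    ultimately have "Y3 (g w) / (w + t) ^ 4 = - (Q2 w * Y1 (g w) + ((w + t) ^ 2 * Q3 w + 2 * (w + t) * Q2 w) * Y (g w))"
      using nz by simp
    then show "Y3 (g w) / (w + t) ^ 4 + 0 * (2 * Y (g w) + 2 * Y1 (g w) / (w + t) + Y2 (g w) / (w + t) ^ 2)
        + Q2 w * (2 * (w + t) * Y (g w) + Y1 (g w)) + Q3 w * ((w + t) ^ 2 * Y (g w)) = 0"
      by (rule alg5)
  qed
  then show ?thesis unfolding sol_at_def using U by blast
qed

text \<open>In the coordinate \<open>s\<close> with \<open>z = z0 + exp s\<close> the equation becomes
  \<open>y''' - 3 y'' + (2 + x\<^sup>2 Q2) y' + x\<^sup>3 Q3 y = 0\<close> with \<open>x = exp s\<close>.\<close>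

locale log_chart =
  fixes Q2 Q3 :: "complex \<Rightarrow> complex" and z0 :: complex and r :: real and B2 B3 :: "complex \<Rightarrow> complex"
  assumes r: "r > 0"
    and B2_hol: "B2 holomorphic_on ball 0 r" and B3_hol: "B3 holomorphic_on ball 0 r"
    and B2: "\<And>x. x \<in> ball 0 r - {0} \<Longrightarrow> B2 x = x ^ 2 * Q2 (z0 + x)"
    and B3: "\<And>x. x \<in> ball 0 r - {0} \<Longrightarrow> B3 x = x ^ 3 * Q3 (z0 + x)"
begin

abbreviation log_ode :: "complex set \<Rightarrow> (complex \<Rightarrow> complex) \<Rightarrow> bool" where
  "log_ode \<equiv> ode3 (\<lambda>s. - 3) (\<lambda>s. 2 + B2 (exp s)) (\<lambda>s. B3 (exp s))"

abbreviation H where "H \<equiv> half_plane (ln r)"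

lemma euler_log_ode: "euler_ode (\<lambda>_. - 3) (\<lambda>x. 2 + B2 x) B3 c y \<longleftrightarrow> log_ode (half_plane c) y"
  by (simp add: euler_ode_def)

lemma in_H: "s \<in> H \<longleftrightarrow> exp s \<in> ball 0 r - {0}"
  using exp_in_punctured_ball[of s "ln r"] r by simp

lemma coeffs_hol:
  "(\<lambda>s. - 3) holomorphic_on H" "(\<lambda>s. 2 + B2 (exp s)) holomorphic_on H" "(\<lambda>s. B3 (exp s)) holomorphic_on H"
proof -
  have "exp holomorphic_on H" "exp ` H \<subseteq> ball (0::complex) r"
    using in_H by (auto intro: holomorphic_intros)
  then have "(\<lambda>s. B2 (exp s)) holomorphic_on H" "(\<lambda>s. B3 (exp s)) holomorphic_on H"
    using holomorphic_on_compose_gen[of exp H _ "ball 0 r"] B2_hol B3_hol by (auto simp: o_def)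
  then show "(\<lambda>s. 2 + B2 (exp s)) holomorphic_on H" "(\<lambda>s. B3 (exp s)) holomorphic_on H"
    by (auto intro: holomorphic_intros)
qed auto

lemma sol_at_imp_log_ode:
  assumes "sol_at Q2 Q3 Y (z0 + exp s)" "s \<in> H"
  shows "\<exists>U. open U \<and> s \<in> U \<and> U \<subseteq> H \<and> log_ode U (\<lambda>t. Y (z0 + exp t))"
proof -
  obtain V where V: "open V" "z0 + exp s \<in> V" "ode3 (\<lambda>_. 0) Q2 Q3 V Y"
    using assms(1) by (auto simp: sol_at_def)
  define U where "U = (\<lambda>t. z0 + exp t) -` V \<inter> H"
  have "open ((\<lambda>t. z0 + exp t) -` V)"
    by (rule open_vimage[OF V(1)]) (intro continuous_intros)
  then have U: "open U" "s \<in> U" "U \<subseteq> H"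
    using V(2) assms(2) open_half_plane by (auto simp: U_def)
  define Y1 where "Y1 = deriv Y"
  define Y2 where "Y2 = (deriv ^^ 2) Y"
  define Y3 where "Y3 = (deriv ^^ 3) Y"
  note D = ode3_derivs[OF V(3,1), folded Y1_def Y2_def Y3_def]
  have de: "((\<lambda>t. z0 + exp t) has_field_derivative exp t) (at t)" for t
    by (auto intro!: derivative_eq_intros)
  have comp: "((\<lambda>t. f (z0 + exp t)) has_field_derivative f' * exp t) (at t)"
    if "(f has_field_derivative f') (at (z0 + exp t))" for f f' and t :: complex
    using DERIV_chain2[of f f' "\<lambda>t. z0 + exp t" t, OF that de] .
  have "log_ode U (\<lambda>t. Y (z0 + exp t))"
  proof (rule ode3I[OF U(1)])
    fix t assume t: "t \<in> U"
    then have tV: "z0 + exp t \<in> V" and tH: "exp t \<in> ball 0 r - {0}" using in_H by (auto simp: U_def)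
    note C = comp[OF D(1)[OF tV]] comp[OF D(2)[OF tV]] comp[OF D(3)[OF tV]]
    show "((\<lambda>t. Y (z0 + exp t)) has_field_derivative exp t * Y1 (z0 + exp t)) (at t)"
      using C(1) by (simp add: mult.commute)
    show "((\<lambda>t. exp t * Y1 (z0 + exp t)) has_field_derivative
        exp t ^ 2 * Y2 (z0 + exp t) + exp t * Y1 (z0 + exp t)) (at t)"
      by (auto intro!: derivative_eq_intros C simp: algebra_simps power2_eq_square)
    show "((\<lambda>t. exp t ^ 2 * Y2 (z0 + exp t) + exp t * Y1 (z0 + exp t)) has_field_derivative
        exp t ^ 3 * Y3 (z0 + exp t) + 3 * exp t ^ 2 * Y2 (z0 + exp t) + exp t * Y1 (z0 + exp t)) (at t)"
      by (auto intro!: derivative_eq_intros C simp: algebra_simps power2_eq_square power3_eq_cube)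
    have "exp t ^ 3 * Y3 (z0 + exp t) + 3 * exp t ^ 2 * Y2 (z0 + exp t) + exp t * Y1 (z0 + exp t)
        + (- 3) * (exp t ^ 2 * Y2 (z0 + exp t) + exp t * Y1 (z0 + exp t))
        + (2 + B2 (exp t)) * (exp t * Y1 (z0 + exp t)) + B3 (exp t) * Y (z0 + exp t)
        = exp t ^ 3 * (Y3 (z0 + exp t) + 0 * Y2 (z0 + exp t) + Q2 (z0 + exp t) * Y1 (z0 + exp t) + Q3 (z0 + exp t) * Y (z0 + exp t))"
      unfolding B2[OF tH] B3[OF tH] by (simp add: algebra_simps power2_eq_square power3_eq_cube)
    also have "\<dots> = 0" using D(4)[OF tV] by simp
    finally show "exp t ^ 3 * Y3 (z0 + exp t) + 3 * exp t ^ 2 * Y2 (z0 + exp t) + exp t * Y1 (z0 + exp t)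
        + (- 3) * (exp t ^ 2 * Y2 (z0 + exp t) + exp t * Y1 (z0 + exp t))
        + (2 + B2 (exp t)) * (exp t * Y1 (z0 + exp t)) + B3 (exp t) * Y (z0 + exp t) = 0" .
  qed
  then show ?thesis using U by blast
qed

lemma log_ode_imp_sol_at:
  assumes y: "log_ode V y" "open V" "V \<subseteq> H" and l: "l holomorphic_on U" "open U" "z \<in> U" "l z \<in> V"
    and el: "\<And>w. w \<in> U \<Longrightarrow> z0 + exp (l w) = w"
  shows "sol_at Q2 Q3 (\<lambda>w. y (l w)) z"
proof -
  define W where "W = U \<inter> l -` V"
  have W: "open W" "z \<in> W"
    using l y(2) continuous_open_preimage[OF holomorphic_on_imp_continuous_on[OF l(1)] l(2) y(2)]
    by (auto simp: W_def)
  define y1 where "y1 = deriv y"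
  define y2 where "y2 = (deriv ^^ 2) y"
  define y3 where "y3 = (deriv ^^ 3) y"
  note D = ode3_derivs[OF y(1,2), folded y1_def y2_def y3_def]
  have xl: "w - z0 = exp (l w)" if "w \<in> W" for w using el[of w] that by (simp add: W_def algebra_simps)
  have dl: "(l has_field_derivative 1 / (w - z0)) (at w)" if w: "w \<in> W" for w
  proof -
    have l': "(l has_field_derivative deriv l w) (at w)"
      using holomorphic_derivI[OF l(1,2)] w by (auto simp: W_def)
    have "((\<lambda>w. z0 + exp (l w)) has_field_derivative exp (l w) * deriv l w) (at w)"
      by (auto intro!: derivative_eq_intros l')
    moreover have "((\<lambda>w. z0 + exp (l w)) has_field_derivative 1) (at w)"
      by (rule has_field_derivative_transform_within_open[OF DERIV_ident W(1) w]) (use el in \<open>auto simp: W_def\<close>)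
    ultimately have "exp (l w) * deriv l w = 1" by (rule DERIV_unique)
    then have "deriv l w = 1 / (w - z0)" unfolding xl[OF w] by (simp add: nonzero_eq_divide_eq mult.commute)
    then show ?thesis using l' by simp
  qed
  have comp: "((\<lambda>w. f (l w)) has_field_derivative f' / (w - z0)) (at w)"
    if "w \<in> W" "(f has_field_derivative f') (at (l w))" for f f' w
    using DERIV_chain2[of f f' l w, OF that(2) dl[OF that(1)]] by simp
  have "ode3 (\<lambda>_. 0) Q2 Q3 W (\<lambda>w. y (l w))"
  proof (rule ode3I[OF W(1)])
    fix w assume w: "w \<in> W"
    then have lV: "l w \<in> V" by (simp add: W_def)
    then have tH: "w - z0 \<in> ball 0 r - {0}" using in_H[of "l w"] y(3) xl[OF w] by auto
    then have nz: "w - z0 \<noteq> 0" by auto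
    note C = comp[OF w D(1)[OF lV]] comp[OF w D(2)[OF lV]] comp[OF w D(3)[OF lV]]
    show "((\<lambda>w. y (l w)) has_field_derivative y1 (l w) / (w - z0)) (at w)" by (rule C(1))
    show "((\<lambda>w. y1 (l w) / (w - z0)) has_field_derivative (y2 (l w) - y1 (l w)) / (w - z0) ^ 2) (at w)"
      using nz by (auto intro!: derivative_eq_intros C simp: divide_simps power2_eq_square; simp add: algebra_simps)
    show "((\<lambda>w. (y2 (l w) - y1 (l w)) / (w - z0) ^ 2) has_field_derivative
        (y3 (l w) - 3 * y2 (l w) + 2 * y1 (l w)) / (w - z0) ^ 3) (at w)"
      using nz by (auto intro!: derivative_eq_intros C simp: divide_simps; simp add: algebra_simps power_numeral_reduce)
    have "(w - z0) ^ 3 * ((y3 (l w) - 3 * y2 (l w) + 2 * y1 (l w)) / (w - z0) ^ 3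
        + Q2 w * (y1 (l w) / (w - z0)) + Q3 w * y (l w))
        = y3 (l w) + (- 3) * y2 (l w) + (2 + (w - z0) ^ 2 * Q2 w) * y1 (l w) + (w - z0) ^ 3 * Q3 w * y (l w)"
      using nz by (simp add: divide_simps) (simp add: algebra_simps power_numeral_reduce)
    also have "\<dots> = 0"
      using D(4)[OF lV] B2[OF tH] B3[OF tH] by (simp add: xl[OF w, symmetric])
    finally show "(y3 (l w) - 3 * y2 (l w) + 2 * y1 (l w)) / (w - z0) ^ 3
        + 0 * ((y2 (l w) - y1 (l w)) / (w - z0) ^ 2)
        + Q2 w * (y1 (l w) / (w - z0)) + Q3 w * y (l w) = 0"
      using nz by simp
  qed
  then show ?thesis unfolding sol_at_def using W by blast
qed

lemma log_ode_exists:
  assumes "s \<in> H"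
  obtains y where "log_ode H y" "y s = c0" "deriv y s = c1" "(deriv ^^ 2) y s = c2"
  using ode3_solution_exists[OF open_half_plane convex_half_plane assms coeffs_hol] by blast

lemma sol_at_extends:
  assumes "sol_at Q2 Q3 Y (z0 + exp s)" "s \<in> H"
  obtains y where "log_ode H y" "eventually (\<lambda>t. y t = Y (z0 + exp t)) (nhds s)"
proof -
  obtain U where U: "open U" "s \<in> U" "U \<subseteq> H" "log_ode U (\<lambda>t. Y (z0 + exp t))"
    using sol_at_imp_log_ode[OF assms] by blast
  obtain e where e: "e > 0" "ball s e \<subseteq> U" using U(1,2) by (meson open_contains_ball)
  obtain y where y: "log_ode H y" "y s = Y (z0 + exp s)" "deriv y s = deriv (\<lambda>t. Y (z0 + exp t)) s"
      "(deriv ^^ 2) y s = (deriv ^^ 2) (\<lambda>t. Y (z0 + exp t)) s"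
    using log_ode_exists[OF assms(2)] by blast
  have eH: "ball s e \<subseteq> H" using e U by auto
  have "y t = Y (z0 + exp t)" if "t \<in> ball s e" for t
    by (rule ode3_unique[OF open_ball connected_ball _ _ _ ode3_subset[OF y(1) eH] ode3_subset[OF U(4) e(2)] _ y(2-4) that])
       (use coeffs_hol eH e holomorphic_on_subset in auto)
  then have "eventually (\<lambda>t. y t = Y (z0 + exp t)) (nhds s)"
    unfolding eventually_nhds using e(1) by (intro exI[of _ "ball s e"]) auto
  then show ?thesis using that y(1) by blast
qed

end

section \<open>Germs of solutions at a point with scalar local monodromy\<close>

text \<open>The coefficient \<open>c\<close> may be zero, so that for fixed \<open>m\<close> the germs form a linear space on which
  \<open>c\<close> is a linear functional.\<close>

definition lead :: "nat \<Rightarrow> complex \<Rightarrow> (complex \<Rightarrow> complex) \<Rightarrow> bool" where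
  "lead m c h \<longleftrightarrow> (\<exists>g. g analytic_on {0} \<and> g 0 = c \<and> eventually (\<lambda>x. h x = x ^ m * g x) (nhds 0))"

lemma lead_lincomb:
  assumes "lead m c1 h1" "lead m c2 h2"
  shows "lead m (a * c1 + b * c2) (\<lambda>x. a * h1 x + b * h2 x)"
proof -
  obtain g1 g2 where g: "g1 analytic_on {0}" "g1 0 = c1" "eventually (\<lambda>x. h1 x = x ^ m * g1 x) (nhds 0)"
     "g2 analytic_on {0}" "g2 0 = c2" "eventually (\<lambda>x. h2 x = x ^ m * g2 x) (nhds 0)"
    using assms unfolding lead_def by blast
  show ?thesis unfolding lead_def
  proof (intro exI[of _ "\<lambda>x. a * g1 x + b * g2 x"] conjI)
    show "(\<lambda>x. a * g1 x + b * g2 x) analytic_on {0}" by (intro analytic_intros g)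
    show "eventually (\<lambda>x. a * h1 x + b * h2 x = x ^ m * (a * g1 x + b * g2 x)) (nhds 0)"
      using g(3,6) by eventually_elim (simp add: algebra_simps)
  qed (use g in auto)
qed

lemma lead_zero:
  assumes "lead m c h" "eventually (\<lambda>x. h x = 0) (nhds 0)"
  shows "c = 0"
proof (rule ccontr)
  assume c: "c \<noteq> 0"
  obtain g where g: "g analytic_on {0}" "g 0 = c" "eventually (\<lambda>x. h x = x ^ m * g x) (nhds 0)"
    using assms unfolding lead_def by blast
  have "isCont g 0" using g(1) analytic_at_imp_isCont by blast
  then have "g \<midarrow>0\<rightarrow> c" using g(2) by (simp add: isCont_def)
  moreover have "eventually (\<lambda>x. g x = 0) (at 0)"
    using eventually_conj[OF g(3) assms(2)] unfolding eventually_at_filter by eventually_elim auto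
  then have "g \<midarrow>0\<rightarrow> 0" using tendsto_eventually by blast
  ultimately show False using c LIM_unique by blast
qed

lemma higher_deriv_power_mult:
  assumes "g holomorphic_on ball 0 e" "e > 0"
  shows "(deriv ^^ m) (\<lambda>x. x ^ m * g x) 0 = fact m * g 0"
proof -
  have p: "(deriv ^^ i) (\<lambda>x::complex. x ^ m) 0 = (if i = m then fact m else 0)" if "i \<le> m" for i
    using higher_deriv_power[of i 0 m 0] that
    by (auto simp: pochhammer_fact[symmetric])
  have "(deriv ^^ m) (\<lambda>x. x ^ m * g x) 0
      = (\<Sum>i = 0..m. of_nat (m choose i) * (deriv ^^ i) (\<lambda>x. x ^ m) 0 * (deriv ^^ (m - i)) g 0)"
    by (rule higher_deriv_mult[OF _ assms(1) open_ball]) (use assms in \<open>auto intro: holomorphic_intros\<close>)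
  also have "\<dots> = (\<Sum>i = 0..m. if i = m then fact m * g 0 else 0)"
    by (rule sum.cong) (auto simp: p)
  finally show ?thesis by simp
qed

lemma two_linear_equations:
  fixes a0 a1 a2 b0 b1 b2 :: complex
  obtains c0 c1 c2 where "c0 \<noteq> 0 \<or> c1 \<noteq> 0 \<or> c2 \<noteq> 0"
    "c0 * a0 + c1 * a1 + c2 * a2 = 0" "c0 * b0 + c1 * b1 + c2 * b2 = 0"
proof -
  consider "a1 * b2 - a2 * b1 \<noteq> 0 \<or> a2 * b0 - a0 * b2 \<noteq> 0 \<or> a0 * b1 - a1 * b0 \<noteq> 0"
    | "a1 * b2 = a2 * b1" "a2 * b0 = a0 * b2" "a0 * b1 = a1 * b0" by auto
  then show ?thesis
  proof cases
    case 1
    then show ?thesis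
      by (rule that) (simp_all add: algebra_simps)
  next
    case 2
    consider "a0 \<noteq> 0 \<or> a1 \<noteq> 0" | "a0 = 0" "a1 = 0" "b0 \<noteq> 0 \<or> b1 \<noteq> 0"
      | "a0 = 0" "a1 = 0" "b0 = 0" "b1 = 0" by auto
    then show ?thesis
    proof cases
      case 1
      show ?thesis by (rule that[of a1 "- a0" 0]) (use 1 2 in \<open>auto simp: algebra_simps\<close>)
    next
      case 2
      show ?thesis by (rule that[of b1 "- b0" 0]) (use 2 in \<open>auto simp: algebra_simps\<close>)
    next
      case 3
      show ?thesis by (rule that[of 1 0 0]) (use 3 in auto)
    qed
  qed
qed

text \<open>If no logarithms occur and the exponents \<open>k\<close>, \<open>k + m2\<close>, \<open>k + m3\<close> differ by integers, a loop around
  \<open>z0\<close> multiplies every solution by the same number \<open>exp (2 \<pi> \<i> k)\<close>. The integer \<open>n = 3 k\<close> makes it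
  a cube root of unity, so that cubic monomials in solutions are single-valued.\<close>

locale scalar_point = log_chart +
  fixes k :: real and m2 m3 :: nat and n :: int
  assumes m: "0 < m2" "m2 < m3" and n: "3 * k = of_int n"
    and mono: "\<And>y s. log_ode H y \<Longrightarrow> s \<in> H \<Longrightarrow>
        y (s + 2 * of_real pi * \<i>) = exp (2 * of_real pi * \<i> * of_real k) * y s"
    and indicial: "\<And>\<kappa>. \<kappa> ^ 3 + (- 3) * \<kappa> ^ 2 + (2 + B2 0) * \<kappa> + B3 0 = 0 \<Longrightarrow>
        \<exists>m\<in>{0, m2, m3}. \<kappa> = of_real k + of_nat m"
begin

abbreviation K where "K \<equiv> complex_of_real k"

text \<open>A solution near \<open>z0\<close> is \<open>(z - z0)\<^sup>k h(z - z0)\<close>; the regular part \<open>h\<close> represents it by an honest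
  holomorphic germ.\<close>

definition germ_sol :: "(complex \<Rightarrow> complex) \<Rightarrow> bool" where
  "germ_sol h \<longleftrightarrow> (\<exists>e. 0 < e \<and> e \<le> r \<and> h holomorphic_on ball 0 e \<and>
     log_ode (half_plane (ln e)) (\<lambda>s. exp (K * s) * h (exp s)))"

lemma exp_ln_r [simp]: "exp (ln r) = r" using r by simp

lemma exp_K_cube: "exp (K * s) ^ 3 = exp s powi n"
proof -
  have "3 * K = of_int n" using n by (metis of_real_mult of_real_numeral of_real_of_int_eq)
  then have "exp (K * s) ^ 3 = exp (of_int n * s)"
    by (subst exp_of_nat_mult[symmetric]) (simp add: mult.assoc[symmetric])
  then show ?thesis by (simp add: exp_power_int)
qed

lemma half_plane_mono: "e \<le> e' \<Longrightarrow> 0 < e \<Longrightarrow> half_plane (ln e) \<subseteq> half_plane (ln e')"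
  unfolding half_plane_def by (intro subsetI CollectI, drule CollectD, erule less_le_trans) simp

lemma in_half_plane_ln: "e > 0 \<Longrightarrow> s \<in> half_plane (ln e) \<longleftrightarrow> exp s \<in> ball 0 e - {0}"
  using exp_in_punctured_ball[of s "ln e"] by simp

lemma holomorphic_part:
  assumes y: "log_ode H y"
  obtains h where "h holomorphic_on ball 0 r" "\<And>s. s \<in> H \<Longrightarrow> y s = exp (K * s) * h (exp s)"
proof (cases "\<exists>s\<in>H. y s \<noteq> 0")
  case False
  then show ?thesis using that[of "\<lambda>_. 0"] by auto
next
  case True
  then obtain s0 where s0: "s0 \<in> H" "y s0 \<noteq> 0" by blast
  obtain \<kappa> h where h: "h holomorphic_on ball 0 r" "h 0 \<noteq> 0"
      "\<And>s. s \<in> H \<Longrightarrow> y s = exp (\<kappa> * s) * h (exp s)"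
      "\<kappa> ^ 3 + (- 3) * \<kappa> ^ 2 + (2 + B2 0) * \<kappa> + B3 0 = 0"
  proof (rule multiplicative_solution[of "\<lambda>_. - 3" "ln r" "\<lambda>x. 2 + B2 x" B3 y _ s0])
    show "euler_ode (\<lambda>_. - 3) (\<lambda>x. 2 + B2 x) B3 (ln r) y" using y euler_log_ode by simp
    show "y (s + 2 * of_real pi * \<i>) = exp (2 * of_real pi * \<i> * of_real k) * y s" if "s \<in> H" for s
      using mono[OF y that] .
  qed (use s0 B2_hol B3_hol in \<open>auto intro!: holomorphic_intros\<close>)
  obtain m where m: "\<kappa> = K + of_nat m" using indicial[OF h(4)] by blast
  show ?thesis
  proof (rule that[of "\<lambda>x. x ^ m * h x"])
    show "(\<lambda>x. x ^ m * h x) holomorphic_on ball 0 r" by (intro holomorphic_intros h)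
    show "y s = exp (K * s) * (exp s ^ m * h (exp s))" if "s \<in> H" for s
      using h(3)[OF that] unfolding m by (simp add: distrib_right exp_add exp_of_nat_mult)
  qed
qed

lemma germ_sol_of_log_ode:
  assumes y: "log_ode H y" and h: "h holomorphic_on ball 0 r" "\<And>s. s \<in> H \<Longrightarrow> y s = exp (K * s) * h (exp s)"
  shows "germ_sol h"
  unfolding germ_sol_def
  by (intro exI[of _ r] conjI r order_refl h(1) ode3_cong[OF open_half_plane refl refl refl h(2) y])

lemma germ_sol_lincomb:
  assumes "germ_sol h1" "germ_sol h2"
  shows "germ_sol (\<lambda>x. a * h1 x + b * h2 x)"
proof -
  obtain e1 where e1: "0 < e1" "e1 \<le> r" "h1 holomorphic_on ball 0 e1"
     "log_ode (half_plane (ln e1)) (\<lambda>s. exp (K * s) * h1 (exp s))"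
    using assms(1) by (auto simp: germ_sol_def)
  obtain e2 where e2: "0 < e2" "e2 \<le> r" "h2 holomorphic_on ball 0 e2"
     "log_ode (half_plane (ln e2)) (\<lambda>s. exp (K * s) * h2 (exp s))"
    using assms(2) by (auto simp: germ_sol_def)
  define e where "e = min e1 e2"
  have e: "0 < e" "e \<le> r" "e \<le> e1" "e \<le> e2" using e1 e2 by (auto simp: e_def)
  have o: "log_ode (half_plane (ln e)) (\<lambda>s. a * (exp (K * s) * h1 (exp s)) + b * (exp (K * s) * h2 (exp s)))"
    by (rule ode3_lincomb[OF open_half_plane ode3_subset[OF e1(4)] ode3_subset[OF e2(4)]])
       (use half_plane_mono e in auto)
  have eq: "(\<lambda>s. a * (exp (K * s) * h1 (exp s)) + b * (exp (K * s) * h2 (exp s)))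
      = (\<lambda>s. exp (K * s) * (a * h1 (exp s) + b * h2 (exp s)))"
    by (auto simp: algebra_simps)
  have "(\<lambda>x. a * h1 x + b * h2 x) holomorphic_on ball 0 e"
    using e1(3) e2(3) e by (intro holomorphic_intros; elim holomorphic_on_subset) auto
  then show ?thesis using o e unfolding germ_sol_def eq by blast
qed

text \<open>If \<open>h\<close> has order \<open>m\<close>, the solution is \<open>(z - z0)\<^bsup>k + m\<^esup>\<close> times a function that does not vanish at
  \<open>z0\<close>, so \<open>k + m\<close> satisfies the indicial equation.\<close>

lemma germ_order:
  assumes "germ_sol h" and nz: "\<not> eventually (\<lambda>x. h x = 0) (nhds 0)"
  shows "\<exists>m\<in>{0, m2, m3}. \<exists>e g. 0 < e \<and> g holomorphic_on ball 0 e \<and> g 0 \<noteq> 0 \<and> (\<forall>x\<in>ball 0 e. h x = x ^ m * g x)"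
proof -
  obtain e where e: "0 < e" "e \<le> r" "h holomorphic_on ball 0 e"
     "log_ode (half_plane (ln e)) (\<lambda>s. exp (K * s) * h (exp s))"
    using assms(1) by (auto simp: germ_sol_def)
  have "\<exists>w\<in>ball 0 e. h w \<noteq> 0"
  proof (rule ccontr)
    assume "\<not> ?thesis"
    then have "eventually (\<lambda>x. h x = 0) (nhds 0)"
      unfolding eventually_nhds using e(1) by (intro exI[of _ "ball 0 e"]) auto
    then show False using nz by blast
  qed
  then obtain w where w: "w \<in> ball 0 e" "h w \<noteq> 0" by blast
  have z: "0 \<in> ball (0::complex) e" using e by simp
  obtain m g where g: "g holomorphic_on ball 0 e" "g 0 \<noteq> 0" "\<And>x. x \<in> ball 0 e \<Longrightarrow> h x = (x - 0) ^ m * g x"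
    using factor_at_zero[OF e(3) open_ball connected_ball z w] by blast
  have yg: "exp (K * s) * h (exp s) = exp ((K + of_nat m) * s) * g (exp s)" if "s \<in> half_plane (ln e)" for s
  proof -
    have "exp s \<in> ball 0 e" using that in_half_plane_ln[OF e(1)] by blast
    then show ?thesis using g(3) by (simp add: distrib_right exp_add exp_of_nat_mult)
  qed
  have el: "exp (ln e) = e" using e by simp
  have "(K + of_nat m) ^ 3 + (- 3) * (K + of_nat m) ^ 2 + (2 + B2 0) * (K + of_nat m) + B3 0 = 0"
    by (rule indicial_equation[of "\<lambda>_. - 3" "ln e" "\<lambda>x. 2 + B2 x" B3, OF _ _ _ _ _ _ yg])
       (use e g B2_hol B3_hol in \<open>auto simp: euler_ode_def el intro!: holomorphic_intros elim: holomorphic_on_subset\<close>)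
  from indicial[OF this] obtain m' where "m' \<in> {0, m2, m3}" "K + of_nat m = K + of_nat m'" by blast
  then have "m \<in> {0, m2, m3}" by auto
  then show ?thesis using e g by (intro bexI[of _ m] exI[of _ e] exI[of _ g]) auto
qed

lemma germ_lead:
  assumes "germ_sol h" "\<not> eventually (\<lambda>x. h x = 0) (nhds 0)"
  obtains m c where "m \<in> {0, m2, m3}" "c \<noteq> 0" "lead m c h"
proof -
  obtain m e g where g: "m \<in> {0, m2, m3}" "0 < e" "g holomorphic_on ball 0 e" "g 0 \<noteq> 0"
      "\<And>x. x \<in> ball 0 e \<Longrightarrow> h x = x ^ m * g x"
    using germ_order[OF assms] by blast
  have "lead m (g 0) h" unfolding lead_def
  proof (intro exI[of _ g] conjI refl)
    show "g analytic_on {0}" using g(2,3) unfolding analytic_at by (meson centre_in_ball open_ball)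
    show "eventually (\<lambda>x. h x = x ^ m * g x) (nhds 0)"
      unfolding eventually_nhds using g by (intro exI[of _ "ball 0 e"]) auto
  qed
  then show ?thesis using that g by blast
qed

text \<open>On the three-dimensional solution space, two coefficients can be made to vanish by a nonzero
  solution; its order is then the third exponent.\<close>

lemma germ_exists:
  assumes "m \<in> {0, m2, m3}"
  obtains h c where "germ_sol h" "c \<noteq> 0" "lead m c h"
proof -
  have "\<exists>m' m''. {0, m2, m3} = {m, m', m''} \<and> m \<noteq> m' \<and> m \<noteq> m''"
  proof -
    have "{0, m2, m3} = {m2, 0, m3}" "{0, m2, m3} = {m3, 0, m2}" by auto
    moreover have "m = 0 \<or> m = m2 \<or> m = m3" using assms by simp
    ultimately show ?thesis using m by (metis less_irrefl less_trans)
  qed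
  then obtain m' m'' where m': "{0, m2, m3} = {m, m', m''}" "m \<noteq> m'" "m \<noteq> m''" by blast
  define s0 where "s0 = complex_of_real (ln r - 1)"
  have s0: "s0 \<in> H" by (simp add: s0_def half_plane_def)
  obtain y0 where y0: "log_ode H y0" "y0 s0 = 1" "deriv y0 s0 = 0" "(deriv ^^ 2) y0 s0 = 0"
    using log_ode_exists[OF s0] by blast
  obtain y1 where y1: "log_ode H y1" "y1 s0 = 0" "deriv y1 s0 = 1" "(deriv ^^ 2) y1 s0 = 0"
    using log_ode_exists[OF s0] by blast
  obtain y2 where y2: "log_ode H y2" "y2 s0 = 0" "deriv y2 s0 = 0" "(deriv ^^ 2) y2 s0 = 1"
    using log_ode_exists[OF s0] by blast
  obtain h0 where h0: "h0 holomorphic_on ball 0 r" "\<And>s. s \<in> H \<Longrightarrow> y0 s = exp (K * s) * h0 (exp s)"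
    using holomorphic_part[OF y0(1)] by blast
  obtain h1 where h1: "h1 holomorphic_on ball 0 r" "\<And>s. s \<in> H \<Longrightarrow> y1 s = exp (K * s) * h1 (exp s)"
    using holomorphic_part[OF y1(1)] by blast
  obtain h2 where h2: "h2 holomorphic_on ball 0 r" "\<And>s. s \<in> H \<Longrightarrow> y2 s = exp (K * s) * h2 (exp s)"
    using holomorphic_part[OF y2(1)] by blast
  define D where "D = (\<lambda>h. (deriv ^^ m') h (0::complex))"
  define D' where "D' = (\<lambda>h. (deriv ^^ m'') h (0::complex))"
  obtain c0 c1 c2 where c: "c0 \<noteq> 0 \<or> c1 \<noteq> 0 \<or> c2 \<noteq> 0" "c0 * D h0 + c1 * D h1 + c2 * D h2 = 0"
      "c0 * D' h0 + c1 * D' h1 + c2 * D' h2 = 0"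
    using two_linear_equations[of "D h0" "D h1" "D h2" "D' h0" "D' h1" "D' h2"] by blast
  define h where "h = (\<lambda>x. 1 * (c0 * h0 x + c1 * h1 x) + c2 * h2 x)"
  define y where "y = (\<lambda>s. 1 * (c0 * y0 s + c1 * y1 s) + c2 * y2 s)"
  have y: "log_ode H y" unfolding y_def
    by (intro ode3_lincomb open_half_plane y0 y1 y2)
  have hh: "h holomorphic_on ball 0 r" unfolding h_def by (intro holomorphic_intros h0 h1 h2)
  have yh: "y s = exp (K * s) * h (exp s)" if "s \<in> H" for s
    using h0(2) h1(2) h2(2) that by (simp add: y_def h_def algebra_simps)
  have dh: "(deriv ^^ j) h 0 = c0 * (deriv ^^ j) h0 0 + c1 * (deriv ^^ j) h1 0 + c2 * (deriv ^^ j) h2 0" for j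
  proof -
    have z: "0 \<in> ball (0::complex) r" using r by simp
    show ?thesis unfolding h_def mult_1
      by (subst higher_deriv_add[OF _ _ open_ball z]; (intro holomorphic_intros h0 h1 h2)?)+
         (simp add: higher_deriv_cmult[OF h0(1) z open_ball] higher_deriv_cmult[OF h1(1) z open_ball]
           higher_deriv_cmult[OF h2(1) z open_ball])
  qed
  have hs: "germ_sol h" by (rule germ_sol_of_log_ode[OF y hh yh])
  have nz: "\<not> eventually (\<lambda>x. h x = 0) (nhds 0)"
  proof
    assume "eventually (\<lambda>x. h x = 0) (nhds 0)"
    then obtain U where U: "open U" "0 \<in> U" "\<And>x. x \<in> U \<Longrightarrow> h x = 0" unfolding eventually_nhds by blast
    have "h x = 0" if "x \<in> ball 0 r" for x
      by (rule analytic_continuation_open[of "U \<inter> ball 0 r" "ball 0 r" h "\<lambda>_. 0"])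
         (use U r hh that in \<open>auto intro!: open_Int\<close>)
    then have y0': "y s = 0" if "s \<in> H" for s
      using yh[OF that] that in_H by auto
    have "(deriv ^^ j) y s0 = 0" for j
      using higher_deriv_transform_within_open[of y H "\<lambda>_. 0" s0 j] y0' y s0 open_half_plane
      by (simp add: ode3_def)
    moreover have "(deriv ^^ j) y s0 = c0 * (deriv ^^ j) y0 s0 + c1 * (deriv ^^ j) y1 s0 + c2 * (deriv ^^ j) y2 s0" for j
    proof -
      have hol: "y0 holomorphic_on H" "y1 holomorphic_on H" "y2 holomorphic_on H"
        using y0 y1 y2 by (auto simp: ode3_def)
      show ?thesis unfolding y_def mult_1
        by (subst higher_deriv_add[OF _ _ open_half_plane s0]; (intro holomorphic_intros hol)?)+
           (simp add: higher_deriv_cmult[OF hol(1) s0 open_half_plane] higher_deriv_cmult[OF hol(2) s0 open_half_plane]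
             higher_deriv_cmult[OF hol(3) s0 open_half_plane])
    qed
    ultimately have "c0 * (deriv ^^ j) y0 s0 + c1 * (deriv ^^ j) y1 s0 + c2 * (deriv ^^ j) y2 s0 = 0" for j
      by metis
    from this[of 0] this[of 1] this[of 2] show False using c(1) y0 y1 y2 by simp
  qed
  obtain q e g where q: "q \<in> {0, m2, m3}" "0 < e" "g holomorphic_on ball 0 e" "g 0 \<noteq> 0"
      "\<And>x. x \<in> ball 0 e \<Longrightarrow> h x = x ^ q * g x"
    using germ_order[OF hs nz] by blast
  have "(deriv ^^ q) h 0 = (deriv ^^ q) (\<lambda>x. x ^ q * g x) 0"
  proof (rule higher_deriv_transform_within_open[of _ "ball 0 e \<inter> ball 0 r"])
    show "(\<lambda>x. x ^ q * g x) holomorphic_on ball 0 e \<inter> ball 0 r"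
      using q(3) by (intro holomorphic_intros; elim holomorphic_on_subset) auto
  qed (use q r hh in \<open>auto elim: holomorphic_on_subset\<close>)
  then have "(deriv ^^ q) h 0 \<noteq> 0" using higher_deriv_power_mult[OF q(3,2)] q(4) by simp
  then have "q \<noteq> m'" "q \<noteq> m''" using c(2,3) dh unfolding D_def D'_def by auto
  then have "q = m" using q(1) m' by auto
  have "lead m (g 0) h" unfolding lead_def \<open>q = m\<close>[symmetric]
  proof (intro exI[of _ g] conjI refl)
    show "g analytic_on {0}" using q(2,3) unfolding analytic_at by (meson centre_in_ball open_ball)
    show "eventually (\<lambda>x. h x = x ^ q * g x) (nhds 0)"
      unfolding eventually_nhds using q by (intro exI[of _ "ball 0 e"]) auto
  qed
  then show ?thesis using that hs q(4) by blast
qed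

end

section \<open>Elliptic fixed points\<close>

text \<open>
  The substitution \<open>z \<mapsto> - 1 / (z + t)\<close> fixes \<open>z0\<close>; with \<open>z = z0 + x\<close> it reads \<open>x \<mapsto> G x\<close>, and
  \<open>P\<close> is the factor of automorphy inverted and normalised to \<open>P 0 = 1\<close>. On the regular part \<open>h\<close> of a
  solution \<open>(z - z0)\<^sup>k h(z - z0)\<close> the action of weight \<open>-2\<close> becomes the operator \<open>U\<close>, up to a constant
  factor. The assumption \<open>cocycle\<close> says that the substitution has order \<open>N\<close> and that the normalised
  factors multiply to \<open>1\<close> along an orbit.
\<close>

locale elliptic_point = scalar_point +
  fixes t :: complex and N :: nat
  assumes z0t: "z0 + t \<noteq> 0" and fixed: "z0 = - 1 / (z0 + t)"
    and laws: "eventually (\<lambda>z. Q2 (- 1 / (z + t)) = (z + t) ^ 4 * Q2 z \<and>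
        Q3 (- 1 / (z + t)) - deriv Q2 (- 1 / (z + t)) / 2 = (z + t) ^ 6 * (Q3 z - deriv Q2 z / 2)) (at z0)"
    and N: "N > 0"
    and cocycle: "eventually (\<lambda>x. ((\<lambda>x. x / ((z0 + t) * (z0 + t + x))) ^^ N) x = x \<and>
        (\<Prod>i<N. (z0 + t) / (z0 + t + ((\<lambda>x. x / ((z0 + t) * (z0 + t + x))) ^^ i) x)) = 1) (nhds 0)"
begin

definition j0 where "j0 = z0 + t"
definition G :: "complex \<Rightarrow> complex" where "G x = x / (j0 * (j0 + x))"
definition P :: "complex \<Rightarrow> complex" where "P x = j0 / (j0 + x)"
definition \<zeta> where "\<zeta> = 1 / j0 ^ 2"
definition U :: "(complex \<Rightarrow> complex) \<Rightarrow> complex \<Rightarrow> complex" where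
  "U h x = exp ((K - 2) * Ln (P x)) * h (G x)"

lemma j0: "j0 \<noteq> 0" using z0t by (simp add: j0_def)

lemma zeta_nz: "\<zeta> \<noteq> 0" using j0 by (simp add: \<zeta>_def)

lemma G_P: "j0 + x \<noteq> 0 \<Longrightarrow> G x = x * P x * \<zeta>"
  using j0 by (simp add: G_def P_def \<zeta>_def field_simps power2_eq_square)

lemma mobius_G: "j0 + x \<noteq> 0 \<Longrightarrow> - 1 / (z0 + x + t) = z0 + G x"
proof -
  assume x: "j0 + x \<noteq> 0"
  have f: "z0 = - 1 / j0" using fixed by (simp add: j0_def)
  have e: "z0 + x + t = j0 + x" by (simp add: j0_def algebra_simps)
  have "1 / j0 - 1 / (j0 + x) = x / (j0 * (j0 + x))" using x j0 by (simp add: diff_frac_eq)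
  then have "- 1 / (j0 + x) = - 1 / j0 + x / (j0 * (j0 + x))" by (simp add: algebra_simps)
  then show ?thesis by (simp only: e G_def f[symmetric])
qed

lemma P_right: "norm x < norm j0 \<Longrightarrow> P x \<notin> \<real>\<^sub>\<le>\<^sub>0 \<and> P x \<noteq> 0 \<and> j0 + x \<noteq> 0"
proof -
  assume x: "norm x < norm j0"
  have nz: "j0 + x \<noteq> 0" using x by (metis add_eq_0_iff2 norm_minus_cancel less_irrefl)
  have "norm (x / j0) < 1" using x by (simp add: norm_divide divide_less_eq_1)
  then have "Re (1 + x / j0) > 0" using abs_Re_le_cmod[of "x / j0"] by simp
  then have "Re (inverse (1 + x / j0)) > 0"
    by (simp add: Re_divide inverse_eq_divide) (smt (verit) divide_pos_pos sum_power2_gt_zero_iff zero_le_power2)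
  moreover have "P x = inverse (1 + x / j0)" using j0 nz by (simp add: P_def field_simps)
  ultimately have "Re (P x) > 0" by simp
  then show ?thesis using nz j0 complex_nonpos_Reals_iff by (force simp: P_def)
qed

lemma G_analytic: "G analytic_on {0}" and P_analytic: "P analytic_on {0}"
  and LnP_analytic: "(\<lambda>x. Ln (P x)) analytic_on {0}"
proof -
  show G: "G analytic_on {0}" unfolding G_def using j0 by (intro analytic_intros) auto
  show P: "P analytic_on {0}" unfolding P_def using j0 by (intro analytic_intros) auto
  show "(\<lambda>x. Ln (P x)) analytic_on {0}"
    using P_right[of 0] j0 by (intro analytic_intros P) auto
qed

lemma G0 [simp]: "G 0 = 0" and P0 [simp]: "P 0 = 1" using j0 by (auto simp: G_def P_def)

lemma isCont_imp_nhds: "isCont f (0::complex) \<Longrightarrow> filterlim f (nhds (f 0)) (nhds 0)"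
  by (simp add: isCont_def tendsto_at_iff_tendsto_nhds)

lemma tendsto_G: "filterlim G (nhds 0) (nhds 0)"
  using isCont_imp_nhds[OF analytic_at_imp_isCont[OF G_analytic]] by simp

lemma eventually_G: "eventually Q (nhds 0) \<Longrightarrow> eventually (\<lambda>x. Q (G x)) (nhds 0)"
  by (rule eventually_compose_filterlim[OF _ tendsto_G])

lemma U_lincomb: "U (\<lambda>x. a * h1 x + b * h2 x) = (\<lambda>x. a * U h1 x + b * U h2 x)"
  by (auto simp: U_def algebra_simps)

lemma U_power: "(U ^^ i) h x = exp ((K - 2) * (\<Sum>l<i. Ln (P ((G ^^ l) x)))) * h ((G ^^ i) x)"
proof (induction i arbitrary: x)
  case (Suc i)
  have "(U ^^ Suc i) h x = exp ((K - 2) * Ln (P x)) * (U ^^ i) h (G x)" by (simp add: U_def)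
  also have "\<dots> = exp ((K - 2) * (Ln (P x) + (\<Sum>l<i. Ln (P ((G ^^ l) (G x)))))) * h ((G ^^ i) (G x))"
    by (simp add: Suc distrib_left exp_add)
  also have "Ln (P x) + (\<Sum>l<i. Ln (P ((G ^^ l) (G x)))) = (\<Sum>l<Suc i. Ln (P ((G ^^ l) x)))"
    by (subst sum.lessThan_Suc_shift) (simp add: funpow_swap1)
  finally show ?case by (simp add: funpow_swap1)
qed simp

lemma G_power_cont: "filterlim (G ^^ i) (nhds 0) (nhds 0)"
proof (induction i)
  case 0 show ?case by (simp add: filterlim_ident id_def)
next
  case (Suc i)
  show ?case using filterlim_compose[OF tendsto_G Suc] by (simp add: o_def)
qed

text \<open>The automorphy factors along an orbit multiply to \<open>1\<close>. The sum of their principal logarithms is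
  therefore a logarithm of \<open>1\<close>, and it is \<open>0\<close> because it is small near the fixed point.\<close>

lemma U_finite_order: "eventually (\<lambda>x. (U ^^ N) h x = h x) (nhds 0)"
proof -
  have Geq: "(\<lambda>x. x / ((z0 + t) * (z0 + t + x))) = G" by (auto simp: G_def j0_def)
  have c: "eventually (\<lambda>x. (G ^^ N) x = x \<and> (\<Prod>i<N. P ((G ^^ i) x)) = 1) (nhds 0)"
    using cocycle unfolding Geq by (simp add: P_def j0_def)
  define S where "S = (\<lambda>x. \<Sum>l<N. Ln (P ((G ^^ l) x)))"
  have "filterlim (\<lambda>x. Ln (P x)) (nhds (Ln (P 0))) (nhds 0)"
    by (rule isCont_imp_nhds[OF analytic_at_imp_isCont[OF LnP_analytic]])
  then have L: "((\<lambda>x. Ln (P x)) \<longlongrightarrow> 0) (nhds 0)" by simp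
  have "(S \<longlongrightarrow> (\<Sum>l<N. 0)) (nhds 0)"
    unfolding S_def by (intro tendsto_sum filterlim_compose[OF L] G_power_cont)
  then have "eventually (\<lambda>x. norm (S x) < 1) (nhds 0)"
    using tendstoD[of S 0 "nhds 0" 1] by simp
  moreover have "eventually (\<lambda>x. \<forall>l<N. norm ((G ^^ l) x) < norm j0) (nhds 0)"
  proof -
    have "eventually (\<lambda>x. norm ((G ^^ l) x) < norm j0) (nhds 0)" for l
      using tendstoD[OF G_power_cont[of l], of "norm j0"] j0 by simp
    then have "eventually (\<lambda>x. \<forall>l\<in>{..<N}. norm ((G ^^ l) x) < norm j0) (nhds 0)"
      by (intro eventually_ball_finite) auto
    then show ?thesis by eventually_elim auto
  qed
  ultimately show ?thesis using c
  proof eventually_elim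
    case (elim x)
    have "exp (S x) = (\<Prod>i<N. P ((G ^^ i) x))"
      unfolding S_def exp_sum[OF finite_lessThan]
      by (rule prod.cong) (use P_right elim(2) in auto)
    then have e0: "exp (S x) = exp 0" using elim(3) by simp
    have im: "\<bar>Im (S x) - Im 0\<bar> < 2 * pi"
      using abs_Im_le_cmod[of "S x"] elim(1) pi_gt3 by simp
    have S0: "S x = 0" by (rule exp_complex_eqI[OF im e0])
    have "(U ^^ N) h x = exp ((K - 2) * S x) * h ((G ^^ N) x)" by (simp only: U_power S_def)
    also have "\<dots> = h x" using elim(3) by (simp only: S0 mult_zero_right exp_zero mult_1)
    finally show ?case .
  qed
qed

lemma lead_U:
  assumes "lead m c h"
  shows "lead m (\<zeta> ^ m * c) (U h)"
proof -
  obtain g where g: "g analytic_on {0}" "g 0 = c" "eventually (\<lambda>x. h x = x ^ m * g x) (nhds 0)"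
    using assms unfolding lead_def by blast
  have e: "eventually (\<lambda>x. norm x < norm j0) (nhds 0)"
    unfolding eventually_nhds using j0 by (intro exI[of _ "ball 0 (norm j0)"]) auto
  have gG: "(\<lambda>x. g (G x)) analytic_on {0}"
    using analytic_on_compose[OF G_analytic, of g] g(1) by (simp add: o_def)
  show ?thesis unfolding lead_def
  proof (intro exI[of _ "\<lambda>x. exp ((K - 2) * Ln (P x)) * (P x * \<zeta>) ^ m * g (G x)"] conjI)
    show "(\<lambda>x. exp ((K - 2) * Ln (P x)) * (P x * \<zeta>) ^ m * g (G x)) analytic_on {0}"
      by (intro analytic_intros LnP_analytic P_analytic gG)
    show "eventually (\<lambda>x. U h x = x ^ m * (exp ((K - 2) * Ln (P x)) * (P x * \<zeta>) ^ m * g (G x))) (nhds 0)"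
      using eventually_G[OF g(3)] e
    proof eventually_elim
      case (elim x)
      then show ?case using G_P[of x] P_right[of x] by (simp add: U_def power_mult_distrib mult_ac)
    qed
  qed (simp add: g)
qed

lemma lead_U_power: "lead m c h \<Longrightarrow> lead m (\<zeta> ^ (m * i) * c) ((U ^^ i) h)"
proof (induction i)
  case (Suc i)
  have "lead m (\<zeta> ^ m * (\<zeta> ^ (m * i) * c)) (U ((U ^^ i) h))" by (rule lead_U[OF Suc.IH[OF Suc.prems]])
  then show ?case by (simp add: power_add mult_ac)
qed simp

lemma Q2_analytic: "z \<in> ball z0 r - {z0} \<Longrightarrow> Q2 analytic_on {z}"
proof -
  assume z: "z \<in> ball z0 r - {z0}"
  define V where "V = ball z0 r - {z0}"
  have "(\<lambda>w. B2 (w - z0)) holomorphic_on V"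
    using holomorphic_on_compose_gen[of "\<lambda>w. w - z0" V B2 "ball 0 r"] B2_hol
    by (force simp: o_def V_def dist_norm norm_minus_commute intro: holomorphic_intros)
  then have "(\<lambda>w. B2 (w - z0) / (w - z0) ^ 2) holomorphic_on V"
    by (intro holomorphic_intros) (auto simp: V_def)
  then have "Q2 holomorphic_on V"
  proof (rule holomorphic_transform)
    show "B2 (w - z0) / (w - z0) ^ 2 = Q2 w" if "w \<in> V" for w
      using B2[of "w - z0"] that by (auto simp: V_def dist_norm norm_minus_commute)
  qed
  moreover have "open V" "z \<in> V" using z by (auto simp: V_def)
  ultimately show ?thesis unfolding analytic_at by blast
qed

text \<open>Bol's lemma, written for the regular parts of solutions.\<close>

lemma germ_sol_U:
  assumes h: "germ_sol h"
  shows "germ_sol (U h)"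
proof -
  obtain e where e: "0 < e" "e \<le> r" "h holomorphic_on ball 0 e"
     "log_ode (half_plane (ln e)) (\<lambda>s. exp (K * s) * h (exp s))"
    using h by (auto simp: germ_sol_def)
  obtain d where d: "d > 0" "\<And>z. z \<noteq> z0 \<Longrightarrow> dist z z0 < d \<Longrightarrow> Q2 (- 1 / (z + t)) = (z + t) ^ 4 * Q2 z \<and>
        Q3 (- 1 / (z + t)) - deriv Q2 (- 1 / (z + t)) / 2 = (z + t) ^ 6 * (Q3 z - deriv Q2 z / 2)"
    using laws unfolding eventually_at by auto
  define e' where "e' = min (min r d) (min (norm j0 / 2) (e * norm j0 ^ 2 / 2))"
  have e': "0 < e'" "e' \<le> r" "e' \<le> d" "e' \<le> norm j0 / 2" "e' \<le> e * norm j0 ^ 2 / 2"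
    using r d(1) j0 e(1) by (auto simp: e'_def)
  have small: "norm x < norm j0" if "x \<in> ball 0 e'" for x
  proof -
    have "norm x < norm j0 / 2" using that e'(4) by simp
    also have "\<dots> \<le> norm j0" by simp
    finally show ?thesis .
  qed
  have Gsmall: "norm (G x) < e" if "x \<in> ball 0 e'" for x
  proof -
    have x: "norm x < norm j0 / 2" "norm x < e * norm j0 ^ 2 / 2" using that e' by auto
    have "norm j0 \<le> norm (j0 + x) + norm x" by (metis add_diff_cancel_right' norm_triangle_ineq4)
    then have "norm j0 / 2 \<le> norm (j0 + x)" using x by linarith
    moreover have "norm j0 > 0" using j0 by simp
    ultimately have pos: "norm (j0 + x) > 0" by linarith
    have "norm j0 / 2 \<le> norm (j0 + x)" by fact
    then have "norm j0 * (norm j0 / 2) \<le> norm j0 * norm (j0 + x)" by (intro mult_left_mono) auto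
    then have "norm (G x) \<le> norm x / (norm j0 * (norm j0 / 2))"
      unfolding G_def norm_divide norm_mult using j0 pos by (intro divide_left_mono) auto
    also have "\<dots> < e" using x(2) j0 by (simp add: field_simps power2_eq_square)
    finally show ?thesis .
  qed
  have Ghol: "G holomorphic_on ball 0 e'" and Phol: "P holomorphic_on ball 0 e'"
  proof -
    have "j0 + x \<noteq> 0" if "x \<in> ball 0 e'" for x using P_right[OF small[OF that]] by blast
    then show "G holomorphic_on ball 0 e'" "P holomorphic_on ball 0 e'"
      unfolding G_def P_def using j0 by (intro holomorphic_intros; simp)+
  qed
  have LPhol: "(\<lambda>x. Ln (P x)) holomorphic_on ball 0 e'"
    using small P_right by (intro holomorphic_intros Phol) auto
  have hG: "(\<lambda>x. h (G x)) holomorphic_on ball 0 e'"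
    using holomorphic_on_compose_gen[OF Ghol e(3)] Gsmall by (force simp: o_def)
  have Uhol: "U h holomorphic_on ball 0 e'"
    unfolding U_def by (intro holomorphic_intros LPhol hG)
  have "log_ode (half_plane (ln e')) (\<lambda>s. exp (K * s) * U h (exp s))"
  proof (rule ode3_pointwise[OF open_half_plane])
    fix s assume s: "s \<in> half_plane (ln e')"
    define x where "x = exp s"
    have x: "x \<in> ball 0 e' - {0}" using s in_half_plane_ln[OF e'(1)] by (simp add: x_def)
    have sH: "s \<in> H" using half_plane_mono[OF e'(2,1)] s by blast
    have Px: "P x \<notin> \<real>\<^sub>\<le>\<^sub>0" "P x \<noteq> 0" "j0 + x \<noteq> 0" using P_right small x by auto
    define s' where "s' = s + Ln (P x) + Ln \<zeta>"
    have es': "exp s' = G x"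
      using Px zeta_nz by (simp add: s'_def exp_add G_P x_def)
    have Gx: "G x \<noteq> 0" using x Px j0 by (simp add: G_def)
    obtain l where l: "l holomorphic_on ball (G x) (norm (G x))" "l (G x) = s'"
        "\<And>w. w \<in> ball (G x) (norm (G x)) \<Longrightarrow> exp (l w) = w"
      using local_log[OF Gx es'] by blast
    define y where "y = (\<lambda>s. exp (K * s) * h (exp s))"
    have s'e: "s' \<in> half_plane (ln e)" 
      unfolding in_half_plane_ln[OF e(1)] es' using Gsmall[of x] x Gx by auto
    have hl: "(\<lambda>w. l (w - z0)) holomorphic_on ball (z0 + G x) (norm (G x))"
      using holomorphic_on_compose_gen[of "\<lambda>w. w - z0" "ball (z0 + G x) (norm (G x))", OF _ l(1)]
      by (force simp: o_def dist_norm algebra_simps intro: holomorphic_intros)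
    have "sol_at Q2 Q3 (\<lambda>w. y (l (w - z0))) (z0 + G x)"
    proof (rule log_ode_imp_sol_at[OF e(4)[folded y_def] open_half_plane half_plane_mono[OF e(2,1)] hl open_ball])
      show "z0 + exp (l (w - z0)) = w" if "w \<in> ball (z0 + G x) (norm (G x))" for w
        using that l(3)[of "w - z0"] by (simp add: dist_norm algebra_simps)
    qed (use Gx l(2) s'e in auto)
    then have "sol_at Q2 Q3 (\<lambda>w. y (l (w - z0))) (- 1 / (z0 + x + t))"
      using mobius_G[OF Px(3)] by simp
    then have "sol_at Q2 Q3 (\<lambda>w. (w + t) ^ 2 * y (l (- 1 / (w + t) - z0))) (z0 + x)"
    proof (rule bol_transformation)
      show "z0 + x + t \<noteq> 0" using Px(3) by (simp add: j0_def algebra_simps)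
      show "Q2 analytic_on {z0 + x}" by (rule Q2_analytic) (use x e' in \<open>auto simp: dist_norm\<close>)
      show "Q2 analytic_on {- 1 / (z0 + x + t)}"
        unfolding mobius_G[OF Px(3)]
        by (rule Q2_analytic) (use x e Gsmall[of x] Gx in \<open>auto simp: dist_norm\<close>)
      have "eventually (\<lambda>w. w \<in> ball z0 e' - {z0}) (nhds (z0 + x))"
        by (rule eventually_nhds_in_open) (use x in \<open>auto simp: dist_norm\<close>)
      then have ev: "eventually (\<lambda>w. Q2 (- 1 / (w + t)) = (w + t) ^ 4 * Q2 w \<and>
        Q3 (- 1 / (w + t)) - deriv Q2 (- 1 / (w + t)) / 2 = (w + t) ^ 6 * (Q3 w - deriv Q2 w / 2)) (nhds (z0 + x))"
      proof eventually_elim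
        case (elim w)
        then show ?case using d(2)[of w] e'(3) by (simp add: dist_commute)
      qed
      show "eventually (\<lambda>w. Q2 (- 1 / (w + t)) = (w + t) ^ 4 * Q2 w) (nhds (z0 + x))"
        using ev by eventually_elim blast
      show "eventually (\<lambda>w. Q3 (- 1 / (w + t)) - deriv Q2 (- 1 / (w + t)) / 2
          = (w + t) ^ 6 * (Q3 w - deriv Q2 w / 2)) (nhds (z0 + x))"
        using ev by eventually_elim blast
    qed
    then obtain V where V: "open V" "s \<in> V" "V \<subseteq> H"
        "log_ode V (\<lambda>\<tau>. (z0 + exp \<tau> + t) ^ 2 * y (l (- 1 / (z0 + exp \<tau> + t) - z0)))"
      using sol_at_imp_log_ode[OF _ sH] unfolding x_def by blast
    define W where "W = half_plane (ln e') \<inter> (\<lambda>\<tau>. G (exp \<tau>)) -` ball (G x) (norm (G x))"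
    have eh: "exp holomorphic_on half_plane (ln e')" by (intro holomorphic_intros)
    have ei: "exp ` half_plane (ln e') \<subseteq> ball (0::complex) e'"
      using in_half_plane_ln[OF e'(1)] by blast
    have hG': "(\<lambda>\<tau>. G (exp \<tau>)) holomorphic_on half_plane (ln e')"
      using holomorphic_on_compose_gen[OF eh Ghol ei] by (simp add: o_def)
    have "open W" unfolding W_def
      by (rule continuous_open_preimage[OF holomorphic_on_imp_continuous_on[OF hG'] open_half_plane open_ball])
    have sW: "s \<in> W" using s Gx by (simp add: W_def x_def)
    define \<delta> where "\<delta> = (\<lambda>\<tau>. l (G (exp \<tau>)) - (\<tau> + Ln (P (exp \<tau>)) + Ln \<zeta>))"
    have "\<delta> holomorphic_on W"
    proof -
      have "(\<lambda>\<tau>. l (G (exp \<tau>))) holomorphic_on W"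
        using holomorphic_on_compose_gen[OF holomorphic_on_subset[OF hG'] l(1), of W]
        by (force simp: o_def W_def)
      moreover have "(\<lambda>\<tau>. Ln (P (exp \<tau>))) holomorphic_on W"
        using holomorphic_on_subset[OF holomorphic_on_compose_gen[OF eh LPhol ei], of W]
        by (simp add: o_def W_def)
      ultimately show ?thesis unfolding \<delta>_def
        by (intro holomorphic_on_diff holomorphic_on_add holomorphic_on_ident holomorphic_on_const)
    qed
    then have contW: "continuous_on W \<delta>" by (rule holomorphic_on_imp_continuous_on)
    define W' where "W' = V \<inter> (W \<inter> \<delta> -` ball 0 1)"
    have "open W'" unfolding W'_def
      by (intro open_Int V(1) continuous_open_preimage[OF contW \<open>open W\<close> open_ball])
    have "\<delta> s = 0" using l(2) by (simp add: \<delta>_def s'_def x_def)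
    then have sW': "s \<in> W'" using V(2) sW by (simp add: W'_def)
    define C where "C = j0 ^ 2 * exp (K * Ln \<zeta>)"
    have C: "C \<noteq> 0" using j0 by (simp add: C_def)
    have eq: "(z0 + exp \<tau> + t) ^ 2 * y (l (- 1 / (z0 + exp \<tau> + t) - z0)) = C * (exp (K * \<tau>) * U h (exp \<tau>))"
      if \<tau>: "\<tau> \<in> W'" for \<tau>
    proof -
      have xx: "exp \<tau> \<in> ball 0 e' - {0}" using in_half_plane_ln[OF e'(1)] \<tau> by (auto simp: W'_def W_def)
      have Pt: "P (exp \<tau>) \<noteq> 0" "j0 + exp \<tau> \<noteq> 0"
        using P_right[OF small, of "exp \<tau>"] xx by blast+
      have lG: "exp (l (G (exp \<tau>))) = G (exp \<tau>)" using l(3) \<tau> by (auto simp: W'_def W_def)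
      have "l (G (exp \<tau>)) = \<tau> + Ln (P (exp \<tau>)) + Ln \<zeta>"
      proof (rule exp_complex_eqI)
        have "norm (\<delta> \<tau>) < 1" using \<tau> by (auto simp: W'_def)
        then show "\<bar>Im (l (G (exp \<tau>))) - Im (\<tau> + Ln (P (exp \<tau>)) + Ln \<zeta>)\<bar> < 2 * pi"
          using abs_Im_le_cmod[of "\<delta> \<tau>"] pi_gt3 by (simp add: \<delta>_def)
        show "exp (l (G (exp \<tau>))) = exp (\<tau> + Ln (P (exp \<tau>)) + Ln \<zeta>)"
          unfolding lG using Pt zeta_nz by (simp add: exp_add G_P)
      qed
      then have "y (l (G (exp \<tau>))) = exp (K * \<tau>) * exp (K * Ln (P (exp \<tau>))) * exp (K * Ln \<zeta>) * h (G (exp \<tau>))"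
        using lG by (simp add: y_def distrib_left exp_add)
      moreover have "exp (K * Ln (P (exp \<tau>))) = exp ((K - 2) * Ln (P (exp \<tau>))) * P (exp \<tau>) ^ 2"
      proof -
        define L where "L = Ln (P (exp \<tau>))"
        have "exp (K * L) = exp ((K - 2) * L + (L + L))" by (simp add: algebra_simps)
        also have "\<dots> = exp ((K - 2) * L) * (exp L * exp L)" by (simp only: exp_add)
        also have "exp L = P (exp \<tau>)" using Pt by (simp add: L_def)
        finally show ?thesis by (simp add: L_def power2_eq_square)
      qed
      moreover have "- 1 / (z0 + exp \<tau> + t) - z0 = G (exp \<tau>)" using mobius_G[OF Pt(2)] by simp
      moreover have "z0 + exp \<tau> + t = j0 + exp \<tau>" by (simp add: j0_def)
      moreover have p2: "(j0 + exp \<tau>) ^ 2 * P (exp \<tau>) ^ 2 = j0 ^ 2"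
        using Pt(2) by (simp add: P_def power_divide)
      moreover have "X * (a * (L * p) * c * w) = (X * p) * c * (a * (L * w))" for X a L p c w :: complex
        by (simp add: mult_ac)
      ultimately show ?thesis unfolding C_def U_def by (simp only:)
    qed
    have o1: "log_ode W' (\<lambda>\<tau>. C * (exp (K * \<tau>) * U h (exp \<tau>)))"
      by (rule ode3_cong[OF \<open>open W'\<close> refl refl refl eq ode3_subset[OF V(4)]]) (simp_all add: W'_def)
    have o2: "log_ode W' (\<lambda>\<tau>. exp (K * \<tau>) * U h (exp \<tau>))"
    proof -
      have "(\<lambda>\<tau>. (1 / C) * (C * (exp (K * \<tau>) * U h (exp \<tau>))) + 0 * (C * (exp (K * \<tau>) * U h (exp \<tau>))))
          = (\<lambda>\<tau>. exp (K * \<tau>) * U h (exp \<tau>))"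
        using C by (intro ext) simp
      then show ?thesis using ode3_lincomb[OF \<open>open W'\<close> o1 o1, of "1 / C" 0] by (simp only:)
    qed
    then show "\<exists>U'. open U' \<and> s \<in> U' \<and> log_ode U' (\<lambda>s. exp (K * s) * U h (exp s))"
      using \<open>open W'\<close> sW' by blast
  qed
  then show ?thesis unfolding germ_sol_def using e' Uhol by blast
qed

lemma germ_sol_U_power: "germ_sol h \<Longrightarrow> germ_sol ((U ^^ i) h)"
  by (induction i) (auto intro: germ_sol_U)

text \<open>For \<open>l = N\<close>, and up to the factor \<open>N\<close>, this is the projection onto the eigenspace of \<open>U\<close> with
  eigenvalue \<open>\<eta>\<close>.\<close>

definition avg :: "complex \<Rightarrow> nat \<Rightarrow> (complex \<Rightarrow> complex) \<Rightarrow> complex \<Rightarrow> complex" where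
  "avg \<eta> l h x = (\<Sum>i<l. (1 / \<eta>) ^ i * (U ^^ i) h x)"

lemma avg_Suc: "avg \<eta> (Suc l) h = (\<lambda>x. 1 * avg \<eta> l h x + (1 / \<eta>) ^ l * (U ^^ l) h x)"
  by (auto simp: avg_def)

lemma germ_sol_avg: "germ_sol h \<Longrightarrow> germ_sol (avg \<eta> l h)"
proof (induction l)
  case 0
  have "(\<lambda>x. 0 * h x + 0 * h x) = avg \<eta> 0 h" by (auto simp: avg_def)
  then show ?case using germ_sol_lincomb[OF 0 0, of 0 0] by simp
next
  case (Suc l)
  show ?case unfolding avg_Suc by (intro germ_sol_lincomb Suc germ_sol_U_power)
qed

lemma lead_avg: "lead m c h \<Longrightarrow> \<eta> = \<zeta> ^ m \<Longrightarrow> lead m (of_nat l * c) (avg \<eta> l h)"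
proof (induction l)
  case 0
  have "(\<lambda>x. 0 * h x + 0 * h x) = avg \<eta> 0 h" by (auto simp: avg_def)
  then show ?case using lead_lincomb[OF 0(1) 0(1), of 0 0] by simp
next
  case (Suc l)
  have e: "1 * (of_nat l * c) + (1 / \<eta>) ^ l * (\<zeta> ^ (m * l) * c) = of_nat (Suc l) * c"
  proof -
    have "(1 / \<eta>) ^ l * \<zeta> ^ (m * l) = 1"
      using zeta_nz by (simp only: Suc.prems(2) power_mult power_one_over) simp
    then show ?thesis by (simp add: distrib_right mult.assoc[symmetric])
  qed
  show ?case unfolding avg_Suc e[symmetric]
    by (intro lead_lincomb Suc.IH lead_U_power Suc.prems)
qed

lemma U_avg: "\<eta> \<noteq> 0 \<Longrightarrow> U (avg \<eta> l h) x = \<eta> * (avg \<eta> l h x - h x + (1 / \<eta>) ^ l * (U ^^ l) h x)"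
proof (induction l)
  case 0 then show ?case by (simp add: avg_def U_def)
next
  case (Suc l)
  show ?case unfolding avg_Suc U_lincomb Suc.IH[OF Suc.prems]
    using Suc.prems by (simp add: algebra_simps)
qed

text \<open>The derivative of the substitution at its fixed point is \<open>\<zeta>\<close>, so \<open>U\<close> multiplies an \<open>m\<close>-th leading
  coefficient by \<open>\<zeta> ^ m\<close>. Projecting a germ of order \<open>m\<close> onto that eigenspace multiplies its leading
  coefficient by \<open>N\<close> and so does not destroy it.\<close>

lemma eigen_germ:
  assumes "m \<in> {0, m2, m3}" "\<zeta> ^ N = 1"
  obtains h c where "germ_sol h" "c \<noteq> 0" "lead m c h"
    "eventually (\<lambda>x. U h x = \<zeta> ^ m * h x) (nhds 0)"
proof -
  obtain h c where h: "germ_sol h" "c \<noteq> 0" "lead m c h" using germ_exists[OF assms(1)] by blast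
  define \<eta> where "\<eta> = \<zeta> ^ m"
  have \<eta>: "\<eta> \<noteq> 0" "\<eta> ^ N = 1" using zeta_nz assms(2)
    by (auto simp: \<eta>_def power_mult[symmetric] mult.commute[of m N]) (simp add: power_mult)
  have "eventually (\<lambda>x. U (avg \<eta> N h) x = \<eta> * avg \<eta> N h x) (nhds 0)"
    using U_finite_order[of h]
    by eventually_elim (simp add: U_avg[OF \<eta>(1)] power_one_over \<eta>(2))
  then show ?thesis
    using that[OF germ_sol_avg[OF h(1)] _ lead_avg[OF h(3) \<eta>_def], of N] N h(2) by (simp add: \<eta>_def)
qed

text \<open>A nonzero germ \<open>U h - h\<close> would have a nonzero leading coefficient, which all powers of \<open>U\<close> would
  preserve, so that the telescoping sum \<open>\<Sum>i<N. U\<^sup>i (U h - h) = 0\<close> would have \<open>N\<close> times this leading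
  coefficient.\<close>

lemma U_scalar:
  assumes "\<zeta> ^ m2 = 1" "\<zeta> ^ m3 = 1" and h: "germ_sol h"
  shows "eventually (\<lambda>x. U h x = h x) (nhds 0)"
proof -
  define g where "g = (\<lambda>x. 1 * U h x + (- 1) * h x)"
  have g: "germ_sol g" unfolding g_def by (intro germ_sol_lincomb germ_sol_U h)
  have z: "avg 1 l g x = (U ^^ l) h x - h x" for l x
  proof (induction l)
    case 0 show ?case by (simp add: avg_def)
  next
    case (Suc l)
    have "(U ^^ l) g x = (U ^^ Suc l) h x - (U ^^ l) h x"
      by (simp add: U_power g_def algebra_simps U_def[symmetric]) (simp add: U_power[symmetric] funpow_swap1 U_power algebra_simps)
    then show ?case using Suc by (simp add: avg_Suc)
  qed
  have "eventually (\<lambda>x. g x = 0) (nhds 0)"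
  proof (rule ccontr)
    assume "\<not> ?thesis"
    then obtain m c where m: "m \<in> {0, m2, m3}" "c \<noteq> 0" "lead m c g" using germ_lead[OF g] by blast
    have "1 = \<zeta> ^ m" using m(1) assms by auto
    then have "lead m (of_nat N * c) (avg 1 N g)" by (rule lead_avg[OF m(3)])
    moreover have "eventually (\<lambda>x. avg 1 N g x = 0) (nhds 0)"
      using U_finite_order[of h] by eventually_elim (simp add: z)
    ultimately have "of_nat N * c = 0" by (rule lead_zero)
    then show False using N m(2) by simp
  qed
  then show ?thesis by eventually_elim (simp add: g_def)
qed

text \<open>The factor \<open>exp ((K - 2) Ln P)\<close> in \<open>U\<close> has the cube \<open>P powi (n - 6)\<close>, which is free of branches.
  The constant \<open>j0 powi (6 - 2 n)\<close> is the same for all choices of \<open>h1\<close> and \<open>h2\<close>, so only the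
  eigenvalues distinguish the monomials.\<close>

lemma cube_transformation:
  assumes "eventually (\<lambda>x. U h1 x = \<eta>1 * h1 x) (nhds 0)" "eventually (\<lambda>x. U h2 x = \<eta>2 * h2 x) (nhds 0)"
    and F: "eventually (\<lambda>z. F z = (z - z0) powi n * (h1 (z - z0) ^ 2 * h2 (z - z0))) (at z0)"
  shows "eventually (\<lambda>z. (z + t) ^ 6 * F (- 1 / (z + t)) = j0 powi (6 - 2 * n) * (\<eta>1 ^ 2 * \<eta>2) * F z) (at z0)"
proof -
  have shift: "eventually (\<lambda>z. Q (z - z0)) (at z0)" if "eventually Q (at 0)" for Q :: "complex \<Rightarrow> bool"
    using that by (subst at_to_0) (simp add: eventually_filtermap)
  have "eventually (\<lambda>x. F (z0 + x) = x powi n * (h1 x ^ 2 * h2 x)) (at 0)"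
    using F by (subst (asm) at_to_0) (simp add: eventually_filtermap add.commute)
  then have F0: "eventually (\<lambda>x. x \<noteq> 0 \<longrightarrow> F (z0 + x) = x powi n * (h1 x ^ 2 * h2 x)) (nhds 0)"
    by (simp add: eventually_at_filter)
  have e: "eventually (\<lambda>x. norm x < norm j0) (nhds 0)"
    unfolding eventually_nhds using j0 by (intro exI[of _ "ball 0 (norm j0)"]) auto
  have "eventually (\<lambda>x. x \<noteq> 0 \<longrightarrow> (z0 + x + t) ^ 6 * F (- 1 / (z0 + x + t))
      = j0 powi (6 - 2 * n) * (\<eta>1 ^ 2 * \<eta>2) * F (z0 + x)) (nhds 0)"
    using F0 eventually_G[OF F0] e assms(1,2)
  proof eventually_elim
    case (elim x)
    show ?case
    proof
      assume x: "x \<noteq> 0"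
      have Px: "P x \<noteq> 0" "j0 + x \<noteq> 0" using P_right[OF elim(3)] by auto
      define L where "L = exp ((K - 2) * Ln (P x))"
      have Gx: "G x \<noteq> 0" using x Px j0 by (simp add: G_def)
      have L3: "L ^ 3 = P x powi (n - 6)"
      proof -
        have "L ^ 3 = exp (3 * ((K - 2) * Ln (P x)))" unfolding L_def by (subst exp_of_nat_mult[symmetric]) simp
        also have "3 * ((K - 2) * Ln (P x)) = of_int (n - 6) * Ln (P x)"
        proof -
          have "3 * K = of_int n" using n by (metis of_real_mult of_real_numeral of_real_of_int_eq)
          then show ?thesis by (simp add: algebra_simps)
        qed
        also have "exp (of_int (n - 6) * Ln (P x)) = P x powi (n - 6)"
          using exp_power_int[of "Ln (P x)" "n - 6"] Px by simp
        finally show ?thesis .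
      qed
      have h: "L * h1 (G x) = \<eta>1 * h1 x" "L * h2 (G x) = \<eta>2 * h2 x"
        using elim(4,5) by (simp_all add: U_def L_def)
      have Lnz: "L \<noteq> 0" by (simp add: L_def)
      have j: "z0 + x + t = j0 / P x" using Px j0 by (simp add: P_def j0_def)
      have "F (- 1 / (z0 + x + t)) = G x powi n * (h1 (G x) ^ 2 * h2 (G x))"
        using elim(2) Gx mobius_G[OF Px(2)] by simp
      also have "\<dots> * L ^ 3 = G x powi n * ((L * h1 (G x)) ^ 2 * (L * h2 (G x)))"
        by (simp add: power_mult_distrib power2_eq_square power3_eq_cube mult_ac)
      also have "\<dots> = G x powi n * ((\<eta>1 ^ 2 * \<eta>2) * (h1 x ^ 2 * h2 x))"
        unfolding h by (simp add: power_mult_distrib mult_ac)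
      also have "G x powi n = x powi n * P x powi n * \<zeta> powi n"
        using G_P[OF Px(2)] by (simp add: power_int_mult_distrib)
      finally have "F (- 1 / (z0 + x + t)) * P x powi (n - 6) = P x powi n * \<zeta> powi n * (\<eta>1 ^ 2 * \<eta>2) * F (z0 + x)"
        using elim(1) x L3 by (simp add: mult_ac)
      moreover have "P x powi (n - 6) = P x powi n / P x ^ 6"
        using Px by (simp add: power_int_diff)
      ultimately have "F (- 1 / (z0 + x + t)) / P x ^ 6 = \<zeta> powi n * (\<eta>1 ^ 2 * \<eta>2) * F (z0 + x)"
        using Px by (simp add: field_simps)
      moreover have "j0 powi (6 - 2 * n) = j0 ^ 6 * \<zeta> powi n"
      proof -
        have "\<zeta> powi n = j0 powi (- (2 * n))"
          unfolding \<zeta>_def by (simp add: power_int_mult power_int_minus divide_inverse power_int_inverse)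
        then show ?thesis using j0 by (simp add: power_int_diff power_int_minus divide_inverse)
      qed
      moreover have J: "(z0 + x + t) ^ 6 * A = j0 ^ 6 * (A / P x ^ 6)" for A
        unfolding j by (simp add: power_divide)
      ultimately show "(z0 + x + t) ^ 6 * F (- 1 / (z0 + x + t)) = j0 powi (6 - 2 * n) * (\<eta>1 ^ 2 * \<eta>2) * F (z0 + x)"
        by (simp only: J mult.assoc)
    qed
  qed
  then have "eventually (\<lambda>x. (z0 + x + t) ^ 6 * F (- 1 / (z0 + x + t))
      = j0 powi (6 - 2 * n) * (\<eta>1 ^ 2 * \<eta>2) * F (z0 + x)) (at 0)"
    by (simp add: eventually_at_filter)
  from shift[OF this] show ?thesis by simp
qed

end

section \<open>Analytic continuation of pairs of solutions\<close>

text \<open>The set \<open>X\<close> may be larger than the set of singular points; an elliptic point is put into \<open>X\<close>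
  whether or not it is singular, and the two cases are then treated alike.\<close>

locale scalar_equation =
  fixes Q2 Q3 :: "complex \<Rightarrow> complex" and X :: "complex set"
  assumes X: "X \<subseteq> upper_half_plane" "X sparse_in upper_half_plane"
    and regular: "\<And>z. z \<in> upper_half_plane - X \<Longrightarrow> Q2 analytic_on {z} \<and> Q3 analytic_on {z}"
    and chart: "\<And>z0. z0 \<in> X \<Longrightarrow> \<exists>r B2 B3 k m2 m3 n. scalar_point Q2 Q3 z0 r B2 B3 k m2 m3 n \<and>
        ball z0 r \<subseteq> upper_half_plane \<and> ball z0 r \<inter> X \<subseteq> {z0}"
begin

abbreviation Hp where "Hp \<equiv> upper_half_plane"

text \<open>Pairs of solutions \<open>(Y1, Y2)\<close> up to a common cube root of unity, encoded by the single-valued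
  monomials \<open>Y1\<^sup>3\<close> and \<open>Y1\<^sup>2 Y2\<close>; the default value on \<open>X\<close> makes identities hold everywhere.\<close>

definition sec :: "complex set \<Rightarrow> (complex \<Rightarrow> complex \<times> complex) \<Rightarrow> bool" where
  "sec A F \<longleftrightarrow> open A \<and> A \<subseteq> Hp \<and> (\<forall>z\<in>A \<inter> X. F z = (0, 0)) \<and>
     (\<forall>z\<in>A - X. \<exists>Y1 Y2. sol_at Q2 Q3 Y1 z \<and> sol_at Q2 Q3 Y2 z \<and>
        eventually (\<lambda>w. F w = (Y1 w ^ 2 * Y1 w, Y1 w ^ 2 * Y2 w)) (nhds z))"

lemma sparse_sub: "A \<subseteq> Hp \<Longrightarrow> X sparse_in A"
  using X(2) sparse_in_subset by blast

lemma open_diff_X: "open A \<Longrightarrow> A \<subseteq> Hp \<Longrightarrow> open (A - X)"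
  using open_diff_sparse_pts sparse_sub by blast

lemma connected_diff_X: "open A \<Longrightarrow> connected A \<Longrightarrow> A \<subseteq> Hp \<Longrightarrow> connected (A - X)"
  using sparse_imp_connected[of A X] sparse_sub by auto

lemma diff_X_nonempty: 
  assumes "open A" "A \<noteq> {}" "A \<subseteq> Hp"
  shows "A - X \<noteq> {}"
proof -
  obtain z where z: "z \<in> A" using assms by blast
  have "eventually (\<lambda>w. w \<notin> X) (at z)"
    using eventually_cosparse_imp_eventually_at[OF eventually_not_in_cosparse[OF sparse_sub[OF assms(3)]] z] .
  moreover have "eventually (\<lambda>w. w \<in> A) (at z)"
    using assms(1) z by (meson eventually_at_topological)
  ultimately have "eventually (\<lambda>w. w \<in> A - X) (at z)" by eventually_elim auto
  then show ?thesis using eventually_happens[of _ "at z"] by (metis at_neq_bot empty_iff)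
qed

lemma sec_holomorphic:
  assumes "sec A F"
  shows "(\<lambda>z. fst (F z)) holomorphic_on (A - X)" "(\<lambda>z. snd (F z)) holomorphic_on (A - X)"
proof -
  have "(\<lambda>z. fst (F z)) analytic_on {z} \<and> (\<lambda>z. snd (F z)) analytic_on {z}" if z: "z \<in> A - X" for z
  proof -
    obtain Y1 Y2 where Y: "sol_at Q2 Q3 Y1 z" "sol_at Q2 Q3 Y2 z"
        "eventually (\<lambda>w. F w = (Y1 w ^ 2 * Y1 w, Y1 w ^ 2 * Y2 w)) (nhds z)"
      using assms z unfolding sec_def by blast
    have a: "Y1 analytic_on {z}" "Y2 analytic_on {z}" using Y sol_at_analytic by auto
    have e1: "eventually (\<lambda>w. fst (F w) = Y1 w ^ 2 * Y1 w) (nhds z)"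
      using Y(3) by eventually_elim simp
    have e2: "eventually (\<lambda>w. snd (F w) = Y1 w ^ 2 * Y2 w) (nhds z)"
      using Y(3) by eventually_elim simp
    have "(\<lambda>w. Y1 w ^ 2 * Y1 w) analytic_on {z}" "(\<lambda>w. Y1 w ^ 2 * Y2 w) analytic_on {z}"
      by (intro analytic_intros a)+
    then show ?thesis using analytic_at_cong[OF e1 refl] analytic_at_cong[OF e2 refl] by simp
  qed
  then show "(\<lambda>z. fst (F z)) holomorphic_on (A - X)" "(\<lambda>z. snd (F z)) holomorphic_on (A - X)"
    by (intro analytic_imp_holomorphic; subst analytic_on_analytic_at; blast)+
qed

lemma sec_subset: "sec A F \<Longrightarrow> B \<subseteq> A \<Longrightarrow> open B \<Longrightarrow> sec B F"
  unfolding sec_def by blast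

lemma sec_cong:
  assumes "sec A F" "\<And>z. z \<in> A \<Longrightarrow> F z = G z"
  shows "sec A G"
  unfolding sec_def
proof (intro conjI ballI)
  show "open A" "A \<subseteq> Hp" using assms(1) by (auto simp: sec_def)
  show "G z = (0, 0)" if "z \<in> A \<inter> X" for z using assms that unfolding sec_def by force
  fix z assume z: "z \<in> A - X"
  obtain Y1 Y2 where Y: "sol_at Q2 Q3 Y1 z" "sol_at Q2 Q3 Y2 z"
      "eventually (\<lambda>w. F w = (Y1 w ^ 2 * Y1 w, Y1 w ^ 2 * Y2 w)) (nhds z)"
    using assms(1) z unfolding sec_def by blast
  have "eventually (\<lambda>w. w \<in> A) (nhds z)"
    using assms(1) z by (intro eventually_nhds_in_open) (auto simp: sec_def)
  with Y(3) have "eventually (\<lambda>w. G w = (Y1 w ^ 2 * Y1 w, Y1 w ^ 2 * Y2 w)) (nhds z)"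
    by eventually_elim (use assms(2) in auto)
  then show "\<exists>Y1 Y2. sol_at Q2 Q3 Y1 z \<and> sol_at Q2 Q3 Y2 z \<and>
      eventually (\<lambda>w. G w = (Y1 w ^ 2 * Y1 w, Y1 w ^ 2 * Y2 w)) (nhds z)"
    using Y by blast
qed

lemma sec_Union:
  assumes "\<And>A. A \<in> \<A> \<Longrightarrow> sec A F"
  shows "sec (\<Union>\<A>) F"
  using assms unfolding sec_def by (intro conjI) (blast intro: open_Union)+

lemma sec_identity:
  assumes F: "sec A F" and G: "sec A G" and A: "connected A"
    and B: "open B" "B \<noteq> {}" "B \<subseteq> A" "\<And>z. z \<in> B - X \<Longrightarrow> F z = G z" and z: "z \<in> A"
  shows "F z = G z"
proof (cases "z \<in> X")
  case True
  then show ?thesis using F G z unfolding sec_def by force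
next
  case False
  have o: "open A" "A \<subseteq> Hp" using F by (auto simp: sec_def)
  have BH: "B \<subseteq> Hp" using B(3) o(2) by blast
  note D = open_diff_X[OF B(1) BH] diff_X_nonempty[OF B(1,2) BH]
  have zz: "z \<in> A - X" using z False by blast
  have sub: "B - X \<subseteq> A - X" using B(3) by blast
  have "fst (F z) = fst (G z)"
    by (rule analytic_continuation_open[OF D(1) open_diff_X[OF o] D(2) connected_diff_X[OF o(1) A o(2)] sub
          sec_holomorphic(1)[OF F] sec_holomorphic(1)[OF G] _ zz]) (use B(4) in auto)
  moreover have "snd (F z) = snd (G z)"
    by (rule analytic_continuation_open[OF D(1) open_diff_X[OF o] D(2) connected_diff_X[OF o(1) A o(2)] sub
          sec_holomorphic(2)[OF F] sec_holomorphic(2)[OF G] _ zz]) (use B(4) in auto)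
  ultimately show ?thesis by (rule prod_eqI)
qed

text \<open>The branch factors \<open>(z - z0)\<^sup>k\<close> of the two solutions enter a cubic monomial only through their
  cube, the integral power with exponent \<open>n = 3 k\<close>.\<close>

definition germ_section :: "complex \<Rightarrow> int \<Rightarrow> (complex \<Rightarrow> complex) \<Rightarrow> (complex \<Rightarrow> complex) \<Rightarrow> complex \<Rightarrow> complex \<times> complex" where
  "germ_section z0 n h1 h2 z = (if z = z0 then (0, 0) else
     ((z - z0) powi n * (h1 (z - z0) ^ 2 * h1 (z - z0)), (z - z0) powi n * (h1 (z - z0) ^ 2 * h2 (z - z0))))"

lemma sec_germ_section:
  assumes "scalar_point Q2 Q3 z0 r B2 B3 k m2 m3 n"
    and ball: "ball z0 r \<subseteq> Hp" "ball z0 r \<inter> X \<subseteq> {z0}" and z0: "z0 \<in> X"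
    and e: "0 < e" "e \<le> r"
    and h1: "log_chart.log_ode B2 B3 (half_plane (ln e)) (\<lambda>s. exp (complex_of_real k * s) * h1 (exp s))"
    and h2: "log_chart.log_ode B2 B3 (half_plane (ln e)) (\<lambda>s. exp (complex_of_real k * s) * h2 (exp s))"
  shows "sec (ball z0 e) (germ_section z0 n h1 h2)"
proof -
  interpret scalar_point Q2 Q3 z0 r B2 B3 k m2 m3 n by fact
  have sub: "ball z0 e \<subseteq> ball z0 r" using e by (simp add: subset_ball)
  show ?thesis unfolding sec_def
  proof (intro conjI ballI)
    show "open (ball z0 e)" "ball z0 e \<subseteq> Hp" using sub ball by auto
    show "germ_section z0 n h1 h2 z = (0, 0)" if "z \<in> ball z0 e \<inter> X" for z
      using that sub ball by (auto simp: germ_section_def)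
    fix z assume "z \<in> ball z0 e - X"
    then have z: "z \<in> ball z0 e" "z - z0 \<noteq> 0" using z0 by auto
    obtain U l where U: "open U" "z \<in> U" "z0 \<notin> U" and hl: "l holomorphic_on U"
      and el: "\<And>w. w \<in> U \<Longrightarrow> exp (l w) = w - z0"
      using local_log_at[OF exp_Ln[OF z(2)]] by metis
    have lz: "l z \<in> half_plane (ln e)"
      unfolding in_half_plane_ln[OF e(1)] el[OF U(2)] using z by (simp add: dist_norm norm_minus_commute)
    have s: "sol_at Q2 Q3 (\<lambda>w. exp (K * l w) * h (w - z0)) z"
      if h: "log_ode (half_plane (ln e)) (\<lambda>s. exp (K * s) * h (exp s))" for h
    proof -
      have "sol_at Q2 Q3 (\<lambda>w. exp (K * l w) * h (exp (l w))) z"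
        by (rule log_ode_imp_sol_at[OF h open_half_plane half_plane_mono[OF e(2,1)] hl U(1,2) lz])
           (simp add: el)
      moreover have "eventually (\<lambda>w. w \<in> U) (nhds z)" by (rule eventually_nhds_in_open[OF U(1,2)])
      then have "eventually (\<lambda>w. exp (K * l w) * h (exp (l w)) = exp (K * l w) * h (w - z0)) (nhds z)"
        by eventually_elim (simp add: el)
      ultimately show ?thesis by (rule sol_at_cong)
    qed
    have "eventually (\<lambda>w. w \<in> U) (nhds z)" by (rule eventually_nhds_in_open[OF U(1,2)])
    then have "eventually (\<lambda>w. germ_section z0 n h1 h2 w =
        ((exp (K * l w) * h1 (w - z0)) ^ 2 * (exp (K * l w) * h1 (w - z0)),
         (exp (K * l w) * h1 (w - z0)) ^ 2 * (exp (K * l w) * h2 (w - z0)))) (nhds z)"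
    proof eventually_elim
      case (elim w)
      have "w \<noteq> z0" using elim U(3) by auto
      have c: "exp (K * l w) ^ 3 = (w - z0) powi n" using exp_K_cube[of "l w"] el[OF elim] by simp
      show ?case using \<open>w \<noteq> z0\<close> unfolding germ_section_def c[symmetric]
        by (simp add: power2_eq_square power3_eq_cube mult_ac)
    qed
    then show "\<exists>Y1 Y2. sol_at Q2 Q3 Y1 z \<and> sol_at Q2 Q3 Y2 z \<and>
        eventually (\<lambda>w. germ_section z0 n h1 h2 w = (Y1 w ^ 2 * Y1 w, Y1 w ^ 2 * Y2 w)) (nhds z)"
      using s[OF h1] s[OF h2] by blast
  qed
qed

text \<open>Near one point of \<open>A\<close> the section comes from two solutions. In the logarithmic coordinate they
  continue around \<open>z0\<close>, and the scalar monodromy multiplies both by the same cube root of unity, which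
  the cubic monomials do not see.\<close>

lemma section_is_germ_section:
  assumes sp: "scalar_point Q2 Q3 z0 r B2 B3 k m2 m3 n"
    and ball: "ball z0 r \<subseteq> Hp" "ball z0 r \<inter> X \<subseteq> {z0}" and z0: "z0 \<in> X"
    and A: "A \<subseteq> ball z0 r" "connected A" "A \<noteq> {}" and F: "sec A F"
  obtains h1 h2 where "scalar_point.germ_sol r B2 B3 k h1" "scalar_point.germ_sol r B2 B3 k h2"
    "sec (ball z0 r) (germ_section z0 n h1 h2)" "\<And>z. z \<in> A \<Longrightarrow> F z = germ_section z0 n h1 h2 z"
proof -
  interpret scalar_point Q2 Q3 z0 r B2 B3 k m2 m3 n by fact
  have oA: "open A" "A \<subseteq> Hp" using F by (auto simp: sec_def)
  obtain z where z: "z \<in> A - X" using diff_X_nonempty[OF oA(1) A(3) oA(2)] by blast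
  then have zz: "z - z0 \<noteq> 0" "z \<in> ball z0 r" using z0 A by auto
  obtain Y1 Y2 where Y: "sol_at Q2 Q3 Y1 z" "sol_at Q2 Q3 Y2 z"
      "eventually (\<lambda>w. F w = (Y1 w ^ 2 * Y1 w, Y1 w ^ 2 * Y2 w)) (nhds z)"
    using F z unfolding sec_def by blast
  define s where "s = Ln (z - z0)"
  have es: "exp s = z - z0" using zz by (simp add: s_def)
  have sH: "s \<in> H" unfolding in_H es using zz by (simp add: dist_norm norm_minus_commute)
  have zs: "z0 + exp s = z" using es by simp
  obtain y1 where y1: "log_ode H y1" "eventually (\<lambda>t. y1 t = Y1 (z0 + exp t)) (nhds s)"
    using sol_at_extends[OF Y(1)[folded zs] sH] by blast
  obtain y2 where y2: "log_ode H y2" "eventually (\<lambda>t. y2 t = Y2 (z0 + exp t)) (nhds s)"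
    using sol_at_extends[OF Y(2)[folded zs] sH] by blast
  obtain h1 where h1: "h1 holomorphic_on ball 0 r" "\<And>s. s \<in> H \<Longrightarrow> y1 s = exp (K * s) * h1 (exp s)"
    using holomorphic_part[OF y1(1)] by blast
  obtain h2 where h2: "h2 holomorphic_on ball 0 r" "\<And>s. s \<in> H \<Longrightarrow> y2 s = exp (K * s) * h2 (exp s)"
    using holomorphic_part[OF y2(1)] by blast
  have o: "log_ode H (\<lambda>s. exp (K * s) * h1 (exp s))" "log_ode H (\<lambda>s. exp (K * s) * h2 (exp s))"
    using ode3_cong[OF open_half_plane refl refl refl h1(2) y1(1)]
      ode3_cong[OF open_half_plane refl refl refl h2(2) y2(1)] by auto
  have G: "sec (ball z0 r) (germ_section z0 n h1 h2)"
    by (rule sec_germ_section[OF sp ball z0 r order_refl o])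
  have GA: "sec A (germ_section z0 n h1 h2)" by (rule sec_subset[OF G A(1) oA(1)])
  obtain U l where U: "open U" "z \<in> U" "z0 \<notin> U" and hl: "l holomorphic_on U" "l z = s"
    and el: "\<And>w. w \<in> U \<Longrightarrow> exp (l w) = w - z0"
    using local_log_at[OF es] by metis
  have "isCont l z"
    using holomorphic_on_imp_continuous_on[OF hl(1)] U continuous_on_eq_continuous_at by blast
  then have lim: "filterlim l (nhds s) (nhds z)"
    unfolding isCont_def hl(2)[symmetric] by (rule iffD1[OF tendsto_at_iff_tendsto_nhds])
  have "eventually (\<lambda>w. F w = germ_section z0 n h1 h2 w) (nhds z)"
    using Y(3) eventually_compose_filterlim[OF y1(2) lim] eventually_compose_filterlim[OF y2(2) lim]
      eventually_nhds_in_open[OF U(1,2)] eventually_compose_filterlim[OF eventually_nhds_in_open[OF open_half_plane sH] lim]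
  proof eventually_elim
    case (elim w)
    have "w \<noteq> z0" using elim(4) U(3) by auto
    have e: "Y1 w = exp (K * l w) * h1 (w - z0)" "Y2 w = exp (K * l w) * h2 (w - z0)"
      using elim(2,3) h1(2)[OF elim(5)] h2(2)[OF elim(5)] el[OF elim(4)] by auto
    have c: "exp (K * l w) ^ 3 = (w - z0) powi n" using exp_K_cube[of "l w"] el[OF elim(4)] by simp
    show ?case using \<open>w \<noteq> z0\<close> unfolding elim(1) e germ_section_def c[symmetric]
      by (simp add: power2_eq_square power3_eq_cube mult_ac)
  qed
  then obtain B where B: "open B" "z \<in> B" "\<And>w. w \<in> B \<Longrightarrow> F w = germ_section z0 n h1 h2 w"
    unfolding eventually_nhds by blast
  have "F w = germ_section z0 n h1 h2 w" if "w \<in> A" for w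
    by (rule sec_identity[OF F GA A(2), of "A \<inter> B"]) (use B z oA that in auto)
  moreover have "germ_sol h1" "germ_sol h2"
    using germ_sol_of_log_ode[OF y1(1) h1] germ_sol_of_log_ode[OF y2(1) h2] by auto
  ultimately show ?thesis using that G by blast
qed

definition ext_disc :: "complex \<Rightarrow> real \<Rightarrow> bool" where
  "ext_disc c e \<longleftrightarrow> (\<forall>A F. A \<subseteq> ball c e \<and> connected A \<and> A \<noteq> {} \<and> sec A F \<longrightarrow>
     (\<exists>G. sec (ball c e) G \<and> (\<forall>z\<in>A. G z = F z)))"

text \<open>Off \<open>X\<close> solutions exist on a whole disc; at a point of \<open>X\<close> sections are given by germs.\<close>

lemma ext_disc_exists:
  assumes "c \<in> Hp"
  obtains e where "e > 0" "ext_disc c e"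
proof (cases "c \<in> X")
  case True
  obtain r B2 B3 k m2 m3 n where sp: "scalar_point Q2 Q3 c r B2 B3 k m2 m3 n"
     and b: "ball c r \<subseteq> Hp" "ball c r \<inter> X \<subseteq> {c}"
    using chart[OF True] by blast
  have "r > 0" using sp by (simp add: scalar_point_def log_chart_def)
  moreover have "ext_disc c r" unfolding ext_disc_def
  proof (intro allI impI, elim conjE)
    fix A F assume A: "A \<subseteq> ball c r" "connected A" "A \<noteq> {}" "sec A F"
    show "\<exists>G. sec (ball c r) G \<and> (\<forall>z\<in>A. G z = F z)"
      by (rule section_is_germ_section[OF sp b True A]) (metis)
  qed
  ultimately show ?thesis by (rule that)
next
  case False
  have "open (Hp - X)" by (rule open_diff_X) (auto simp: upper_half_plane_def open_halfspace_Im_gt)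
  moreover have "c \<in> Hp - X" using assms False by blast
  ultimately obtain e where e: "e > 0" "ball c e \<subseteq> Hp - X" by (rule openE)
  have hol: "(\<lambda>_. 0) holomorphic_on ball c e" "Q2 holomorphic_on ball c e" "Q3 holomorphic_on ball c e"
  proof -
    show "Q2 holomorphic_on ball c e" "Q3 holomorphic_on ball c e"
      by (intro analytic_imp_holomorphic; subst analytic_on_analytic_at; use regular e(2) in blast)+
  qed simp
  have "ext_disc c e" unfolding ext_disc_def
  proof (intro allI impI, elim conjE)
    fix A F assume A: "A \<subseteq> ball c e" "connected A" "A \<noteq> {}" and F: "sec A F"
    obtain z where z: "z \<in> A" using A(3) by blast
    then have zX: "z \<in> A - X" "z \<in> ball c e" using A e by auto
    obtain Y1 Y2 where Y: "sol_at Q2 Q3 Y1 z" "sol_at Q2 Q3 Y2 z"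
        "eventually (\<lambda>w. F w = (Y1 w ^ 2 * Y1 w, Y1 w ^ 2 * Y2 w)) (nhds z)"
      using F zX unfolding sec_def by blast
    have ex: "\<exists>Z. ode3 (\<lambda>_. 0) Q2 Q3 (ball c e) Z \<and> eventually (\<lambda>w. Y w = Z w) (nhds z)"
      if Y: "sol_at Q2 Q3 Y z" for Y
    proof -
      obtain U where U: "open U" "z \<in> U" "ode3 (\<lambda>_. 0) Q2 Q3 U Y" using Y by (auto simp: sol_at_def)
      obtain d where d: "d > 0" "ball z d \<subseteq> U \<inter> ball c e"
        using openE[OF open_Int[OF U(1) open_ball] IntI[OF U(2) zX(2)]] by blast
      obtain Z where Z: "ode3 (\<lambda>_. 0) Q2 Q3 (ball c e) Z" "Z z = Y z" "deriv Z z = deriv Y z"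
          "(deriv ^^ 2) Z z = (deriv ^^ 2) Y z"
        using ode3_solution_exists[OF open_ball convex_ball zX(2) hol] by blast
      have sub: "ball z d \<subseteq> U" "ball z d \<subseteq> ball c e" using d by auto
      have "Y w = Z w" if "w \<in> ball z d" for w
        by (rule ode3_unique[OF open_ball connected_ball _ _ _ ode3_subset[OF U(3) sub(1)] ode3_subset[OF Z(1) sub(2)]
              _ Z(2-4)[symmetric] that])
           (use d hol sub(2) holomorphic_on_subset in auto)
      then have "eventually (\<lambda>w. Y w = Z w) (nhds z)"
        unfolding eventually_nhds using d(1) by (intro exI[of _ "ball z d"]) auto
      then show ?thesis using Z(1) by blast
    qed
    obtain Z1 where Z1: "ode3 (\<lambda>_. 0) Q2 Q3 (ball c e) Z1" "eventually (\<lambda>w. Y1 w = Z1 w) (nhds z)"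
      using ex[OF Y(1)] by blast
    obtain Z2 where Z2: "ode3 (\<lambda>_. 0) Q2 Q3 (ball c e) Z2" "eventually (\<lambda>w. Y2 w = Z2 w) (nhds z)"
      using ex[OF Y(2)] by blast
    define G where "G = (\<lambda>w. (Z1 w ^ 2 * Z1 w, Z1 w ^ 2 * Z2 w))"
    have G: "sec (ball c e) G" unfolding sec_def
    proof (intro conjI ballI)
      show "ball c e \<subseteq> Hp" using e by blast
      show "G z = (0, 0)" if "z \<in> ball c e \<inter> X" for z using that e by blast
      fix w assume "w \<in> ball c e - X"
      then have "w \<in> ball c e" by blast
      then have "sol_at Q2 Q3 Z1 w" "sol_at Q2 Q3 Z2 w"
        unfolding sol_at_def using Z1(1) Z2(1) open_ball by blast+
      then show "\<exists>Y1 Y2. sol_at Q2 Q3 Y1 w \<and> sol_at Q2 Q3 Y2 w \<and>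
          eventually (\<lambda>w. G w = (Y1 w ^ 2 * Y1 w, Y1 w ^ 2 * Y2 w)) (nhds w)"
        by (intro exI[of _ Z1] exI[of _ Z2]) (simp add: G_def)
    qed auto
    have "eventually (\<lambda>w. F w = G w) (nhds z)"
      using Y(3) Z1(2) Z2(2) by eventually_elim (simp add: G_def)
    then obtain B where B: "open B" "z \<in> B" "\<And>w. w \<in> B \<Longrightarrow> F w = G w"
      unfolding eventually_nhds by blast
    have oA: "open A" using F by (simp add: sec_def)
    have GA: "sec A G" by (rule sec_subset[OF G A(1) oA])
    have "F w = G w" if "w \<in> A" for w
      by (rule sec_identity[OF F GA A(2), of "A \<inter> B"]) (use B z oA that in auto)
    then show "\<exists>G. sec (ball c e) G \<and> (\<forall>z\<in>A. G z = F z)" using G by metis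
  qed
  then show ?thesis using that e(1) by blast
qed

lemma ext_disc_shrink:
  assumes "ext_disc c e" "ball c' e' \<subseteq> ball c e"
  shows "ext_disc c' e'"
  unfolding ext_disc_def
proof (intro allI impI, elim conjE)
  fix A F assume A: "A \<subseteq> ball c' e'" "connected A" "A \<noteq> {}" "sec A F"
  then obtain G where "sec (ball c e) G" "\<forall>z\<in>A. G z = F z"
    using assms unfolding ext_disc_def by (metis order_trans)
  then show "\<exists>G. sec (ball c' e') G \<and> (\<forall>z\<in>A. G z = F z)"
    using sec_subset[OF _ assms(2) open_ball] by blast
qed

text \<open>Discs of a uniform size centred on the boundary circle of a disc extend a section across it.
  Two overlapping such discs meet inside the circle, at the midpoint of their centres, so the
  extensions agree by the identity theorem.\<close>

lemma section_extend_step: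
  assumes F: "sec (ball c R) F" and R: "R > 0" and lam: "lam > 0"
    and ext: "\<And>w. w \<in> sphere c R \<Longrightarrow> ext_disc w lam"
  obtains G where "sec (ball c R \<union> (\<Union>w\<in>sphere c R. ball w lam)) G" "\<And>z. z \<in> ball c R \<Longrightarrow> G z = F z"
proof -
  have ne: "ball w lam \<inter> ball c R \<noteq> {}" if w: "w \<in> sphere c R" for w
  proof -
    have "w \<in> closure (ball c R)" using w R by (simp add: closure_ball sphere_def cball_def)
    moreover have "w \<in> ball w lam" using lam by simp
    ultimately show ?thesis using open_Int_closure_eq_empty[OF open_ball, of w lam "ball c R"] by blast
  qed
  have "\<exists>G. sec (ball w lam) G \<and> (\<forall>z\<in>ball w lam \<inter> ball c R. G z = F z)" if w: "w \<in> sphere c R" for w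
  proof -
    have "sec (ball w lam \<inter> ball c R) F" by (rule sec_subset[OF F]) auto
    moreover have "connected (ball w lam \<inter> ball c R)"
      by (intro convex_connected convex_Int convex_ball)
    ultimately show ?thesis using ext[OF w] ne[OF w] unfolding ext_disc_def by blast
  qed
  then obtain g where g: "\<And>w. w \<in> sphere c R \<Longrightarrow> sec (ball w lam) (g w)"
     "\<And>w z. w \<in> sphere c R \<Longrightarrow> z \<in> ball w lam \<inter> ball c R \<Longrightarrow> g w z = F z" by metis
  have agree: "g v z = g w z" if vw: "v \<in> sphere c R" "w \<in> sphere c R" and z: "z \<in> ball v lam" "z \<in> ball w lam" for v w z
  proof (cases "v = w")
    case False
    define m where "m = midpoint v w"
    have "dist v w < 2 * lam" using z dist_triangle2[of v w z] by (simp add: dist_commute)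
    then have "m \<in> ball v lam" "m \<in> ball w lam" by (auto simp: m_def dist_midpoint)
    moreover have "m \<in> ball c R"
      using dist_decreases_open_segment[of m v w c] False vw
      by (force simp: m_def midpoint_in_open_segment dist_commute)
    ultimately have m: "m \<in> ball v lam \<inter> ball w lam \<inter> ball c R" by blast
    show ?thesis
    proof (rule sec_identity[of "ball v lam \<inter> ball w lam" _ _ "ball v lam \<inter> ball w lam \<inter> ball c R"])
      show "sec (ball v lam \<inter> ball w lam) (g v)" by (rule sec_subset[OF g(1)[OF vw(1)]]) auto
      show "sec (ball v lam \<inter> ball w lam) (g w)" by (rule sec_subset[OF g(1)[OF vw(2)]]) auto
      show "connected (ball v lam \<inter> ball w lam)" by (intro convex_connected convex_Int convex_ball)
      show "ball v lam \<inter> ball w lam \<inter> ball c R \<noteq> {}" using m by blast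
    qed (use g(2) vw z in auto)
  qed simp
  define G where "G = (\<lambda>z. if z \<in> ball c R then F z else g (SOME w. w \<in> sphere c R \<and> z \<in> ball w lam) z)"
  have Gg: "g w z = G z" if w: "w \<in> sphere c R" "z \<in> ball w lam" for w z
  proof (cases "z \<in> ball c R")
    case True then show ?thesis using g(2) w by (simp add: G_def)
  next
    case False
    define v where "v = (SOME w. w \<in> sphere c R \<and> z \<in> ball w lam)"
    have "\<exists>w. w \<in> sphere c R \<and> z \<in> ball w lam" using w by blast
    then have "v \<in> sphere c R \<and> z \<in> ball v lam" unfolding v_def by (rule someI_ex)
    moreover have "G z = g v z" unfolding G_def v_def by (simp only: False if_False)
    ultimately show ?thesis using agree[OF w(1) _ w(2), of v] by simp
  qed
  have "sec (\<Union>(insert (ball c R) ((\<lambda>w. ball w lam) ` sphere c R))) G"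
  proof (rule sec_Union)
    fix A assume "A \<in> insert (ball c R) ((\<lambda>w. ball w lam) ` sphere c R)"
    then consider "A = ball c R" | w where "w \<in> sphere c R" "A = ball w lam" by blast
    then show "sec A G"
    proof cases
      case 1 then show ?thesis using sec_cong[OF F, of G] by (simp add: G_def)
    next
      case 2 then show ?thesis using sec_cong[OF g(1)[OF 2(1)], of G] Gg[OF 2(1)] by simp
    qed
  qed
  then show ?thesis by (intro that[of G]) (auto simp: G_def)
qed

end

text \<open>The hyperbolic discs about \<open>b\<close>, with \<open>u\<close> the exponential of the hyperbolic radius. As Euclidean
  discs they increase with \<open>u\<close> and exhaust the half-plane, which concentric Euclidean discs cannot do.\<close>

definition hyp_centre :: "complex \<Rightarrow> real \<Rightarrow> complex" where
  "hyp_centre b u = Complex (Re b) (Im b * (u + 1 / u) / 2)"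

definition hyp_radius :: "complex \<Rightarrow> real \<Rightarrow> real" where
  "hyp_radius b u = Im b * (u - 1 / u) / 2"

abbreviation hyp_disc :: "complex \<Rightarrow> real \<Rightarrow> complex set" where
  "hyp_disc b u \<equiv> ball (hyp_centre b u) (hyp_radius b u)"

lemma inverse_gt_diff: "1 \<le> u \<Longrightarrow> u \<le> v \<Longrightarrow> 1 / v \<le> 1 / (u::real)"
  by (simp add: frac_le)

lemma hyp_centre_dist:
  assumes b: "Im b > 0" and u: "1 \<le> u" "u \<le> v"
  shows "dist (hyp_centre b v) (hyp_centre b u) = Im b * (v + 1 / v - u - 1 / u) / 2"
proof -
  have "v + 1 / v - u - 1 / u = (v - u) * (1 - 1 / (u * v))" using u by (simp add: field_simps)
  moreover have "1 / (u * v) \<le> 1" using u mult_mono[of 1 u 1 v] by simp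
  ultimately have "v + 1 / v - u - 1 / u \<ge> 0" using u by simp
  then have "Im b * (v + 1 / v - u - 1 / u) / 2 \<ge> 0" using b by simp
  moreover have "hyp_centre b v - hyp_centre b u = \<i> * of_real (Im b * (v + 1 / v - u - 1 / u) / 2)"
    by (simp add: hyp_centre_def complex_eq_iff algebra_simps diff_divide_distrib add_divide_distrib)
  ultimately show ?thesis unfolding dist_norm by (simp only: norm_mult norm_of_real norm_ii abs_of_nonneg mult_1)
qed

lemma hyp_disc_mono:
  assumes "Im b > 0" "1 \<le> u" "u \<le> v"
  shows "hyp_disc b u \<subseteq> hyp_disc b v"
proof -
  have "dist (hyp_centre b u) (hyp_centre b v) + hyp_radius b u \<le> hyp_radius b v"
    using hyp_centre_dist[OF assms] mult_left_mono[OF inverse_gt_diff[OF assms(2,3)], of "Im b"] assms(1)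
    by (simp add: hyp_radius_def dist_commute algebra_simps add_divide_distrib diff_divide_distrib)
  then show ?thesis by (simp add: ball_subset_ball_iff)
qed

lemma hyp_disc_upper:
  assumes b: "Im b > 0" and u: "1 \<le> u"
  shows "cball (hyp_centre b u) (hyp_radius b u) \<subseteq> upper_half_plane"
proof
  fix z assume "z \<in> cball (hyp_centre b u) (hyp_radius b u)"
  then have "\<bar>Im (hyp_centre b u - z)\<bar> \<le> hyp_radius b u"
    using abs_Im_le_cmod[of "hyp_centre b u - z"] by (simp add: dist_norm)
  then have "Im (hyp_centre b u) - hyp_radius b u \<le> Im z" by simp
  moreover have "Im (hyp_centre b u) - hyp_radius b u = Im b * (1 / u)"
    by (simp add: hyp_centre_def hyp_radius_def algebra_simps diff_divide_distrib add_divide_distrib)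
  moreover have "Im b * (1 / u) > 0" using b u by simp
  ultimately show "z \<in> upper_half_plane" by (simp add: upper_half_plane_def)
qed

lemma hyp_disc_exhaust:
  assumes b: "Im b > 0" and z: "Im z > 0"
    and u: "u \<ge> 1" "u > ((Re z - Re b) ^ 2 + Im z ^ 2 + Im b ^ 2) / (Im z * Im b)"
  shows "z \<in> hyp_disc b u"
proof -
  have "(Re z - Re b) ^ 2 + Im z ^ 2 + Im b ^ 2 < u * (Im z * Im b)"
    using u(2) b z by (simp add: pos_divide_less_eq)
  also have "\<dots> \<le> (u + 1 / u) * (Im z * Im b)" using u b z by (intro mult_right_mono) auto
  finally have *: "(Re z - Re b) ^ 2 + Im z ^ 2 + Im b ^ 2 < (u + 1 / u) * (Im z * Im b)" .
  define w where "w = 1 / u"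
  have "(Im b * (u + w) / 2) ^ 2 - (Im b * (u - w) / 2) ^ 2 = Im b ^ 2 * (u * w)"
    by (simp add: power2_eq_square field_simps)
  also have "u * w = 1" using u by (simp add: w_def)
  finally have "(Im b * (u + w) / 2) ^ 2 - (Im b * (u - w) / 2) ^ 2 = Im b ^ 2" by simp
  moreover have "(Im z - Im b * (u + w) / 2) ^ 2
      = Im z ^ 2 - (u + w) * (Im z * Im b) + (Im b * (u + w) / 2) ^ 2"
    by (simp add: power2_diff mult_ac)
  ultimately have "(Re z - Re b) ^ 2 + (Im z - Im b * (u + 1 / u) / 2) ^ 2 < (Im b * (u - 1 / u) / 2) ^ 2"
    using * unfolding w_def[symmetric] by linarith
  then have "(dist z (hyp_centre b u)) ^ 2 < hyp_radius b u ^ 2"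
    by (simp add: dist_norm cmod_power2 hyp_centre_def hyp_radius_def)
  moreover have "hyp_radius b u \<ge> 0" using b u inverse_gt_diff[of 1 u] order_trans[of "1 / u" 1 u] by (simp add: hyp_radius_def)
  ultimately show ?thesis by (simp add: power_less_imp_less_base dist_commute)
qed

context scalar_equation
begin

lemma uniform_ext_disc:
  assumes "compact C" "C \<subseteq> Hp"
  obtains lam where "lam > 0" "\<And>c. c \<in> C \<Longrightarrow> ext_disc c lam"
proof -
  have "\<exists>e. e > 0 \<and> ext_disc c e" if "c \<in> C" for c using ext_disc_exists that assms(2) by blast
  then obtain e where e: "\<And>c. c \<in> C \<Longrightarrow> e c > 0 \<and> ext_disc c (e c)" by metis
  define \<G> where "\<G> = (\<lambda>c. ball c (e c)) ` C"
  have "C \<subseteq> \<Union>\<G>" using e by (force simp: \<G>_def)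
  moreover have "open G" if "G \<in> \<G>" for G using that by (auto simp: \<G>_def)
  ultimately obtain d where d: "0 < d" "\<And>x. x \<in> C \<Longrightarrow> \<exists>G\<in>\<G>. ball x d \<subseteq> G"
    using Heine_Borel_lemma[OF assms(1), of \<G>] by blast
  show ?thesis
  proof (rule that[OF d(1)])
    fix c assume "c \<in> C"
    then obtain c' where "c' \<in> C" "ball c d \<subseteq> ball c' (e c')" using d(2) by (force simp: \<G>_def)
    then show "ext_disc c d" using e ext_disc_shrink by blast
  qed
qed

text \<open>By compactness the extension step is possible with a uniform \<open>lam\<close> on all circles up to \<open>u1\<close>, so
  finitely many steps suffice.\<close>

lemma section_on_hyp_disc:
  assumes b: "Im b > 0" and u: "1 < u0" "u0 \<le> u1" and F0: "sec (hyp_disc b u0) F0"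
  obtains F where "sec (hyp_disc b u1) F" "\<And>z. z \<in> hyp_disc b u0 \<Longrightarrow> F z = F0 z"
proof -
  have u1: "1 \<le> u1" using u by simp
  obtain lam where lam: "lam > 0" "\<And>c. c \<in> cball (hyp_centre b u1) (hyp_radius b u1) \<Longrightarrow> ext_disc c lam"
    using uniform_ext_disc[OF compact_cball hyp_disc_upper[OF b u1]] by blast
  define \<delta> where "\<delta> = lam / Im b"
  have "\<delta> > 0" using lam b by (simp add: \<delta>_def)
  define W where "W = (\<lambda>u. \<exists>F. sec (hyp_disc b u) F \<and> (\<forall>z\<in>hyp_disc b u0. F z = F0 z))"
  have step: "W (min (u + \<delta>) u1)" if uu: "u0 \<le> u" "u \<le> u1" and "W u" for u
  proof -
    obtain F where F: "sec (hyp_disc b u) F" "\<And>z. z \<in> hyp_disc b u0 \<Longrightarrow> F z = F0 z"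
      using \<open>W u\<close> by (auto simp: W_def)
    have "1 < u" using u uu by simp
    have "1 / u < u" using \<open>1 < u\<close> less_trans[of "1 / u" 1 u] by simp
    then have R: "hyp_radius b u > 0" using b by (simp add: hyp_radius_def)
    have cc: "cball (hyp_centre b u) (hyp_radius b u) \<subseteq> cball (hyp_centre b u1) (hyp_radius b u1)"
    proof -
      have "hyp_disc b u \<subseteq> cball (hyp_centre b u1) (hyp_radius b u1)"
        using hyp_disc_mono[OF b _ uu(2)] \<open>1 < u\<close> ball_subset_cball by fastforce
      then have "closure (hyp_disc b u) \<subseteq> cball (hyp_centre b u1) (hyp_radius b u1)"
        by (rule closure_minimal) simp
      then show ?thesis using R by (simp add: closure_ball)
    qed
    have ext: "ext_disc w lam" if "w \<in> sphere (hyp_centre b u) (hyp_radius b u)" for w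
      by (rule lam(2)) (use that cc sphere_cball in blast)
    obtain G where G: "sec (hyp_disc b u \<union> (\<Union>w\<in>sphere (hyp_centre b u) (hyp_radius b u). ball w lam)) G"
        "\<And>z. z \<in> hyp_disc b u \<Longrightarrow> G z = F z"
      using section_extend_step[OF F(1) R lam(1) ext] by blast
    define v where "v = min (u + \<delta>) u1"
    have v: "u \<le> v" "v \<le> u + \<delta>" using \<open>\<delta> > 0\<close> uu by (auto simp: v_def)
    have "hyp_disc b v \<subseteq> hyp_disc b u \<union> (\<Union>w\<in>sphere (hyp_centre b u) (hyp_radius b u). ball w lam)"
    proof
      fix z assume z: "z \<in> hyp_disc b v"
      show "z \<in> hyp_disc b u \<union> (\<Union>w\<in>sphere (hyp_centre b u) (hyp_radius b u). ball w lam)"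
      proof (cases "z \<in> hyp_disc b u")
        case False
        define c where "c = hyp_centre b u"
        define \<rho> where "\<rho> = hyp_radius b u"
        define D where "D = norm (z - c)"
        have D: "D \<ge> \<rho>" "\<rho> > 0" using False R by (auto simp: D_def c_def \<rho>_def dist_norm norm_minus_commute)
        \<comment> \<open>the radial projection of \<open>z\<close> to the circle\<close>
        define w where "w = c + of_real (\<rho> / D) * (z - c)"
        have "w - c = of_real (\<rho> / D) * (z - c)" by (simp add: w_def)
        then have "norm (w - c) = \<bar>\<rho> / D\<bar> * D" by (simp only: norm_mult norm_of_real D_def)
        then have "norm (w - c) = \<rho>" using D by simp
        then have "w \<in> sphere c \<rho>" by (simp add: dist_norm norm_minus_commute)
        moreover have "z \<in> ball w lam"
        proof -
          have "z - w = of_real (1 - \<rho> / D) * (z - c)" by (simp add: w_def algebra_simps)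
          then have "norm (z - w) = \<bar>1 - \<rho> / D\<bar> * D" by (simp only: norm_mult norm_of_real D_def)
          also have "\<dots> = D - \<rho>" using D by (simp add: field_simps)
          also have "D < hyp_radius b v + dist (hyp_centre b v) c"
            using z dist_triangle[of z c "hyp_centre b v"] by (simp add: D_def dist_norm norm_minus_commute)
          also have "hyp_radius b v + dist (hyp_centre b v) c - \<rho> = Im b * (v - u)"
            unfolding c_def \<rho>_def using hyp_centre_dist[OF b _ v(1)] \<open>1 < u\<close>
            by (simp add: hyp_radius_def algebra_simps add_divide_distrib diff_divide_distrib)
          also have "Im b * (v - u) \<le> Im b * \<delta>" using v b by (intro mult_left_mono) auto
          also have "\<dots> = lam" using b by (simp add: \<delta>_def)
          finally show ?thesis by (simp add: dist_norm norm_minus_commute)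
        qed
        ultimately show ?thesis by (auto simp: c_def \<rho>_def)
      qed auto
    qed
    then have "sec (hyp_disc b v) G" by (rule sec_subset[OF G(1)]) simp
    moreover have "\<forall>z\<in>hyp_disc b u0. G z = F0 z"
    proof
      fix z assume z: "z \<in> hyp_disc b u0"
      have "hyp_disc b u0 \<subseteq> hyp_disc b u" using hyp_disc_mono[OF b _ uu(1)] u by simp
      then have "G z = F z" using G(2) z by blast
      then show "G z = F0 z" using F(2)[OF z] by simp
    qed
    ultimately have "W v" unfolding W_def by blast
    then show ?thesis by (simp add: v_def)
  qed
  have W: "W (min (u0 + real n * \<delta>) u1)" for n
  proof (induction n)
    case 0
    have "min (u0 + real 0 * \<delta>) u1 = u0" using u by simp
    then show ?case unfolding W_def using F0 by auto
  next
    case (Suc n)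
    have "W (min (min (u0 + real n * \<delta>) u1 + \<delta>) u1)"
      by (rule step) (use Suc u \<open>\<delta> > 0\<close> in auto)
    moreover have "min (min (u0 + real n * \<delta>) u1 + \<delta>) u1 = min (u0 + real (Suc n) * \<delta>) u1"
      using \<open>\<delta> > 0\<close> by (auto simp: min_def algebra_simps)
    ultimately show ?case by simp
  qed
  obtain n :: nat where "u1 - u0 \<le> real n * \<delta>"
    using reals_Archimedean3[OF \<open>\<delta> > 0\<close>] by (meson less_imp_le)
  then have "min (u0 + real n * \<delta>) u1 = u1" by simp
  then have "W u1" using W[of n] by simp
  then show ?thesis unfolding W_def using that by blast
qed

text \<open>The extensions to larger and larger discs agree by the identity theorem and glue together.\<close>

lemma global_section:
  assumes b: "b \<in> Hp" and e: "e > 0" and F0: "sec (ball b e) F0"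
  obtains F where "sec Hp F" "\<And>z. z \<in> ball b e \<Longrightarrow> F z = F0 z"
proof -
  have b0: "Im b > 0" using b by (simp add: upper_half_plane_def)
  define u0 where "u0 = 1 + e / (2 * Im b)"
  have u0: "u0 > 1" using e b0 by (simp add: u0_def)
  have db: "dist b (hyp_centre b u0) = Im b * ((u0 + 1 / u0) / 2 - 1)"
  proof -
    have "hyp_centre b 1 = b" by (simp add: hyp_centre_def complex_eq_iff)
    then show ?thesis using hyp_centre_dist[OF b0, of 1 u0] u0
      by (simp add: dist_commute algebra_simps add_divide_distrib diff_divide_distrib)
  qed
  have "dist (hyp_centre b u0) b + hyp_radius b u0 = Im b * (u0 - 1)"
    unfolding dist_commute[of _ b] db
    by (simp add: hyp_radius_def algebra_simps add_divide_distrib diff_divide_distrib)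
  also have "\<dots> < e" using e b0 by (simp add: u0_def)
  finally have sub: "hyp_disc b u0 \<subseteq> ball b e" by (simp add: ball_subset_ball_iff)
  have bin: "b \<in> hyp_disc b u0"
  proof -
    have "Im b * (1 / u0) < Im b * 1" using u0 b0 by (intro mult_strict_left_mono) auto
    then show ?thesis using db
      by (simp add: dist_commute hyp_radius_def algebra_simps add_divide_distrib diff_divide_distrib)
  qed
  have "sec (hyp_disc b u0) F0" by (rule sec_subset[OF F0 sub]) auto
  then have "\<exists>F. sec (hyp_disc b (u0 + real n)) F \<and> (\<forall>z\<in>hyp_disc b u0. F z = F0 z)" for n
    using section_on_hyp_disc[OF b0 u0, of "u0 + real n" F0] by (metis le_add_same_cancel1 of_nat_0_le_iff)
  then obtain f where f: "\<And>n. sec (hyp_disc b (u0 + real n)) (f n)" "\<And>n z. z \<in> hyp_disc b u0 \<Longrightarrow> f n z = F0 z"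
    by metis
  define E where "E = (\<lambda>n::nat. hyp_disc b (u0 + real n))"
  have fE: "sec (E n) (f n)" for n using f(1) by (simp add: E_def)
  have E0: "E 0 = hyp_disc b u0" by (simp add: E_def)
  have Emono: "E m \<subseteq> E n" if "m \<le> n" for m n
    unfolding E_def by (rule hyp_disc_mono[OF b0]) (use u0 that in auto)
  have le: "f m z = f n z" if "m \<le> n" "z \<in> E m" for m n z
  proof (rule sec_identity[of "E m" _ _ "E 0"])
    show "sec (E m) (f m)" by (rule fE)
    show "sec (E m) (f n)" by (rule sec_subset[OF fE Emono[OF that(1)]]) (simp add: E_def)
    show "connected (E m)" "open (E 0)" by (simp_all add: E_def)
    show "E 0 \<noteq> {}" using bin E0 by blast
    show "E 0 \<subseteq> E m" by (rule Emono) simp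
  qed (use f(2) E0 that in auto)
  have agree: "f m z = f n z" if "z \<in> E m" "z \<in> E n" for m n z
  proof (cases "m \<le> n")
    case True
    then show ?thesis using le that(1) by blast
  next
    case False
    then have "n \<le> m" by simp
    then show ?thesis using le[OF _ that(2)] by simp
  qed
  define F where "F = (\<lambda>z. f (SOME n. z \<in> E n) z)"
  have Ff: "f n z = F z" if "z \<in> E n" for n z
    unfolding F_def by (rule agree[OF that]) (rule someI[of "\<lambda>n. z \<in> E n", OF that])
  have "sec (\<Union>(range E)) F"
  proof (rule sec_Union)
    fix A assume "A \<in> range E"
    then obtain n where "A = E n" by blast
    then show "sec A F" using sec_cong[OF fE Ff] by simp
  qed
  moreover have "\<Union>(range E) = Hp"
  proof
    show "\<Union>(range E) \<subseteq> Hp"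
    proof (rule UN_least)
      fix n
      have "cball (hyp_centre b (u0 + real n)) (hyp_radius b (u0 + real n)) \<subseteq> Hp"
        by (rule hyp_disc_upper[OF b0]) (use u0 in simp)
      then show "E n \<subseteq> Hp" unfolding E_def using ball_subset_cball by (rule order_trans[rotated])
    qed
    show "Hp \<subseteq> \<Union>(range E)"
    proof
      fix z assume "z \<in> Hp"
      then have z: "Im z > 0" by (simp add: upper_half_plane_def)
      obtain n :: nat where n: "((Re z - Re b) ^ 2 + Im z ^ 2 + Im b ^ 2) / (Im z * Im b) < real n"
        using reals_Archimedean2 by blast
      have "z \<in> E n" unfolding E_def by (rule hyp_disc_exhaust[OF b0 z]) (use n u0 in auto)
      then show "z \<in> \<Union>(range E)" by blast
    qed
  qed
  ultimately have FH: "sec Hp F" by simp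
  have FE: "F z = F0 z" if "z \<in> E 0" for z using Ff[OF that] f(2) that E0 by simp
  have bH: "ball b e \<subseteq> Hp" using F0 by (simp add: sec_def)
  have oE: "open (E 0)" "E 0 \<noteq> {}" "E 0 \<subseteq> ball b e"
    using bin sub unfolding E0 by blast+
  have "F z = F0 z" if "z \<in> ball b e" for z
    by (rule sec_identity[OF sec_subset[OF FH bH open_ball] F0 connected_ball oE _ that]) (use FE in blast)
  then show ?thesis using that FH by blast
qed

end

section \<open>Multipliers at the cusp\<close>

text \<open>With \<open>z = s / (2 \<pi> \<i>)\<close> an equation with \<open>1\<close>-periodic coefficients becomes an equation of
  Euler type in \<open>q = exp s\<close>.\<close>

lemma cusp_chart:
  assumes sol: "sol_at Q2 Q3 Y z" and F: "F2 holomorphic_on ball 0 (exp c)" "F3 holomorphic_on ball 0 (exp c)"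
    and eq: "eventually (\<lambda>w. Q2 w = F2 (exp (2 * of_real pi * \<i> * w)) \<and> Q3 w = F3 (exp (2 * of_real pi * \<i> * w))) (nhds z)"
    and z: "2 * of_real pi * \<i> * z \<in> half_plane c"
  obtains y where "euler_ode (\<lambda>_. 0) (\<lambda>x. (2 * of_real pi * \<i>) powi (-2) * F2 x)
      (\<lambda>x. (2 * of_real pi * \<i>) powi (-3) * F3 x) c y"
    "eventually (\<lambda>w. Y w = y (2 * of_real pi * \<i> * w)) (nhds z)"
proof -
  define \<omega> where "\<omega> = 2 * complex_of_real pi * \<i>"
  have \<omega>: "\<omega> \<noteq> 0" by (simp add: \<omega>_def)
  obtain U where U: "open U" "z \<in> U" "ode3 (\<lambda>_. 0) Q2 Q3 U Y" using sol by (auto simp: sol_at_def)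
  obtain V where V: "open V" "z \<in> V" "\<And>w. w \<in> V \<Longrightarrow> Q2 w = F2 (exp (\<omega> * w)) \<and> Q3 w = F3 (exp (\<omega> * w))"
    using eq unfolding eventually_nhds \<omega>_def by blast
  define s where "s = \<omega> * z"
  define W where "W = (\<lambda>t. t / \<omega>) -` (U \<inter> V) \<inter> half_plane c"
  have W: "open W" "s \<in> W"
  proof -
    have "open ((\<lambda>t. t / \<omega>) -` (U \<inter> V))"
      by (rule open_vimage[OF open_Int[OF U(1) V(1)]]) (intro continuous_intros; simp add: \<omega>)
    then show "open W" unfolding W_def using open_half_plane by blast
    show "s \<in> W" using U V z \<omega> by (simp add: W_def s_def \<omega>_def)
  qed
  note D = ode3_derivs[OF U(3,1)]
  have comp: "((\<lambda>t. f (t / \<omega>)) has_field_derivative f' / \<omega>) (at t)"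
    if "(f has_field_derivative f') (at (t / \<omega>))" for f f' and t :: complex
  proof -
    have "((\<lambda>t. t / \<omega>) has_field_derivative 1 / \<omega>) (at t)"
      by (rule DERIV_cdivide[OF DERIV_ident])
    from DERIV_chain2[of f f' "\<lambda>t. t / \<omega>" t, OF that this] show ?thesis by simp
  qed
  define A2 where "A2 = (\<lambda>x. \<omega> powi (-2) * F2 x)"
  define A3 where "A3 = (\<lambda>x. \<omega> powi (-3) * F3 x)"
  have p2: "\<omega> powi (-2) = 1 / \<omega> ^ 2" and p3: "\<omega> powi (-3) = 1 / \<omega> ^ 3"
    by (simp_all add: power_int_minus divide_inverse)
  have o: "ode3 (\<lambda>s. 0) (\<lambda>s. A2 (exp s)) (\<lambda>s. A3 (exp s)) W (\<lambda>t. Y (t / \<omega>))"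
  proof (rule ode3I[OF W(1)])
    fix t assume t: "t \<in> W"
    then have tU: "t / \<omega> \<in> U" and tV: "t / \<omega> \<in> V" by (auto simp: W_def)
    show "((\<lambda>t. Y (t / \<omega>)) has_field_derivative deriv Y (t / \<omega>) / \<omega>) (at t)"
      by (rule comp[OF D(1)[OF tU]])
    have "((\<lambda>t. deriv Y (t / \<omega>) / \<omega>) has_field_derivative (deriv ^^ 2) Y (t / \<omega>) / \<omega> / \<omega>) (at t)"
      by (rule DERIV_cdivide[OF comp[OF D(2)[OF tU]]])
    then show "((\<lambda>t. deriv Y (t / \<omega>) / \<omega>) has_field_derivative (deriv ^^ 2) Y (t / \<omega>) / \<omega> ^ 2) (at t)"
      by (simp add: power2_eq_square)
    have "((\<lambda>t. (deriv ^^ 2) Y (t / \<omega>) / \<omega> ^ 2) has_field_derivative (deriv ^^ 3) Y (t / \<omega>) / \<omega> / \<omega> ^ 2) (at t)"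
      by (rule DERIV_cdivide[OF comp[OF D(3)[OF tU]]])
    then show "((\<lambda>t. (deriv ^^ 2) Y (t / \<omega>) / \<omega> ^ 2) has_field_derivative (deriv ^^ 3) Y (t / \<omega>) / \<omega> ^ 3) (at t)"
      by (simp add: power2_eq_square power3_eq_cube mult.assoc)
    have "(deriv ^^ 3) Y (t / \<omega>) + F2 (exp t) * deriv Y (t / \<omega>) + F3 (exp t) * Y (t / \<omega>) = 0"
      using D(4)[OF tU] V(3)[OF tV] \<omega> by simp
    then have "((deriv ^^ 3) Y (t / \<omega>) + F2 (exp t) * deriv Y (t / \<omega>) + F3 (exp t) * Y (t / \<omega>)) / \<omega> ^ 3 = 0"
      by simp
    then show "(deriv ^^ 3) Y (t / \<omega>) / \<omega> ^ 3 + 0 * ((deriv ^^ 2) Y (t / \<omega>) / \<omega> ^ 2)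
        + A2 (exp t) * (deriv Y (t / \<omega>) / \<omega>) + A3 (exp t) * Y (t / \<omega>) = 0"
      unfolding A2_def A3_def p2 p3 add_divide_distrib by (simp add: power2_eq_square power3_eq_cube)
  qed
  have hol: "(\<lambda>_. 0) holomorphic_on half_plane c" "(\<lambda>s. A2 (exp s)) holomorphic_on half_plane c"
      "(\<lambda>s. A3 (exp s)) holomorphic_on half_plane c"
  proof -
    have e: "exp holomorphic_on half_plane c" "exp ` half_plane c \<subseteq> ball (0::complex) (exp c)"
      using exp_in_punctured_ball[of _ c] by (auto intro: holomorphic_intros)
    have "A2 holomorphic_on ball 0 (exp c)" "A3 holomorphic_on ball 0 (exp c)"
      unfolding A2_def A3_def by (intro holomorphic_intros F)+
    then show "(\<lambda>s. A2 (exp s)) holomorphic_on half_plane c" "(\<lambda>s. A3 (exp s)) holomorphic_on half_plane c"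
      using holomorphic_on_compose_gen[OF e(1) _ e(2)] by (auto simp: o_def)
  qed simp
  have sH: "s \<in> half_plane c" using W(2) by (simp add: W_def)
  obtain y where y: "ode3 (\<lambda>s. 0) (\<lambda>s. A2 (exp s)) (\<lambda>s. A3 (exp s)) (half_plane c) y"
      "y s = Y (s / \<omega>)" "deriv y s = deriv (\<lambda>t. Y (t / \<omega>)) s" "(deriv ^^ 2) y s = (deriv ^^ 2) (\<lambda>t. Y (t / \<omega>)) s"
    using ode3_solution_exists[OF open_half_plane convex_half_plane sH hol] by blast
  obtain d where d: "d > 0" "ball s d \<subseteq> W" using openE[OF W] by blast
  have dH: "ball s d \<subseteq> half_plane c" using d(2) by (auto simp: W_def)
  have "y t = Y (t / \<omega>)" if "t \<in> ball s d" for t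
    by (rule ode3_unique[OF open_ball connected_ball _ _ _ ode3_subset[OF y(1) dH] ode3_subset[OF o d(2)] _ y(2-4) that])
       (use hol dH d(1) holomorphic_on_subset in auto)
  then have "eventually (\<lambda>t. y t = Y (t / \<omega>)) (nhds s)"
    unfolding eventually_nhds using d(1) by (intro exI[of _ "ball s d"]) auto
  moreover have "filterlim (\<lambda>w. \<omega> * w) (nhds s) (nhds z)"
    unfolding s_def by (intro tendsto_intros filterlim_ident)
  ultimately have "eventually (\<lambda>w. y (\<omega> * w) = Y (\<omega> * w / \<omega>)) (nhds z)"
    by (rule eventually_compose_filterlim)
  then have "eventually (\<lambda>w. Y w = y (\<omega> * w)) (nhds z)" by eventually_elim (simp add: \<omega>)
  then show ?thesis using that[of y] y(1) by (simp add: euler_ode_def A2_def A3_def \<omega>_def)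
qed

text \<open>The quotient \<open>y(s + 2 \<pi> \<i>) / y(s)\<close> takes finitely many values, the cube roots of \<open>\<gamma>\<close>, and is
  therefore locally constant.\<close>

lemma multiplier_of_cube:
  assumes y: "y holomorphic_on half_plane c"
    and U: "open U" "U \<noteq> {}" "U \<subseteq> half_plane c"
    and cube: "\<And>s. s \<in> U \<Longrightarrow> y (s + 2 * of_real pi * \<i>) ^ 3 = \<gamma> * y s ^ 3"
    and nz: "\<And>s. s \<in> U \<Longrightarrow> y s \<noteq> 0"
  obtains \<mu> where "\<mu> ^ 3 = \<gamma>" "\<And>s. s \<in> half_plane c \<Longrightarrow> y (s + 2 * of_real pi * \<i>) = \<mu> * y s"
proof -
  obtain s0 where s0: "s0 \<in> U" using U by blast
  obtain d where d: "d > 0" "ball s0 d \<subseteq> U" using openE[OF U(1) s0] by blast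
  have y2: "(\<lambda>s. y (s + 2 * of_real pi * \<i>)) holomorphic_on half_plane c"
    using holomorphic_on_compose_gen[of "\<lambda>s. s + 2 * of_real pi * \<i>" "half_plane c", OF _ y]
    by (force simp: o_def half_plane_add_2pi intro: holomorphic_intros)
  define t where "t = (\<lambda>s. y (s + 2 * of_real pi * \<i>) / y s)"
  have sub: "ball s0 d \<subseteq> half_plane c" using d U by blast
  have "t holomorphic_on ball s0 d" unfolding t_def
    using nz d by (intro holomorphic_intros holomorphic_on_subset[OF y2 sub] holomorphic_on_subset[OF y sub]) auto
  then have ct: "continuous_on (ball s0 d) t" by (rule holomorphic_on_imp_continuous_on)
  have t3: "t s ^ 3 = \<gamma>" if "s \<in> ball s0 d" for s
    using cube[of s] nz[of s] that d by (auto simp: t_def power_divide)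
  have "t ` ball s0 d \<subseteq> {w. w ^ 3 = \<gamma>}" using t3 by blast
  moreover have "finite {w::complex. w ^ 3 = \<gamma>}"
    by (rule finite_nth_roots) simp
  ultimately have "finite (t ` ball s0 d)" by (rule finite_subset)
  then have "t constant_on ball s0 d"
    by (intro continuous_finite_range_constant[OF connected_ball ct])
  then obtain \<mu> where \<mu>: "\<And>s. s \<in> ball s0 d \<Longrightarrow> t s = \<mu>" unfolding constant_on_def by blast
  have "y (s + 2 * of_real pi * \<i>) = \<mu> * y s" if "s \<in> half_plane c" for s
  proof (rule analytic_continuation_open[OF open_ball open_half_plane _ connected_half_plane sub y2 _ _ that])
    show "(\<lambda>s. \<mu> * y s) holomorphic_on half_plane c" by (intro holomorphic_intros y)
    show "y (w + 2 * of_real pi * \<i>) = \<mu> * y w" if "w \<in> ball s0 d" for w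
      using \<mu>[OF that] nz[of w] that d by (auto simp: t_def field_simps)
  qed (use d in auto)
  moreover have "\<mu> ^ 3 = \<gamma>" using t3[of s0] \<mu>[of s0] d by simp
  ultimately show ?thesis by (rule that[rotated])
qed

lemma multiplier_of_mixed_cube:
  assumes y: "y1 holomorphic_on half_plane c" "y2 holomorphic_on half_plane c"
    and U: "open U" "U \<noteq> {}" "U \<subseteq> half_plane c" and m: "\<mu> \<noteq> 0"
    and y1: "\<And>s. s \<in> half_plane c \<Longrightarrow> y1 (s + 2 * of_real pi * \<i>) = \<mu> * y1 s"
    and mixed: "\<And>s. s \<in> U \<Longrightarrow> y1 (s + 2 * of_real pi * \<i>) ^ 2 * y2 (s + 2 * of_real pi * \<i>) = \<gamma> * (y1 s ^ 2 * y2 s)"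
    and nz: "\<And>s. s \<in> U \<Longrightarrow> y1 s \<noteq> 0" and s: "s \<in> half_plane c"
  shows "y2 (s + 2 * of_real pi * \<i>) = \<gamma> / \<mu> ^ 2 * y2 s"
proof (rule analytic_continuation_open[OF U(1) open_half_plane U(2) connected_half_plane U(3) _ _ _ s])
  show "(\<lambda>s. y2 (s + 2 * of_real pi * \<i>)) holomorphic_on half_plane c"
    using holomorphic_on_compose_gen[of "\<lambda>s. s + 2 * of_real pi * \<i>" "half_plane c", OF _ y(2)]
    by (force simp: o_def half_plane_add_2pi intro: holomorphic_intros)
  show "(\<lambda>s. \<gamma> / \<mu> ^ 2 * y2 s) holomorphic_on half_plane c" by (intro holomorphic_intros y)
  show "y2 (w + 2 * of_real pi * \<i>) = \<gamma> / \<mu> ^ 2 * y2 w" if "w \<in> U" for w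
  proof -
    have "\<mu> ^ 2 * y1 w ^ 2 * y2 (w + 2 * of_real pi * \<i>) = \<gamma> * (y1 w ^ 2 * y2 w)"
      using mixed[OF that] y1[of w] that U by (auto simp: power_mult_distrib)
    then have "y1 w ^ 2 * (\<mu> ^ 2 * y2 (w + 2 * of_real pi * \<i>)) = y1 w ^ 2 * (\<gamma> * y2 w)"
      by (simp add: mult_ac)
    then have "\<mu> ^ 2 * y2 (w + 2 * of_real pi * \<i>) = \<gamma> * y2 w"
      using nz[OF that] by (subst (asm) mult_cancel_left) simp
    then show ?thesis using m by (simp add: field_simps)
  qed
qed

context scalar_equation
begin

lemma mobius_upper: "Im z > 0 \<Longrightarrow> Im t = 0 \<Longrightarrow> - 1 / (z + t) \<in> Hp \<and> z + t \<noteq> 0"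
proof -
  assume z: "Im z > 0" "Im t = 0"
  have nz: "z + t \<noteq> 0" using z by (auto simp: complex_eq_iff)
  have "Im (- 1 / (z + t)) = Im (z + t) / (norm (z + t)) ^ 2"
  proof -
    have "Im (- 1 / w) = Im w / (norm w) ^ 2" for w
      by (simp add: Im_divide cmod_power2)
    then show ?thesis .
  qed
  also have "\<dots> > 0" using z nz by simp
  finally show ?thesis using nz by (simp add: upper_half_plane_def)
qed

text \<open>Both sides are holomorphic off \<open>X\<close> and the preimage of \<open>X\<close> under the substitution. This is a sparse
  set, so its complement is connected.\<close>

lemma law_propagates:
  fixes t :: complex
  assumes a: "a holomorphic_on (Hp - X)" and t: "Im t = 0" and z0: "z0 \<in> Hp"
    and law: "eventually (\<lambda>z. (z + t) ^ 6 * a (- 1 / (z + t)) = C * a z) (at z0)"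
    and z: "z \<in> Hp - X" "- 1 / (z + t) \<notin> X"
  shows "(z + t) ^ 6 * a (- 1 / (z + t)) = C * a z"
proof -
  define g where "g = (\<lambda>z. - 1 / (z + t))"
  define X' where "X' = {z \<in> Hp. g z \<in> X}"
  have oH: "open Hp" "connected Hp"
    by (auto simp: upper_half_plane_def open_halfspace_Im_gt intro: convex_connected convex_halfspace_Im_gt)
  have gH: "g z \<in> Hp" "z + t \<noteq> 0" if "z \<in> Hp" for z
    using mobius_upper[OF _ t, of z] that by (auto simp: g_def upper_half_plane_def)
  have hg: "g holomorphic_on Hp" unfolding g_def using gH(2) by (intro holomorphic_intros) auto
  have inj: "inj_on g Hp" using gH(2) by (auto simp: inj_on_def g_def field_simps)
  have "eventually (\<lambda>w. w \<notin> X') (at z)" if z: "z \<in> Hp" for z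
  proof -
    have ev: "eventually (\<lambda>w. w \<notin> X) (at (g z))"
      using eventually_cosparse_imp_eventually_at[OF eventually_not_in_cosparse[OF X(2)] gH(1)[OF z]] .
    have "isCont g z" using holomorphic_on_imp_continuous_on[OF hg] oH z continuous_on_eq_continuous_at by blast
    then have lim: "g \<midarrow>z\<rightarrow> g z" by (simp add: isCont_def)
    have evH: "eventually (\<lambda>w. w \<in> Hp) (at z)" using oH(1) z by (meson eventually_at_topological)
    have "eventually (\<lambda>w. g w \<noteq> g z) (at z)"
    proof -
      have "eventually (\<lambda>w. w \<noteq> z) (at z)" by (simp add: eventually_at_filter)
      with evH show ?thesis by eventually_elim (use inj z in \<open>auto simp: inj_on_def\<close>)
    qed
    then have "filterlim g (at (g z)) (at z)" using lim by (simp add: filterlim_at)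
    from eventually_compose_filterlim[OF ev this] show ?thesis
      by eventually_elim (simp add: X'_def)
  qed
  then have "eventually (\<lambda>w. w \<notin> X') (cosparse Hp)"
    by (subst eventually_cosparse_open_eq[OF oH(1)]) blast
  then have sp': "X' sparse_in Hp" by (simp add: eventually_cosparse)
  have sp: "(X \<union> X') sparse_in Hp" by (rule sparse_in_union'[OF X(2) sp'])
  define V where "V = Hp - (X \<union> X')"
  have V: "open V" "connected V" unfolding V_def
    using open_diff_sparse_pts[OF oH(1) sp] sparse_imp_connected[OF _ oH(2,1) sp] by auto
  have ha: "a holomorphic_on V" using holomorphic_on_subset[OF a] by (auto simp: V_def)
  have hag: "(\<lambda>z. a (g z)) holomorphic_on V"
    using holomorphic_on_compose_gen[OF holomorphic_on_subset[OF hg] a, of V] gH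
    by (force simp: V_def X'_def o_def)
  obtain d where d: "d > 0" "\<And>z. z \<noteq> z0 \<Longrightarrow> dist z z0 < d \<Longrightarrow> (z + t) ^ 6 * a (g z) = C * a z"
    using law unfolding eventually_at g_def by auto
  have "eventually (\<lambda>w. w \<notin> X \<union> X') (at z0)"
    using eventually_cosparse_imp_eventually_at[OF eventually_not_in_cosparse[OF sp] z0] .
  moreover have "eventually (\<lambda>w. w \<in> Hp \<inter> ball z0 d \<and> w \<noteq> z0) (at z0)"
    unfolding eventually_at_topological using oH(1) z0 d(1) by (intro exI[of _ "Hp \<inter> ball z0 d"]) auto
  ultimately have "eventually (\<lambda>w. w \<in> V \<inter> (ball z0 d - {z0})) (at z0)"
    by eventually_elim (auto simp: V_def)
  then have ne: "V \<inter> (ball z0 d - {z0}) \<noteq> {}"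
    using eventually_happens[of _ "at z0"] by (metis at_neq_bot empty_iff)
  have "(z + t) ^ 6 * a (g z) = C * a z"
  proof (rule analytic_continuation_open[of "V \<inter> (ball z0 d - {z0})" V
        "\<lambda>z. (z + t) ^ 6 * a (g z)" "\<lambda>z. C * a z" z])
    show "open (V \<inter> (ball z0 d - {z0}))" using V(1) by auto
    show "(\<lambda>z. (z + t) ^ 6 * a (g z)) holomorphic_on V" by (intro holomorphic_intros hag)
    show "(\<lambda>z. C * a z) holomorphic_on V" by (intro holomorphic_intros ha)
    show "z \<in> V" using z by (auto simp: V_def X'_def g_def)
    show "(w + t) ^ 6 * a (g w) = C * a w" if "w \<in> V \<inter> (ball z0 d - {z0})" for w
      using d(2)[of w] that by (auto simp: dist_commute)
  qed (use V ne in auto)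
  then show ?thesis by (simp add: g_def)
qed

lemma sec_nonzero_propagates:
  assumes F: "sec Hp F" and B: "open B" "B \<noteq> {}" "B \<subseteq> Hp" and z: "z \<in> Hp - X"
  shows "fst (F z) \<noteq> 0 \<Longrightarrow> \<not> (\<forall>w\<in>B - X. fst (F w) = 0)"
    and "snd (F z) \<noteq> 0 \<Longrightarrow> \<not> (\<forall>w\<in>B - X. snd (F w) = 0)"
proof -
  have oH: "open Hp" "connected Hp"
    by (auto simp: upper_half_plane_def open_halfspace_Im_gt intro: convex_connected convex_halfspace_Im_gt)
  have sub: "B - X \<subseteq> Hp - X" using B(3) by blast
  show "\<not> (\<forall>w\<in>B - X. fst (F w) = 0)" if "fst (F z) \<noteq> 0"
  proof
    assume z0: "\<forall>w\<in>B - X. fst (F w) = 0"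
    have "fst (F z) = 0"
      by (rule analytic_continuation_open[OF open_diff_X[OF B(1,3)] open_diff_X[OF oH(1)] diff_X_nonempty[OF B]
           connected_diff_X[OF oH] sub sec_holomorphic(1)[OF F] holomorphic_on_const[of 0] _ z])
         (use z0 in auto)
    then show False using that by simp
  qed
  show "\<not> (\<forall>w\<in>B - X. snd (F w) = 0)" if "snd (F z) \<noteq> 0"
  proof
    assume z0: "\<forall>w\<in>B - X. snd (F w) = 0"
    have "snd (F z) = 0"
      by (rule analytic_continuation_open[OF open_diff_X[OF B(1,3)] open_diff_X[OF oH(1)] diff_X_nonempty[OF B]
           connected_diff_X[OF oH] sub sec_holomorphic(2)[OF F] holomorphic_on_const[of 0] _ z])
         (use z0 in auto)
    then show False using that by simp
  qed
qed

text \<open>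
  The relation \<open>R = S T\<close> turns the multipliers of a global section under \<open>S\<close> and \<open>R\<close> into
  multipliers under the translation \<open>T\<close>. Near the cusp the section comes from two solutions that
  are multiplied by constants under \<open>T\<close>, and by the exponents at the cusp both constants are \<open>\<mu>\<close>.
\<close>

lemma multiplier_ratio:
  assumes F: "sec Hp F" and nz: "z1 \<in> Hp - X" "fst (F z1) \<noteq> 0" "z2 \<in> Hp - X" "snd (F z2) \<noteq> 0"
    and p: "p \<in> Hp" "p' \<in> Hp"
    and S: "eventually (\<lambda>z. (z + 0) ^ 6 * fst (F (- 1 / (z + 0))) = \<alpha>1 * fst (F z)) (at p)"
      "eventually (\<lambda>z. (z + 0) ^ 6 * snd (F (- 1 / (z + 0))) = \<alpha>2 * snd (F z)) (at p)"
    and R: "eventually (\<lambda>z. (z + 1) ^ 6 * fst (F (- 1 / (z + 1))) = \<beta>1 * fst (F z)) (at p')"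
      "eventually (\<lambda>z. (z + 1) ^ 6 * snd (F (- 1 / (z + 1))) = \<beta>2 * snd (F z)) (at p')"
    and \<alpha>: "\<alpha>1 \<noteq> 0" "\<alpha>2 \<noteq> 0" "\<beta>1 \<noteq> 0"
    and cF: "F2 holomorphic_on ball 0 (exp c)" "F3 holomorphic_on ball 0 (exp c)"
    and cQ: "\<And>z. 2 * of_real pi * \<i> * z \<in> half_plane c \<Longrightarrow> z \<in> Hp - X \<Longrightarrow>
        Q2 z = F2 (exp (2 * of_real pi * \<i> * z)) \<and> Q3 z = F3 (exp (2 * of_real pi * \<i> * z))"
    and c: "c < 0"
    and roots: "\<And>\<kappa>. \<kappa> ^ 3 + ((2 * of_real pi * \<i>) powi (-2) * F2 0) * \<kappa>
        + (2 * of_real pi * \<i>) powi (-3) * F3 0 = 0 \<Longrightarrow> exp (2 * of_real pi * \<i> * \<kappa>) = \<mu>"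
  shows "\<beta>1 / \<alpha>1 = \<beta>2 / \<alpha>2"
proof -
  define \<omega> where "\<omega> = 2 * complex_of_real pi * \<i>"
  have \<omega>: "\<omega> \<noteq> 0" by (simp add: \<omega>_def)
  define L where "L = {z. \<omega> * z \<in> half_plane c}"
  have LIm: "z \<in> L \<longleftrightarrow> Im z > - c / (2 * pi)" for z
    by (simp add: L_def \<omega>_def half_plane_def field_simps; linarith)
  have L: "open L" "connected L" "L \<noteq> {}" "L \<subseteq> Hp"
  proof -
    have e: "L = {z. Im z > - c / (2 * pi)}" using LIm by auto
    show "open L" "connected L" unfolding e
      by (auto intro: open_halfspace_Im_gt convex_connected convex_halfspace_Im_gt)
    have "Complex 0 (- c / (2 * pi) + 1) \<in> L" by (simp add: LIm)
    then show "L \<noteq> {}" by blast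
    have "- c / (2 * pi) > 0" using c by (intro divide_pos_pos) auto
    then show "L \<subseteq> Hp" using LIm by (force simp: upper_half_plane_def)
  qed
  define a where "a = (\<lambda>z. fst (F z))"
  define b where "b = (\<lambda>z. snd (F z))"
  have S': "eventually (\<lambda>z. (z + 0) ^ 6 * a (- 1 / (z + 0)) = \<alpha>1 * a z) (at p)"
      "eventually (\<lambda>z. (z + 0) ^ 6 * b (- 1 / (z + 0)) = \<alpha>2 * b z) (at p)"
    and R': "eventually (\<lambda>z. (z + 1) ^ 6 * a (- 1 / (z + 1)) = \<beta>1 * a z) (at p')"
      "eventually (\<lambda>z. (z + 1) ^ 6 * b (- 1 / (z + 1)) = \<beta>2 * b z) (at p')"
    unfolding a_def b_def using S R by blast+
  note hol = sec_holomorphic[OF F, folded a_def b_def]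
  note LX = open_diff_X[OF L(1,4)] diff_X_nonempty[OF L(1,3,4)] connected_diff_X[OF L(1,2,4)]
  \<comment> \<open>the section near the cusp in terms of solutions \<open>y1\<close>, \<open>y2\<close> on a half-plane\<close>
  obtain z where z: "z \<in> L - X" using LX(2) by blast
  obtain Y1 Y2 where Y: "sol_at Q2 Q3 Y1 z" "sol_at Q2 Q3 Y2 z"
      "eventually (\<lambda>w. F w = (Y1 w ^ 2 * Y1 w, Y1 w ^ 2 * Y2 w)) (nhds z)"
    using F z L(4) unfolding sec_def by blast
  have evL: "eventually (\<lambda>w. w \<in> L - X) (nhds z)" by (rule eventually_nhds_in_open[OF LX(1) z])
  have eq: "eventually (\<lambda>w. Q2 w = F2 (exp (2 * of_real pi * \<i> * w)) \<and> Q3 w = F3 (exp (2 * of_real pi * \<i> * w))) (nhds z)"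
    using evL by eventually_elim (rule cQ, use L(4) in \<open>auto simp: L_def \<omega>_def\<close>)
  have zc: "2 * of_real pi * \<i> * z \<in> half_plane c" using z by (simp add: L_def \<omega>_def)
  define A2 where "A2 = (\<lambda>x. \<omega> powi (-2) * F2 x)"
  define A3 where "A3 = (\<lambda>x. \<omega> powi (-3) * F3 x)"
  have A: "(\<lambda>_. 0) holomorphic_on ball 0 (exp c)" "A2 holomorphic_on ball 0 (exp c)" "A3 holomorphic_on ball 0 (exp c)"
    unfolding A2_def A3_def by (intro holomorphic_intros cF)+
  obtain y1 where y1: "euler_ode (\<lambda>_. 0) A2 A3 c y1" "eventually (\<lambda>w. Y1 w = y1 (\<omega> * w)) (nhds z)"
    using cusp_chart[OF Y(1) cF eq zc] unfolding A2_def A3_def \<omega>_def by blast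
  obtain y2 where y2: "euler_ode (\<lambda>_. 0) A2 A3 c y2" "eventually (\<lambda>w. Y2 w = y2 (\<omega> * w)) (nhds z)"
    using cusp_chart[OF Y(2) cF eq zc] unfolding A2_def A3_def \<omega>_def by blast
  have hy: "y1 holomorphic_on half_plane c" "y2 holomorphic_on half_plane c"
    using y1 y2 by (auto simp: euler_ode_def ode3_def)
  have hyL: "(\<lambda>w. y1 (\<omega> * w)) holomorphic_on L" "(\<lambda>w. y2 (\<omega> * w)) holomorphic_on L"
    using holomorphic_on_compose_gen[of "\<lambda>w. \<omega> * w" L, OF _ hy(1)] holomorphic_on_compose_gen[of "\<lambda>w. \<omega> * w" L, OF _ hy(2)]
    by (force simp: o_def L_def intro: holomorphic_intros)+
  have "eventually (\<lambda>w. w \<in> L - X \<and> a w = y1 (\<omega> * w) ^ 3 \<and> b w = y1 (\<omega> * w) ^ 2 * y2 (\<omega> * w)) (nhds z)"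
    using Y(3) y1(2) y2(2) evL
    by eventually_elim (simp add: a_def b_def power2_eq_square power3_eq_cube)
  then obtain B where B: "open B" "z \<in> B" "\<And>w. w \<in> B \<Longrightarrow> w \<in> L - X \<and> a w = y1 (\<omega> * w) ^ 3 \<and> b w = y1 (\<omega> * w) ^ 2 * y2 (\<omega> * w)"
    unfolding eventually_nhds by blast
  have LX': "L - X \<subseteq> Hp - X" "L - X \<subseteq> L" using L(4) by auto
  have BL: "B \<subseteq> L - X" "B \<noteq> {}" using B by auto
  have aL: "a w = y1 (\<omega> * w) ^ 3" if "w \<in> L - X" for w
    by (rule analytic_continuation_open[OF B(1) LX(1) BL(2) LX(3) BL(1) holomorphic_on_subset[OF hol(1) LX'(1)] _ _ that])
       (use B(3) in \<open>auto intro!: holomorphic_intros holomorphic_on_subset[OF hyL(1)]\<close>)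
  have bL: "b w = y1 (\<omega> * w) ^ 2 * y2 (\<omega> * w)" if "w \<in> L - X" for w
    by (rule analytic_continuation_open[OF B(1) LX(1) BL(2) LX(3) BL(1) holomorphic_on_subset[OF hol(2) LX'(1)] _ _ that])
       (use B(3) in \<open>auto intro!: holomorphic_intros holomorphic_on_subset[OF hyL(1)] holomorphic_on_subset[OF hyL(2)]\<close>)
  \<comment> \<open>both solutions are nonzero\<close>
  have "\<not> (\<forall>w\<in>L - X. a w = 0)" "\<not> (\<forall>w\<in>L - X. b w = 0)"
    using sec_nonzero_propagates(1)[OF F L(1,3,4) nz(1,2)] sec_nonzero_propagates(2)[OF F L(1,3,4) nz(3,4)]
    by (auto simp: a_def b_def)
  then obtain w1 w2 where w: "w1 \<in> L - X" "a w1 \<noteq> 0" "w2 \<in> L - X" "b w2 \<noteq> 0" by blast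
  have nz1: "y1 (\<omega> * w1) \<noteq> 0" "\<omega> * w1 \<in> half_plane c" using aL[OF w(1)] w by (auto simp: L_def)
  have nz2: "y2 (\<omega> * w2) \<noteq> 0" "\<omega> * w2 \<in> half_plane c" using bL[OF w(3)] w by (auto simp: L_def)
  \<comment> \<open>an open set on which the relation of \<open>S\<close>, \<open>R\<close> and \<open>T\<close> can be evaluated\<close>
  define g where "g = (\<lambda>w::complex. - 1 / (w + 1))"
  define N where "N = {w \<in> L. y1 (\<omega> * w) \<noteq> 0}"
  have "open N"
  proof -
    have "N = L \<inter> (\<lambda>w. y1 (\<omega> * w)) -` (- {0})" by (auto simp: N_def)
    then show ?thesis
      using continuous_open_preimage[OF holomorphic_on_imp_continuous_on[OF hyL(1)] L(1), of "- {0}"] by auto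
  qed
  have w1N: "w1 \<in> N" using nz1 w by (auto simp: N_def)
  have NL: "N \<subseteq> L" by (auto simp: N_def)
  have shiftL: "w + 1 \<in> L \<longleftrightarrow> w \<in> L" for w by (simp add: LIm)
  obtain N1 where N1: "open N1" "N1 \<noteq> {}" "N1 \<subseteq> N - X"
    using open_diff_X[OF \<open>open N\<close>] diff_X_nonempty[OF \<open>open N\<close>] w1N NL L(4) by (metis empty_iff order_trans subset_refl)
  obtain N2 where N2: "open N2" "N2 \<noteq> {}" "N2 \<subseteq> N1" "\<And>w. w \<in> N2 \<Longrightarrow> w + 1 \<notin> X"
  proof -
    define M where "M = (\<lambda>w. w + 1) ` N1"
    have M: "open M" "M \<noteq> {}" "M \<subseteq> Hp"
      using open_translation[OF N1(1), of 1] N1 NL L(4) shiftL by (auto simp: M_def add.commute[of 1])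
    have "open ((\<lambda>w. w - 1) ` (M - X))"
      using open_translation[OF open_diff_X[OF M(1,3)], of "- 1"] by (simp add: add.commute[of "-1"])
    moreover have "(\<lambda>w. w - 1) ` (M - X) \<noteq> {}" using diff_X_nonempty[OF M] by blast
    ultimately show ?thesis by (intro that[of "(\<lambda>w. w - 1) ` (M - X)"]) (auto simp: M_def)
  qed
  have N2H: "N2 \<subseteq> Hp" "N2 \<subseteq> L" using N2(3) N1(3) NL L(4) by blast+
  obtain N3 where N3: "open N3" "N3 \<noteq> {}" "N3 \<subseteq> N2" "\<And>w. w \<in> N3 \<Longrightarrow> g w \<notin> X"
  proof -
    have gH: "g w \<in> Hp" "w + 1 \<noteq> 0" if "w \<in> Hp" for w
      using mobius_upper[of w 1] that by (auto simp: g_def upper_half_plane_def)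
    have hg: "g holomorphic_on N2" unfolding g_def using gH(2) N2H by (intro holomorphic_intros) auto
    have "inj_on g N2" using gH(2) N2H by (auto simp: inj_on_def g_def field_simps)
    then have og: "open (g ` N2)" by (rule open_mapping_thm3[OF hg N2(1)])
    have gN: "g ` N2 \<noteq> {}" "g ` N2 \<subseteq> Hp" using N2 gH N2H by auto
    have "open (N2 \<inter> g -` (g ` N2 - X))"
      by (rule continuous_open_preimage[OF holomorphic_on_imp_continuous_on[OF hg] N2(1) open_diff_X[OF og gN(2)]])
    moreover have "N2 \<inter> g -` (g ` N2 - X) \<noteq> {}" using diff_X_nonempty[OF og gN] by blast
    ultimately show ?thesis by (intro that[of "N2 \<inter> g -` (g ` N2 - X)"]) auto
  qed
  have rel: "a (w + 1) = \<beta>1 / \<alpha>1 * a w \<and> b (w + 1) = \<beta>2 / \<alpha>2 * b w" if w: "w \<in> N3" for w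
  proof -
    have m: "w \<in> L" "w \<notin> X" "w + 1 \<notin> X" "g w \<notin> X" using w N3 N2 N1 NL by blast+
    have h: "w \<in> Hp - X" "w + 1 \<in> Hp - X" using m L(4) shiftL by blast+
    have gw: "- 1 / (w + 1) \<notin> X" "- 1 / ((w + 1) + 0) \<notin> X" using m(4) by (auto simp: g_def)
    have i0: "Im (0::complex) = 0" "Im (1::complex) = 0" by auto
    have "(w + 1) ^ 6 * a (- 1 / (w + 1)) = \<beta>1 * a w" "(w + 1) ^ 6 * b (- 1 / (w + 1)) = \<beta>2 * b w"
      using law_propagates[OF hol(1) i0(2) p(2) R'(1) h(1) gw(1)]
        law_propagates[OF hol(2) i0(2) p(2) R'(2) h(1) gw(1)] by auto
    moreover have "(w + 1) ^ 6 * a (- 1 / (w + 1)) = \<alpha>1 * a (w + 1)" "(w + 1) ^ 6 * b (- 1 / (w + 1)) = \<alpha>2 * b (w + 1)"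
      using law_propagates[OF hol(1) i0(1) p(1) S'(1) h(2) gw(2)]
        law_propagates[OF hol(2) i0(1) p(1) S'(2) h(2) gw(2)] by auto
    ultimately have "\<alpha>1 * a (w + 1) = \<beta>1 * a w" "\<alpha>2 * b (w + 1) = \<beta>2 * b w" by simp_all
    then show ?thesis using \<alpha> by (simp add: field_simps)
  qed
  define U where "U = (\<lambda>w. \<omega> * w) ` N3"
  have oU: "open U"
  proof -
    have "U = (\<lambda>s. s / \<omega>) -` N3" using \<omega> by (force simp: U_def)
    moreover have "continuous_on UNIV (\<lambda>s. s / \<omega>)" using \<omega> by (intro continuous_intros) auto
    ultimately show ?thesis using open_vimage[OF N3(1)] by simp
  qed
  have U: "U \<noteq> {}" "U \<subseteq> half_plane c" using N3 N2H by (auto simp: U_def L_def)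
  have Unz: "y1 s \<noteq> 0" if "s \<in> U" for s using that N3 N2 N1 by (auto simp: U_def N_def)
  have sh: "\<omega> * w + 2 * of_real pi * \<i> = \<omega> * (w + 1)" for w by (simp add: \<omega>_def algebra_simps)
  have memb: "w \<in> L - X" "w + 1 \<in> L - X" if "w \<in> N3" for w
    using that N3 N2 N1 NL shiftL by blast+
  have cube: "y1 (s + 2 * of_real pi * \<i>) ^ 3 = \<beta>1 / \<alpha>1 * y1 s ^ 3" if "s \<in> U" for s
  proof -
    obtain w where w: "w \<in> N3" "s = \<omega> * w" using \<open>s \<in> U\<close> by (auto simp: U_def)
    show ?thesis using rel[OF w(1)] aL[OF memb(1)[OF w(1)]] aL[OF memb(2)[OF w(1)]]
      unfolding w(2) sh by simp
  qed
  have mixed: "y1 (s + 2 * of_real pi * \<i>) ^ 2 * y2 (s + 2 * of_real pi * \<i>) = \<beta>2 / \<alpha>2 * (y1 s ^ 2 * y2 s)" if "s \<in> U" for s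
  proof -
    obtain w where w: "w \<in> N3" "s = \<omega> * w" using \<open>s \<in> U\<close> by (auto simp: U_def)
    show ?thesis using rel[OF w(1)] bL[OF memb(1)[OF w(1)]] bL[OF memb(2)[OF w(1)]]
      unfolding w(2) sh by simp
  qed
  obtain \<mu>1 where \<mu>1: "\<mu>1 ^ 3 = \<beta>1 / \<alpha>1" "\<And>s. s \<in> half_plane c \<Longrightarrow> y1 (s + 2 * of_real pi * \<i>) = \<mu>1 * y1 s"
    using multiplier_of_cube[OF hy(1) oU U cube Unz] by blast
  have "\<mu>1 \<noteq> 0" using \<mu>1(1) \<alpha> by auto
  have y2m: "y2 (s + 2 * of_real pi * \<i>) = (\<beta>2 / \<alpha>2) / \<mu>1 ^ 2 * y2 s" if "s \<in> half_plane c" for s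
    by (rule multiplier_of_mixed_cube[OF hy oU U \<open>\<mu>1 \<noteq> 0\<close> \<mu>1(2) mixed Unz that])
  have roots': "exp (2 * of_real pi * \<i> * \<kappa>) = \<mu>" if "\<kappa> ^ 3 + 0 * \<kappa> ^ 2 + A2 0 * \<kappa> + A3 0 = 0" for \<kappa>
    by (rule roots) (use that in \<open>simp add: A2_def A3_def \<omega>_def\<close>)
  obtain k1 where k1: "exp (2 * of_real pi * \<i> * k1) = \<mu>1" "k1 ^ 3 + 0 * k1 ^ 2 + A2 0 * k1 + A3 0 = 0"
    using multiplicative_solution[OF A y1(1) \<mu>1(2) nz1(2,1)] by blast
  obtain k2 where k2: "exp (2 * of_real pi * \<i> * k2) = (\<beta>2 / \<alpha>2) / \<mu>1 ^ 2" "k2 ^ 3 + 0 * k2 ^ 2 + A2 0 * k2 + A3 0 = 0"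
    using multiplicative_solution[OF A y2(1) y2m nz2(2,1)] by blast
  have m1: "\<mu>1 = (\<beta>2 / \<alpha>2) / \<mu>1 ^ 2" using roots'[OF k1(2)] roots'[OF k2(2)] k1(1) k2(1) by simp
  have alg: "x * y = q" if "x = q / y" "y \<noteq> 0" for x y q :: complex
    unfolding that(1) using that(2) by simp
  have "\<mu>1 * \<mu>1 ^ 2 = \<beta>2 / \<alpha>2" by (rule alg[OF m1]) (use \<open>\<mu>1 \<noteq> 0\<close> in simp)
  then have "\<mu>1 ^ 3 = \<beta>2 / \<alpha>2" by (simp add: power2_eq_square power3_eq_cube mult.assoc)
  then show ?thesis using \<mu>1(1) by simp
qed

end

section \<open>Charts from local exponents and apparentness\<close>

text \<open>The function \<open>x\<^sup>j Q(z0 + x)\<close> has a removable singularity, and the coefficient \<open>polar_coeff\<close>, defined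
  by an error estimate, is the value of its extension.\<close>

lemma polar_part:
  assumes mer: "Q meromorphic_on {z0}" and ord: "is_pole Q z0 \<Longrightarrow> - zorder Q z0 \<le> int j"
    and hol: "Q holomorphic_on (ball z0 r - {z0})" and r: "r > 0" and j: "j > 0"
  obtains B where "B holomorphic_on ball 0 r" "\<And>x. x \<in> ball 0 r - {0} \<Longrightarrow> B x = x ^ j * Q (z0 + x)"
    "B 0 = polar_coeff j Q z0" "\<not> is_pole Q z0 \<Longrightarrow> B 0 = 0"
proof -
  define G where "G = (\<lambda>x. x ^ j * Q (z0 + x))"
  have hQ: "(\<lambda>x. Q (z0 + x)) holomorphic_on (ball 0 r - {0})"
    using holomorphic_on_compose_gen[of "\<lambda>x. z0 + x" "ball 0 r - {0}", OF _ hol]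
    by (force simp: o_def dist_norm intro: holomorphic_intros)
  have hG: "G holomorphic_on (ball 0 r - {0})" unfolding G_def by (intro holomorphic_intros hQ)
  have iso: "isolated_singularity_at Q z0" and ne: "not_essential Q z0"
    using mer meromorphic_at_iff by auto
  have shift: "eventually P (at z0) \<longleftrightarrow> eventually (\<lambda>x. P (z0 + x)) (at 0)" for P
    by (subst at_to_0) (simp add: eventually_filtermap add.commute)
  have shift_lim: "((\<lambda>x. Q (z0 + x)) \<longlongrightarrow> l) (at 0)" if "Q \<midarrow>z0\<rightarrow> l" for l
    using that by (subst (asm) at_to_0) (simp add: filterlim_filtermap add.commute)
  \<comment> \<open>in both cases \<open>G\<close> has a finite limit at the origin\<close>
  have limG: "\<exists>l. (G \<longlongrightarrow> l) (at 0) \<and> (\<not> is_pole Q z0 \<longrightarrow> l = 0)"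
  proof (cases "is_pole Q z0")
    case True
    have "eventually (\<lambda>w. Q w \<noteq> 0) (at z0)" using True non_zero_neighbour_pole by blast
    then have "frequently (\<lambda>w. Q w \<noteq> 0) (at z0)" by (rule eventually_frequently[OF at_neq_bot])
    then obtain d where d: "d > 0" "zor_poly Q z0 holomorphic_on cball z0 d"
       "\<forall>w\<in>cball z0 d - {z0}. Q w = zor_poly Q z0 w * (w - z0) powi zorder Q z0"
      using zorder_exist[OF iso ne] by blast
    define e where "e = nat (int j + zorder Q z0)"
    have e: "int j + zorder Q z0 = int e" using ord[OF True] by (simp add: e_def)
    have "isCont (zor_poly Q z0) z0"
      using d(1,2) holomorphic_on_imp_continuous_on continuous_on_interior by (metis centre_in_ball interior_cball)
    then have "((\<lambda>x. zor_poly Q z0 (z0 + x)) \<longlongrightarrow> zor_poly Q z0 z0) (at 0)"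
      by (simp add: isCont_iff)
    then have lim: "((\<lambda>x. x ^ e * zor_poly Q z0 (z0 + x)) \<longlongrightarrow> 0 ^ e * zor_poly Q z0 z0) (at 0)"
      by (intro tendsto_intros)
    have "(G \<longlongrightarrow> 0 ^ e * zor_poly Q z0 z0) (at 0)"
    proof (rule Lim_transform_within_open[OF lim open_ball[of 0 d]])
      show "x ^ e * zor_poly Q z0 (z0 + x) = G x" if "x \<in> ball 0 d" "x \<noteq> 0" for x
      proof -
        have "z0 + x \<in> cball z0 d - {z0}" using that by (auto simp: dist_norm)
        then have "Q (z0 + x) = zor_poly Q z0 (z0 + x) * x powi zorder Q z0" using d(3) by force
        moreover have "x ^ j * x powi zorder Q z0 = x ^ e"
          using e power_int_add[of x "int j" "zorder Q z0"] that by simp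
        ultimately show ?thesis by (simp add: G_def mult_ac)
      qed
    qed (use d in auto)
    then show ?thesis using True by blast
  next
    case False
    then obtain l where "Q \<midarrow>z0\<rightarrow> l" using ne by (auto simp: not_essential_def)
    then have "((\<lambda>x. x ^ j * Q (z0 + x)) \<longlongrightarrow> 0 ^ j * l) (at 0)"
      by (intro tendsto_intros shift_lim)
    moreover have "0 ^ j * l = 0" using j by simp
    ultimately show ?thesis using False unfolding G_def by (intro exI[of _ 0]) simp
  qed
  then obtain l where l: "(G \<longlongrightarrow> l) (at 0)" "\<not> is_pole Q z0 \<Longrightarrow> l = 0" by blast
  have "eventually (\<lambda>x. dist (G x) l < 1) (at 0)" using tendstoD[OF l(1), of 1] by simp
  then have "eventually (\<lambda>x. norm (G x) \<le> norm l + 1) (at 0)"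
  proof eventually_elim
    case (elim x)
    then show ?case using norm_triangle_ineq2[of "G x" l] by (simp add: dist_norm)
  qed
  then obtain B where B: "B holomorphic_on ball 0 r" "\<And>x. x \<in> ball 0 r - {0} \<Longrightarrow> B x = G x"
    using holomorphic_on_extend_bounded[of G "ball 0 r" 0] hG r by auto
  have contB: "isCont B 0"
    using holomorphic_on_imp_continuous_on[OF B(1)] r by (simp add: continuous_on_eq_continuous_at)
  have evr: "eventually (\<lambda>x. x \<in> ball 0 r - {0}) (at (0::complex))"
    using eventually_at_in_open[of "ball (0::complex) r" 0] r by (simp add: dist_norm)
  have "(G \<longlongrightarrow> B 0) (at 0)"
    using contB unfolding isCont_def
    by (rule Lim_transform_eventually) (use evr B(2) in \<open>auto elim: eventually_mono\<close>)
  then have Bl: "B 0 = l" using l(1) LIM_unique by blast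
  \<comment> \<open>identification of the coefficient\<close>
  have scaled: "Q (z0 + x) - A * (z0 + x - z0) powi (- int j) = (B x - A) * x powi (- int j)"
    if "x \<in> ball 0 r - {0}" for x A
  proof -
    have "B x = x ^ j * Q (z0 + x)" using B(2)[OF that] by (simp add: G_def)
    moreover have "x ^ j * x powi (- int j) = 1" using that by (simp add: power_int_minus)
    ultimately have "B x * x powi (- int j) = Q (z0 + x)" by (simp add: mult_ac)
    then show ?thesis by (simp add: left_diff_distrib)
  qed
  have big: "(\<lambda>z. Q z - A * (z - z0) powi (- int j)) \<in> O[at z0](\<lambda>z. (z - z0) powi (1 - int j)) \<longleftrightarrow>
      (\<exists>c>0. eventually (\<lambda>x. norm (B x - A) \<le> c * norm x) (at 0))" for A
  proof -
    have "eventually (\<lambda>z. norm (Q z - A * (z - z0) powi (- int j)) \<le> c * norm ((z - z0) powi (1 - int j))) (at z0)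
      \<longleftrightarrow> eventually (\<lambda>x. norm (B x - A) \<le> c * norm x) (at 0)" for c
      unfolding shift
    proof (rule eventually_cong[OF evr])
      fix x assume x: "x \<in> ball 0 r - {0::complex}"
      have p: "norm (x powi (- int j)) > 0" using x by simp
      have "norm ((z0 + x - z0) powi (1 - int j)) = norm x * norm (x powi (- int j))"
        using x power_int_add[of x 1 "- int j"] by (simp add: norm_mult)
      then have "(norm (Q (z0 + x) - A * (z0 + x - z0) powi (- int j)) \<le> c * norm ((z0 + x - z0) powi (1 - int j)))
         = (norm (B x - A) * norm (x powi (- int j)) \<le> (c * norm x) * norm (x powi (- int j)))"
        unfolding scaled[OF x] norm_mult by (simp only: mult.assoc)
      also have "\<dots> = (norm (B x - A) \<le> c * norm x)" using p by (rule mult_le_cancel_right_pos)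
      finally show "(norm (Q (z0 + x) - A * (z0 + x - z0) powi (- int j)) \<le> c * norm ((z0 + x - z0) powi (1 - int j)))
         = (norm (B x - A) \<le> c * norm x)" .
    qed
    then show ?thesis unfolding bigo_def by simp
  qed
  have "polar_coeff j Q z0 = B 0"
    unfolding polar_coeff_def big
  proof (rule the_equality)
    have "(B has_field_derivative deriv B 0) (at 0)"
      using holomorphic_derivI[OF B(1) open_ball] r by simp
    then have "((\<lambda>x. (B x - B 0) / x) \<longlongrightarrow> deriv B 0) (at 0)"
      by (simp add: has_field_derivative_iff)
    then have "eventually (\<lambda>x. dist ((B x - B 0) / x) (deriv B 0) < 1) (at 0)"
      using tendstoD[of _ "deriv B 0" "at 0" 1] by simp
    moreover have "eventually (\<lambda>x. x \<noteq> 0) (at (0::complex))" by (simp add: eventually_at_filter)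
    ultimately have "eventually (\<lambda>x. norm (B x - B 0) \<le> (norm (deriv B 0) + 1) * norm x) (at 0)"
    proof eventually_elim
      case (elim x)
      then have "norm ((B x - B 0) / x) \<le> norm (deriv B 0) + 1"
        using norm_triangle_ineq2[of "(B x - B 0) / x" "deriv B 0"] by (simp add: dist_norm)
      then show ?case using elim(2) by (simp add: norm_divide divide_le_eq)
    qed
    moreover have "norm (deriv B 0) + 1 > 0" by (simp add: add_nonneg_pos)
    ultimately show "\<exists>c>0. eventually (\<lambda>x. norm (B x - B 0) \<le> c * norm x) (at 0)" by blast
  next
    fix A assume "\<exists>c>0. eventually (\<lambda>x. norm (B x - A) \<le> c * norm x) (at 0)"
    then obtain c where c: "eventually (\<lambda>x. norm (B x - A) \<le> c * norm x) (at 0)" by blast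
    have "((\<lambda>x::complex. c * norm x) \<longlongrightarrow> c * norm (0::complex)) (at 0)" by (intro tendsto_intros)
    then have "((\<lambda>x. B x - A) \<longlongrightarrow> 0) (at 0)"
      by (intro Lim_null_comparison[OF c]) simp
    moreover have "((\<lambda>x. B x - A) \<longlongrightarrow> B 0 - A) (at 0)"
      using contB unfolding isCont_def by (intro tendsto_intros)
    ultimately show "A = B 0" using LIM_unique by fastforce
  qed
  then show ?thesis using that[of B] B Bl l(2) by (simp add: G_def)
qed

lemma poly_indicial: "poly (indicial_poly Q2 Q3 z0) \<kappa> =
    \<kappa> ^ 3 + (- 3) * \<kappa> ^ 2 + (2 + polar_coeff 2 Q2 z0) * \<kappa> + polar_coeff 3 Q3 z0"
  by (simp add: indicial_poly_def algebra_simps power2_eq_square power3_eq_cube)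

lemma poly_cusp_indicial: "poly (cusp_indicial_poly Q2 Q3) \<kappa> =
    \<kappa> ^ 3 + ((2 * of_real pi * \<i>) powi (-2) * cusp_value Q2) * \<kappa> + (2 * of_real pi * \<i>) powi (-3) * cusp_value Q3"
  by (simp add: cusp_indicial_poly_def algebra_simps)

lemma ordered_roots_roots:
  assumes "ordered_roots p k1 k2 k3"
  shows "poly p \<kappa> = 0 \<longleftrightarrow> \<kappa> \<in> {of_real k1, of_real k2, of_real k3}"
proof -
  have p: "proots p = {#of_real k1, of_real k2, of_real k3#}" using assms by (simp add: ordered_roots_def)
  then have "p \<noteq> 0" by auto
  from set_count_proots[OF this] p show ?thesis by auto
qed

lemma ordered_roots_unique:
  assumes "ordered_roots p k1 k2 k3" "ordered_roots p l1 l2 l3"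
  shows "k1 = l1 \<and> k2 = l2 \<and> k3 = l3"
proof -
  have "image_mset Re {#of_real k1, of_real k2, of_real k3#} = image_mset Re {#of_real l1, of_real l2, of_real l3 :: complex#}"
    using assms by (simp only: ordered_roots_def)
  then have "mset [k1, k2, k3] = mset [l1, l2, l3]" by simp
  moreover have "sorted [k1, k2, k3]" "sorted [l1, l2, l3]" using assms by (auto simp: ordered_roots_def)
  ultimately have "[k1, k2, k3] = [l1, l2, l3]" by (metis properties_for_sort)
  then show ?thesis by simp
qed

context log_chart
begin

text \<open>A solution on the smaller half-plane extends to the larger one.\<close>

lemma mono_shrink:
  assumes mono: "\<And>y s. log_ode H y \<Longrightarrow> s \<in> H \<Longrightarrow> y (s + 2 * of_real pi * \<i>) = \<mu> * y s"
    and e: "0 < e" "e \<le> r" and y: "log_ode (half_plane (ln e)) y" and s: "s \<in> half_plane (ln e)"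
  shows "y (s + 2 * of_real pi * \<i>) = \<mu> * y s"
proof -
  have sub: "half_plane (ln e) \<subseteq> H" using e r 
    by (auto simp: half_plane_def intro: less_le_trans)
  have sH: "s \<in> H" using s sub by blast
  obtain x where x: "log_ode H x" "x s = y s" "deriv x s = deriv y s" "(deriv ^^ 2) x s = (deriv ^^ 2) y s"
    using log_ode_exists[OF sH] by blast
  have "x t = y t" if "t \<in> half_plane (ln e)" for t
    by (rule ode3_unique[OF open_half_plane connected_half_plane _ _ _ ode3_subset[OF x(1) sub] y s x(2-4) that])
       (use coeffs_hol sub holomorphic_on_subset in blast)+
  then show ?thesis using mono[OF x(1) sH] s half_plane_add_2pi[of s "ln e"] by simp
qed

lemma shrink: "0 < e \<Longrightarrow> e \<le> r \<Longrightarrow> log_chart Q2 Q3 z0 e B2 B3"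
proof -
  assume e: "0 < e" "e \<le> r"
  then have "ball (0::complex) e \<subseteq> ball 0 r" by (simp add: subset_ball)
  then have "B2 holomorphic_on ball 0 e" "B3 holomorphic_on ball 0 e"
    using B2_hol B3_hol holomorphic_on_subset by blast+
  then show ?thesis using e B2 B3 by unfold_locales auto
qed

text \<open>Solutions are holomorphic at \<open>z0\<close> and hence single-valued. The coefficients themselves are
  controlled only on the punctured disc, as a meromorphic function may have an arbitrary value at a
  removable singularity.\<close>

lemma mono_regular:
  assumes q: "q2 holomorphic_on ball z0 r" "q3 holomorphic_on ball z0 r"
    and eq: "\<And>z. z \<in> ball z0 r - {z0} \<Longrightarrow> Q2 z = q2 z \<and> Q3 z = q3 z"
    and y: "log_ode H y" and s: "s \<in> H"
  shows "y (s + 2 * of_real pi * \<i>) = y s"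
proof -
  have x: "exp s \<noteq> 0" "exp s \<in> ball 0 r - {0}" using s in_H by auto
  define z where "z = z0 + exp s"
  have z: "z \<in> ball z0 r - {z0}" using x by (auto simp: z_def dist_norm)
  have "exp s = z - z0" by (simp add: z_def)
  then obtain U l where U: "open U" "z \<in> U" "z0 \<notin> U" and hl: "l holomorphic_on U" and lz: "l z = s"
    and el: "\<And>w. w \<in> U \<Longrightarrow> exp (l w) = w - z0"
    using local_log_at by metis
  have "sol_at Q2 Q3 (\<lambda>w. y (l w)) z"
    by (rule log_ode_imp_sol_at[OF y open_half_plane subset_refl hl U(1,2)]) (use lz s el in simp_all)
  then obtain V where V: "open V" "z \<in> V" "ode3 (\<lambda>_. 0) Q2 Q3 V (\<lambda>w. y (l w))"
    by (auto simp: sol_at_def)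
  define Y where "Y = (\<lambda>w. y (l w))"
  obtain Z where Z: "ode3 (\<lambda>_. 0) q2 q3 (ball z0 r) Z" "Z z = Y z" "deriv Z z = deriv Y z"
      "(deriv ^^ 2) Z z = (deriv ^^ 2) Y z"
    using ode3_solution_exists[OF open_ball convex_ball _ holomorphic_on_const q, of z 0] z by blast
  have oP: "open (ball z0 r - {z0})" by auto
  have ZQ: "ode3 (\<lambda>_. 0) Q2 Q3 (ball z0 r - {z0}) Z"
    by (rule ode3_cong[OF oP refl _ _ refl ode3_subset[OF Z(1)]]) (use eq in auto)
  obtain d where d: "d > 0" "ball z d \<subseteq> V \<inter> (ball z0 r - {z0}) \<inter> U"
    using openE[OF open_Int[OF open_Int[OF V(1) oP] U(1)], of z] V(2) z U(2) by blast
  have sub: "ball z d \<subseteq> V" "ball z d \<subseteq> ball z0 r - {z0}" "ball z d \<subseteq> ball z0 r" using d by auto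
  have YZ: "Y w = Z w" if "w \<in> ball z d" for w
  proof (rule ode3_unique[OF open_ball connected_ball _ _ _ _ _ _ Z(2-4)[symmetric] that])
    show "ode3 (\<lambda>_. 0) q2 q3 (ball z d) Y"
      unfolding Y_def
      by (rule ode3_cong[OF open_ball refl _ _ refl ode3_subset[OF V(3) sub(1)]]) (use eq subsetD[OF sub(2)] in blast)+
    show "ode3 (\<lambda>_. 0) q2 q3 (ball z d) Z" by (rule ode3_subset[OF Z(1) sub(3)])
  qed (use q sub(3) d(1) holomorphic_on_subset in auto)
  have logZ: "log_ode H (\<lambda>t. Z (z0 + exp t))"
  proof (rule ode3_pointwise[OF open_half_plane])
    fix t assume t: "t \<in> H"
    then have "z0 + exp t \<in> ball z0 r - {z0}" using in_H by (auto simp: dist_norm)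
    then have "sol_at Q2 Q3 Z (z0 + exp t)" unfolding sol_at_def using ZQ oP by blast
    from sol_at_imp_log_ode[OF this t] show "\<exists>U. open U \<and> t \<in> U \<and> log_ode U (\<lambda>t. Z (z0 + exp t))" by blast
  qed
  have hol: "y holomorphic_on H" "(\<lambda>t. Z (z0 + exp t)) holomorphic_on H"
    using y logZ by (auto simp: ode3_def)
  have "eventually (\<lambda>t. y t = Z (z0 + exp t)) (nhds s)"
  proof -
    have "isCont l (z0 + exp s)"
      using holomorphic_on_imp_continuous_on[OF hl] U z_def continuous_on_eq_continuous_at by blast
    then have "isCont (\<lambda>t. l (z0 + exp t) - t) s"
      by (intro continuous_intros isCont_o2[where f = "\<lambda>t. z0 + exp t" and g = l])
    then have lim: "((\<lambda>t. l (z0 + exp t) - t) \<longlongrightarrow> 0) (nhds s)"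
      using lz[unfolded z_def] tendsto_at_iff_tendsto_nhds[of "\<lambda>t. l (z0 + exp t) - t" s] by (simp add: isCont_def)
    have e1: "eventually (\<lambda>t. norm (l (z0 + exp t) - t) < 1) (nhds s)"
      using tendstoD[OF lim, of 1] by (simp add: dist_norm)
    have "open ((\<lambda>t. z0 + exp t) -` ball z d)" by (rule open_vimage[OF open_ball]) (intro continuous_intros)
    then have "eventually (\<lambda>t. t \<in> (\<lambda>t. z0 + exp t) -` ball z d) (nhds s)"
      by (rule eventually_nhds_in_open) (use d(1) in \<open>simp add: z_def\<close>)
    with e1 show ?thesis
    proof eventually_elim
      case (elim t)
      then have tz: "z0 + exp t \<in> ball z d" by simp
      then have "exp (l (z0 + exp t)) = exp t" using d(2) el[of "z0 + exp t"] by force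
      then have "l (z0 + exp t) = t"
      proof (rule exp_complex_eqI[rotated])
        show "\<bar>Im (l (z0 + exp t)) - Im t\<bar> < 2 * pi"
          using abs_Im_le_cmod[of "l (z0 + exp t) - t"] elim(1) pi_gt3 by simp
      qed
      then show ?case using YZ[OF tz] by (simp add: Y_def)
    qed
  qed
  then obtain T where T: "open T" "s \<in> T" "\<And>t. t \<in> T \<Longrightarrow> y t = Z (z0 + exp t)"
    unfolding eventually_nhds by blast
  have yZ: "y t = Z (z0 + exp t)" if "t \<in> H" for t
    by (rule analytic_continuation_open[of "T \<inter> H" H y "\<lambda>t. Z (z0 + exp t)" t])
       (use T s hol that open_half_plane connected_half_plane in auto)
  show ?thesis using yZ[OF s] yZ[OF half_plane_add_2pi[THEN iffD2, OF s]] by (simp add: exp_add_2pi)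
qed

text \<open>Pulling a solution on the half-plane back to the slit disc by the principal logarithm,
  absence of logarithmic singularities makes every solution a finite sum of eigenfunctions of the
  local monodromy, hence an eigenfunction with the common multiplier of the exponents.\<close>

lemma mono_apparent:
  assumes nolog: "\<not> (\<exists>y. solution_on Q2 Q3 (slit_disc z0 r) y \<and> logarithmic_singularity z0 r y)"
    and roots: "\<And>\<kappa>. \<kappa> ^ 3 + (- 3) * \<kappa> ^ 2 + (2 + B2 0) * \<kappa> + B3 0 = 0 \<Longrightarrow> exp (2 * of_real pi * \<i> * \<kappa>) = \<mu>"
    and y: "log_ode H y" and s: "s \<in> H"
  shows "y (s + 2 * of_real pi * \<i>) = \<mu> * y s"
proof -
  define D where "D = slit_disc z0 r"
  have Dx: "w - z0 \<in> ball 0 r - {0}" "w - z0 \<notin> \<real>\<^sub>\<le>\<^sub>0" if "w \<in> D" for w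
    using that by (auto simp: D_def slit_disc_def dist_norm norm_minus_commute)
  have "open D"
  proof -
    have "D = ball z0 r \<inter> (\<lambda>w. w - z0) -` (- \<real>\<^sub>\<le>\<^sub>0)" by (auto simp: D_def slit_disc_def)
    moreover have "open ((\<lambda>w. w - z0) -` (- \<real>\<^sub>\<le>\<^sub>0))"
      by (rule open_vimage) (auto intro!: continuous_intros closed_nonpos_Reals_complex simp: open_Compl)
    ultimately show ?thesis by auto
  qed
  have hl: "(\<lambda>w. Ln (w - z0)) holomorphic_on D"
    using Dx(2) by (intro holomorphic_intros) auto
  have lH: "Ln (w - z0) \<in> H" if "w \<in> D" for w
    unfolding in_H using Dx[OF that] by auto
  have "ode3 (\<lambda>_. 0) Q2 Q3 D (\<lambda>w. y (Ln (w - z0)))"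
  proof (rule ode3_pointwise[OF \<open>open D\<close>])
    fix w assume w: "w \<in> D"
    have "sol_at Q2 Q3 (\<lambda>w. y (Ln (w - z0))) w"
      by (rule log_ode_imp_sol_at[OF y open_half_plane subset_refl hl \<open>open D\<close> w lH[OF w]]) (use Dx in auto)
    then show "\<exists>U. open U \<and> w \<in> U \<and> ode3 (\<lambda>_. 0) Q2 Q3 U (\<lambda>w. y (Ln (w - z0)))" by (simp add: sol_at_def)
  qed
  then have "solution_on Q2 Q3 D (\<lambda>w. y (Ln (w - z0)))"
    by (simp add: solution_on_def ode3_def)
  then have "\<not> logarithmic_singularity z0 r (\<lambda>w. y (Ln (w - z0)))" using nolog by (auto simp: D_def)
  then obtain E h where E: "finite E" "\<And>\<alpha>. \<alpha> \<in> E \<Longrightarrow> h \<alpha> holomorphic_on ball z0 r"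
      "\<And>w. w \<in> D \<Longrightarrow> y (Ln (w - z0)) = (\<Sum>\<alpha>\<in>E. (w - z0) powr \<alpha> * h \<alpha> w)"
    by (auto simp: logarithmic_singularity_def D_def)
  define f where "f = (\<lambda>\<alpha> x. h \<alpha> (z0 + x))"
  define W where "W = H \<inter> {t. \<bar>Im t\<bar> < pi}"
  have "open W" unfolding W_def abs_less_iff
    by (intro open_Int open_half_plane) (auto simp: Collect_conj_eq minus_less_iff
        intro!: open_Int open_halfspace_Im_lt open_halfspace_Im_gt)
  have strip: "y t = (\<Sum>\<alpha>\<in>E. exp (\<alpha> * t) * f \<alpha> (exp t))" if t: "t \<in> W" for t
  proof -
    have L: "Ln (exp t) = t" using t by (intro Ln_exp) (auto simp: W_def abs_less_iff)
    have "exp t \<notin> \<real>\<^sub>\<le>\<^sub>0"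
    proof
      assume "exp t \<in> \<real>\<^sub>\<le>\<^sub>0"
      then have "Re (exp t) \<le> 0" "Im (exp t) = 0" by (auto simp: complex_nonpos_Reals_iff)
      then have "Im (Ln (exp t)) = pi" using Im_Ln_eq_pi[of "exp t"]
        by (metis Re_exp complex_eq_iff exp_not_eq_zero less_eq_real_def zero_complex.sel)
      then show False using t unfolding L by (simp add: W_def)
    qed
    moreover have "exp t \<in> ball 0 r - {0}" using t in_H by (auto simp: W_def)
    ultimately have "z0 + exp t \<in> D" by (auto simp: D_def slit_disc_def dist_norm)
    from E(3)[OF this] show ?thesis using L by (simp add: f_def powr_def)
  qed
  define c0 where "c0 = complex_of_real (ln r - 1)"
  have "c0 \<in> W" by (simp add: W_def c0_def half_plane_def)
  have ysum: "y t = (\<Sum>\<alpha>\<in>E. exp (\<alpha> * t) * f \<alpha> (exp t))" if t: "t \<in> H" for t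
  proof (rule analytic_continuation_open[of W H y "\<lambda>t. \<Sum>\<alpha>\<in>E. exp (\<alpha> * t) * f \<alpha> (exp t)" t])
    have e: "(\<lambda>t. z0 + exp t) holomorphic_on H" "(\<lambda>t. z0 + exp t) ` H \<subseteq> ball z0 r"
      using in_H by (auto intro!: holomorphic_intros simp: dist_norm)
    have "(\<lambda>t. f \<alpha> (exp t)) holomorphic_on H" if "\<alpha> \<in> E" for \<alpha>
      using holomorphic_on_compose_gen[OF e(1) E(2)[OF that] e(2)] by (simp add: o_def f_def)
    then show "(\<lambda>t. \<Sum>\<alpha>\<in>E. exp (\<alpha> * t) * f \<alpha> (exp t)) holomorphic_on H"
      by (intro holomorphic_on_sum holomorphic_on_mult) (auto intro!: holomorphic_intros)
    show "y holomorphic_on H" using y by (simp add: ode3_def)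
    show "W \<noteq> {}" using \<open>c0 \<in> W\<close> by blast
  qed (use \<open>open W\<close> strip open_half_plane connected_half_plane t in \<open>auto simp: W_def\<close>)
  have el: "exp (ln r) = r" using r by simp
  show ?thesis
    by (rule multiplier_from_power_sum[of "\<lambda>_. - 3" "ln r" "\<lambda>x. 2 + B2 x" B3 y E f \<mu> s])
       (use y ysum E(1) s roots B2_hol B3_hol in \<open>auto simp: euler_ode_def el intro!: holomorphic_intros\<close>)
qed

end

text \<open>At a pole, \<open>H2\<close> supplies the exponents and the absence of logarithms. At any other point the
  exponents are \<open>0\<close>, \<open>1\<close>, \<open>2\<close>, and \<open>k = 0\<close>.\<close>

lemma chart_exists:
  assumes mer: "Q2 meromorphic_on upper_half_plane" "Q3 meromorphic_on upper_half_plane"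
    and H1: "H1 Q2 Q3" and H2: "H2 Q2 Q3" and z0: "z0 \<in> upper_half_plane"
  obtains r0 where "r0 > 0" "\<And>e. 0 < e \<Longrightarrow> e \<le> r0 \<Longrightarrow> \<exists>B2 B3 k m2 m3 n. scalar_point Q2 Q3 z0 e B2 B3 k m2 m3 n \<and>
      local_exponents Q2 Q3 z0 k (k + real m2) (k + real m3)"
proof -
  have m0: "Q2 meromorphic_on {z0}" "Q3 meromorphic_on {z0}"
    using mer z0 meromorphic_on_subset by blast+
  have ord: "is_pole Q2 z0 \<Longrightarrow> - zorder Q2 z0 \<le> int 2" "is_pole Q3 z0 \<Longrightarrow> - zorder Q3 z0 \<le> int 3"
    using H1 z0 by (auto simp: H1_def pole_order_le_def)
  show ?thesis
  proof (cases "singular_point Q2 Q3 z0")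
    case True
    then obtain k1 k2 k3 where k: "local_exponents Q2 Q3 z0 k1 k2 k3" "k1 < k2" "k2 < k3" "third_nonpos_int k1"
        "k2 - k1 \<in> \<int>" "k3 - k1 \<in> \<int>" and app: "apparent Q2 Q3 z0"
      using H2 z0 unfolding H2_def by blast
    obtain r where r: "r > 0" "Q2 holomorphic_on (ball z0 r - {z0})" "Q3 holomorphic_on (ball z0 r - {z0})"
        "\<not> (\<exists>y. solution_on Q2 Q3 (slit_disc z0 r) y \<and> logarithmic_singularity z0 r y)"
      using app unfolding apparent_def by blast
    obtain B2 where B2: "B2 holomorphic_on ball 0 r" "\<And>x. x \<in> ball 0 r - {0} \<Longrightarrow> B2 x = x ^ 2 * Q2 (z0 + x)"
        "B2 0 = polar_coeff 2 Q2 z0"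
      using polar_part[OF m0(1) ord(1) r(2,1)] by (metis zero_less_numeral)
    obtain B3 where B3: "B3 holomorphic_on ball 0 r" "\<And>x. x \<in> ball 0 r - {0} \<Longrightarrow> B3 x = x ^ 3 * Q3 (z0 + x)"
        "B3 0 = polar_coeff 3 Q3 z0"
      using polar_part[OF m0(2) ord(2) r(3,1)] by (metis zero_less_numeral)
    note pc = B2(3)[symmetric] B3(3)[symmetric] and nolog = r(4)
    interpret log_chart Q2 Q3 z0 r B2 B3 using r(1) B2 B3 by unfold_locales auto
    obtain a2 a3 :: int where a: "k2 - k1 = of_int a2" "k3 - k1 = of_int a3" using k(5,6) by (auto elim!: Ints_cases)
    define m2 where "m2 = nat a2"
    define m3 where "m3 = nat a3"
    have "0 < a2" "a2 < a3" using a k(2,3) by linarith+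
    then have m: "real m2 = k2 - k1" "real m3 = k3 - k1" "0 < m2" "m2 < m3"
      using a by (auto simp: m2_def m3_def)
    have kk: "k2 = k1 + real m2" "k3 = k1 + real m3" using m by auto
    obtain n where n: "3 * k1 = of_int n" using k(4) unfolding third_nonpos_int_def
      by (metis nonzero_mult_div_cancel_left times_divide_eq_right zero_neq_numeral)
    have roots: "\<exists>m\<in>{0, m2, m3}. \<kappa> = of_real k1 + of_nat m"
      if "\<kappa> ^ 3 + (- 3) * \<kappa> ^ 2 + (2 + B2 0) * \<kappa> + B3 0 = 0" for \<kappa>
    proof -
      have "poly (indicial_poly Q2 Q3 z0) \<kappa> = 0" using that unfolding poly_indicial pc .
      then have "\<kappa> \<in> {of_real k1, of_real k2, of_real k3}"
        using ordered_roots_roots k(1) unfolding local_exponents_def by blast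
      then show ?thesis by (auto simp: kk)
    qed
    have mult: "exp (2 * of_real pi * \<i> * \<kappa>) = exp (2 * of_real pi * \<i> * of_real k1)"
      if r: "\<kappa> ^ 3 + (- 3) * \<kappa> ^ 2 + (2 + B2 0) * \<kappa> + B3 0 = 0" for \<kappa>
    proof -
      obtain m where "\<kappa> = of_real k1 + of_nat m" using roots[OF r] by blast
      then have "exp (2 * of_real pi * \<i> * \<kappa>) = exp (2 * of_real pi * \<i> * of_real k1) * exp ((2 * of_int (int m) * of_real pi) * \<i>)"
        by (simp add: distrib_left exp_add mult_ac)
      then show ?thesis using exp_integer_2pi[of "of_int (int m)"] by simp
    qed
    show ?thesis
    proof (rule that[OF r(1)])
      fix e assume e: "0 < e" "e \<le> r"
      have "scalar_point Q2 Q3 z0 e B2 B3 k1 m2 m3 n"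
        unfolding scalar_point_def scalar_point_axioms_def
        using shrink[OF e] m n roots mono_shrink[OF mono_apparent[OF nolog mult] e] by blast
      then show "\<exists>B2 B3 k m2 m3 n. scalar_point Q2 Q3 z0 e B2 B3 k m2 m3 n \<and>
          local_exponents Q2 Q3 z0 k (k + real m2) (k + real m3)"
        using k(1) unfolding kk by blast
    qed
  next
    case False
    then have np: "\<not> is_pole Q2 z0" "\<not> is_pole Q3 z0" by (auto simp: singular_point_def)
    have ext: "\<exists>d q. d > 0 \<and> q holomorphic_on ball z0 d \<and> (\<forall>z\<in>ball z0 d - {z0}. Q z = q z)"
      if Q: "Q meromorphic_on {z0}" "\<not> is_pole Q z0" for Q
    proof -
      obtain d1 where d1: "d1 > 0" "Q analytic_on ball z0 d1 - {z0}"
        using meromorphic_on_isolated_singularity[OF Q(1)] unfolding isolated_singularity_at_def by blast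
      obtain l where "Q \<midarrow>z0\<rightarrow> l" using meromorphic_on_not_essential[OF Q(1)] Q(2)
        by (auto simp: not_essential_def)
      then have "eventually (\<lambda>z. dist (Q z) l < 1) (at z0)" using tendstoD[of Q l "at z0" 1] by simp
      then have "eventually (\<lambda>z. norm (Q z) \<le> norm l + 1) (at z0)"
      proof eventually_elim
        case (elim z)
        then show ?case using norm_triangle_ineq2[of "Q z" l] by (simp add: dist_norm)
      qed
      moreover have "Q holomorphic_on ball z0 d1 - {z0}" using d1(2) by (rule analytic_imp_holomorphic)
      ultimately obtain q where "q holomorphic_on ball z0 d1" "\<forall>z\<in>ball z0 d1 - {z0}. q z = Q z"
        using holomorphic_on_extend_bounded[of Q "ball z0 d1" z0] d1(1) by auto
      then show ?thesis using d1(1) by metis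
    qed
    obtain d2 q2 where q2: "d2 > 0" "q2 holomorphic_on ball z0 d2" "\<forall>z\<in>ball z0 d2 - {z0}. Q2 z = q2 z"
      using ext[OF m0(1) np(1)] by blast
    obtain d3 q3 where q3: "d3 > 0" "q3 holomorphic_on ball z0 d3" "\<forall>z\<in>ball z0 d3 - {z0}. Q3 z = q3 z"
      using ext[OF m0(2) np(2)] by blast
    define r where "r = min d2 d3"
    have r: "r > 0" "ball z0 r \<subseteq> ball z0 d2" "ball z0 r \<subseteq> ball z0 d3" using q2 q3 by (auto simp: r_def)
    have q: "q2 holomorphic_on ball z0 r" "q3 holomorphic_on ball z0 r"
      using q2(2) q3(2) r holomorphic_on_subset by blast+
    have eq: "Q2 z = q2 z \<and> Q3 z = q3 z" if "z \<in> ball z0 r - {z0}" for z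
      using q2(3) q3(3) r that by blast
    have hol: "Q2 holomorphic_on (ball z0 r - {z0})" "Q3 holomorphic_on (ball z0 r - {z0})"
    proof -
      have "q2 holomorphic_on (ball z0 r - {z0})" "q3 holomorphic_on (ball z0 r - {z0})"
        using q holomorphic_on_subset by blast+
      then show "Q2 holomorphic_on (ball z0 r - {z0})" "Q3 holomorphic_on (ball z0 r - {z0})"
        using eq holomorphic_transform by metis+
    qed
    obtain B2 where B2: "B2 holomorphic_on ball 0 r" "\<And>x. x \<in> ball 0 r - {0} \<Longrightarrow> B2 x = x ^ 2 * Q2 (z0 + x)"
        "B2 0 = polar_coeff 2 Q2 z0" "B2 0 = 0"
      using polar_part[OF m0(1) ord(1) hol(1) r(1)] np(1) by (metis zero_less_numeral)
    obtain B3 where B3: "B3 holomorphic_on ball 0 r" "\<And>x. x \<in> ball 0 r - {0} \<Longrightarrow> B3 x = x ^ 3 * Q3 (z0 + x)"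
        "B3 0 = polar_coeff 3 Q3 z0" "B3 0 = 0"
      using polar_part[OF m0(2) ord(2) hol(2) r(1)] np(2) by (metis zero_less_numeral)
    note pc = B2(3,4) B3(3,4)
    interpret log_chart Q2 Q3 z0 r B2 B3 using r(1) B2 B3 by unfold_locales auto
    have roots: "\<exists>m\<in>{0, 1, 2::nat}. \<kappa> = of_real 0 + of_nat m"
      if "\<kappa> ^ 3 + (- 3) * \<kappa> ^ 2 + (2 + B2 0) * \<kappa> + B3 0 = 0" for \<kappa>
    proof -
      have "\<kappa> * (\<kappa> - 1) * (\<kappa> - 2) = 0" using that pc
        by (simp add: algebra_simps power2_eq_square power3_eq_cube)
      then show ?thesis by auto
    qed
    have "proots (indicial_poly Q2 Q3 z0) = {#0, 1, 2#}"
    proof -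
      have e: "indicial_poly Q2 Q3 z0 = [:-0, 1:] * [:-1, 1:] * [:-2, 1:]"
        using pc by (simp add: indicial_poly_def)
      show ?thesis unfolding e by (subst proots_mult | simp)+
    qed
    then have le: "local_exponents Q2 Q3 z0 0 (0 + real 1) (0 + real 2)"
      by (simp add: local_exponents_def ordered_roots_def)
    show ?thesis
    proof (rule that[OF r(1)])
      fix e assume e: "0 < e" "e \<le> r"
      have "y (s + 2 * of_real pi * \<i>) = 1 * y s" if "log_ode H y" "s \<in> H" for y s
        using mono_regular[OF q eq that] by simp
      note m1 = mono_shrink[OF this e]
      have "scalar_point Q2 Q3 z0 e B2 B3 0 1 2 0"
        unfolding scalar_point_def scalar_point_axioms_def
        using shrink[OF e] roots m1 by simp
      then show "\<exists>B2 B3 k m2 m3 n. scalar_point Q2 Q3 z0 e B2 B3 k m2 m3 n \<and>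
          local_exponents Q2 Q3 z0 k (k + real m2) (k + real m3)"
        using le by blast
    qed
  qed
qed

section \<open>Sections with prescribed multipliers\<close>

lemma lead_nonzero:
  assumes "lead m c h" "c \<noteq> 0"
  shows "eventually (\<lambda>x. h x \<noteq> 0) (at 0)"
proof -
  obtain g where g: "g analytic_on {0}" "g 0 = c" "eventually (\<lambda>x. h x = x ^ m * g x) (nhds 0)"
    using assms unfolding lead_def by blast
  have "isCont g 0" using g(1) analytic_at_imp_isCont by blast
  then have "(g \<longlongrightarrow> c) (at 0)" using g(2) by (simp add: isCont_def)
  then have "eventually (\<lambda>x. g x \<noteq> 0) (at 0)" using assms(2) by (rule tendsto_imp_eventually_ne)
  moreover have "eventually (\<lambda>x. x \<noteq> 0 \<longrightarrow> h x = x ^ m * g x) (at 0)"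
    using g(3) unfolding eventually_at_filter by eventually_elim simp
  moreover have "eventually (\<lambda>x. x \<noteq> 0) (at (0::complex))" by (simp add: eventually_at_filter)
  ultimately show ?thesis by eventually_elim simp
qed

context scalar_equation
begin

text \<open>The section is the continuation of the pair of eigenvectors belonging to the exponents \<open>k\<close> and
  \<open>k + m\<close>.\<close>

lemma section_from_eigen_germs:
  assumes ep: "elliptic_point Q2 Q3 z0 r B2 B3 k m2 m3 n t N"
    and b: "ball z0 r \<subseteq> Hp" "ball z0 r \<inter> X \<subseteq> {z0}" and z0: "z0 \<in> X"
    and \<zeta>: "\<zeta> = 1 / (z0 + t) ^ 2" "\<zeta> ^ N = 1" and m: "m \<in> {0, m2, m3}"
  obtains F C z1 where "sec Hp F" "z1 \<in> Hp - X" "fst (F z1) \<noteq> 0" "snd (F z1) \<noteq> 0" "C \<noteq> 0"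
    "eventually (\<lambda>z. (z + t) ^ 6 * fst (F (- 1 / (z + t))) = C * fst (F z)) (at z0)"
    "eventually (\<lambda>z. (z + t) ^ 6 * snd (F (- 1 / (z + t))) = C * \<zeta> ^ m * snd (F z)) (at z0)"
proof -
  interpret E: elliptic_point Q2 Q3 z0 r B2 B3 k m2 m3 n t N by fact
  have sp: "scalar_point Q2 Q3 z0 r B2 B3 k m2 m3 n" by (rule E.scalar_point_axioms)
  have z: "E.\<zeta> = \<zeta>" by (simp add: E.\<zeta>_def E.j0_def \<zeta>(1))
  obtain h1 c1 where h1: "E.germ_sol h1" "c1 \<noteq> 0" "lead 0 c1 h1"
     "eventually (\<lambda>x. E.U h1 x = E.\<zeta> ^ 0 * h1 x) (nhds 0)"
    using E.eigen_germ[of 0] \<zeta>(2) z by auto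
  obtain h2 c2 where h2: "E.germ_sol h2" "c2 \<noteq> 0" "lead m c2 h2"
     "eventually (\<lambda>x. E.U h2 x = E.\<zeta> ^ m * h2 x) (nhds 0)"
    using E.eigen_germ[OF m] \<zeta>(2) z by auto
  obtain e1 where e1: "0 < e1" "e1 \<le> r" "E.log_ode (half_plane (ln e1)) (\<lambda>s. exp (E.K * s) * h1 (exp s))"
    using h1(1) unfolding E.germ_sol_def by blast
  obtain e2 where e2: "0 < e2" "e2 \<le> r" "E.log_ode (half_plane (ln e2)) (\<lambda>s. exp (E.K * s) * h2 (exp s))"
    using h2(1) unfolding E.germ_sol_def by blast
  define e where "e = min e1 e2"
  have e: "0 < e" "e \<le> r" "e \<le> e1" "e \<le> e2" using e1 e2 by (auto simp: e_def)
  have o: "E.log_ode (half_plane (ln e)) (\<lambda>s. exp (E.K * s) * h1 (exp s))"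
     "E.log_ode (half_plane (ln e)) (\<lambda>s. exp (E.K * s) * h2 (exp s))"
    using ode3_subset[OF e1(3) E.half_plane_mono[OF e(3,1)]] ode3_subset[OF e2(3) E.half_plane_mono[OF e(4,1)]] by auto
  have F0: "sec (ball z0 e) (germ_section z0 n h1 h2)"
    by (rule sec_germ_section[OF sp b z0 e(1,2) o])
  have z0H: "z0 \<in> Hp" using z0 X by blast
  obtain F where F: "sec Hp F" "\<And>z. z \<in> ball z0 e \<Longrightarrow> F z = germ_section z0 n h1 h2 z"
    using global_section[OF z0H e(1) F0] by blast
  have evb: "eventually (\<lambda>z. z \<in> ball z0 e - {z0}) (at z0)"
    using eventually_at_in_open[of "ball z0 e" z0] e(1) by simp
  have f1: "eventually (\<lambda>z. fst (F z) = (z - z0) powi n * (h1 (z - z0) ^ 2 * h1 (z - z0))) (at z0)"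
    using evb by eventually_elim (simp add: F(2) germ_section_def)
  have f2: "eventually (\<lambda>z. snd (F z) = (z - z0) powi n * (h1 (z - z0) ^ 2 * h2 (z - z0))) (at z0)"
    using evb by eventually_elim (simp add: F(2) germ_section_def)
  have l1: "eventually (\<lambda>z. (z + t) ^ 6 * fst (F (- 1 / (z + t))) = E.j0 powi (6 - 2 * n) * ((E.\<zeta> ^ 0) ^ 2 * E.\<zeta> ^ 0) * fst (F z)) (at z0)"
    by (rule E.cube_transformation[OF h1(4) h1(4) f1])
  have l2: "eventually (\<lambda>z. (z + t) ^ 6 * snd (F (- 1 / (z + t))) = E.j0 powi (6 - 2 * n) * ((E.\<zeta> ^ 0) ^ 2 * E.\<zeta> ^ m) * snd (F z)) (at z0)"
    by (rule E.cube_transformation[OF h1(4) h2(4) f2])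
  have shift: "eventually (\<lambda>z. Q (z - z0)) (at z0)" if "eventually Q (at 0)" for Q :: "complex \<Rightarrow> bool"
    using that by (subst at_to_0) (simp add: eventually_filtermap)
  have "eventually (\<lambda>z. z \<notin> X) (at z0)"
    using eventually_cosparse_imp_eventually_at[OF eventually_not_in_cosparse[OF X(2)] z0H] .
  then have ev: "eventually (\<lambda>z. z \<in> Hp - X \<and> fst (F z) \<noteq> 0 \<and> snd (F z) \<noteq> 0) (at z0)"
    using evb f1 f2 shift[OF lead_nonzero[OF h1(3,2)]] shift[OF lead_nonzero[OF h2(3,2)]]
  proof eventually_elim
    case (elim z)
    have "z \<in> Hp" using elim(2) F0 by (auto simp: sec_def)
    then show ?case using elim by simp
  qed
  obtain z1 where z1: "z1 \<in> Hp - X" "fst (F z1) \<noteq> 0" "snd (F z1) \<noteq> 0"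
    using eventually_happens[OF ev] at_neq_bot[of z0] by blast
  show ?thesis
    by (rule that[OF F(1) z1, of "E.j0 powi (6 - 2 * n)"]) (use l1 l2 z E.j0 in simp_all)
qed

text \<open>Every section is given by germs near \<open>z0\<close>. As \<open>U\<close> is the identity on germs, only the common
  automorphy constant remains.\<close>

lemma multipliers_at_scalar_point:
  assumes ep: "elliptic_point Q2 Q3 z0 r B2 B3 k m2 m3 n t N"
    and b: "ball z0 r \<subseteq> Hp" "ball z0 r \<inter> X \<subseteq> {z0}" and z0: "z0 \<in> X"
    and \<zeta>: "\<zeta> = 1 / (z0 + t) ^ 2" "\<zeta> ^ m2 = 1" "\<zeta> ^ m3 = 1" and F: "sec Hp F"
  obtains C where "C \<noteq> 0"
    "eventually (\<lambda>z. (z + t) ^ 6 * fst (F (- 1 / (z + t))) = C * fst (F z)) (at z0)"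
    "eventually (\<lambda>z. (z + t) ^ 6 * snd (F (- 1 / (z + t))) = C * snd (F z)) (at z0)"
proof -
  interpret E: elliptic_point Q2 Q3 z0 r B2 B3 k m2 m3 n t N by fact
  have sp: "scalar_point Q2 Q3 z0 r B2 B3 k m2 m3 n" by (rule E.scalar_point_axioms)
  have z: "E.\<zeta> = \<zeta>" by (simp add: E.\<zeta>_def E.j0_def \<zeta>(1))
  have Fb: "sec (ball z0 r) F" by (rule sec_subset[OF F b(1)]) simp
  have ne: "ball z0 r \<noteq> {}" using E.r by simp
  obtain h1 h2 where h: "E.germ_sol h1" "E.germ_sol h2" "\<And>z. z \<in> ball z0 r \<Longrightarrow> F z = germ_section z0 n h1 h2 z"
    using section_is_germ_section[OF sp b z0 subset_refl connected_ball ne Fb] by blast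
  have u: "eventually (\<lambda>x. E.U h1 x = 1 * h1 x) (nhds 0)" "eventually (\<lambda>x. E.U h2 x = 1 * h2 x) (nhds 0)"
    using E.U_scalar[OF _ _ h(1)] E.U_scalar[OF _ _ h(2)] \<zeta>(2,3) z by simp_all
  have evb: "eventually (\<lambda>z. z \<in> ball z0 r - {z0}) (at z0)"
    using eventually_at_in_open[of "ball z0 r" z0] E.r by simp
  have f1: "eventually (\<lambda>z. fst (F z) = (z - z0) powi n * (h1 (z - z0) ^ 2 * h1 (z - z0))) (at z0)"
    using evb by eventually_elim (simp add: h(3) germ_section_def)
  have f2: "eventually (\<lambda>z. snd (F z) = (z - z0) powi n * (h1 (z - z0) ^ 2 * h2 (z - z0))) (at z0)"
    using evb by eventually_elim (simp add: h(3) germ_section_def)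
  show ?thesis
    by (rule that[of "E.j0 powi (6 - 2 * n)"])
       (use E.cube_transformation[OF u(1) u(1) f1] E.cube_transformation[OF u(1) u(2) f2] E.j0 in simp_all)
qed

end

text \<open>Two expansions of \<open>f\<close> agree at points tending to the cusp, hence have the same value at \<open>q = 0\<close>.\<close>

lemma cusp_value_eq:
  assumes F: "F analytic_on {0}" "q_function f F"
  shows "cusp_value f = F 0"
  unfolding cusp_value_def
proof (rule the_equality)
  fix v assume "\<exists>G. G analytic_on {0} \<and> q_function f G \<and> G 0 = v"
  then obtain G where G: "G analytic_on {0}" "q_function f G" "G 0 = v" by blast
  show "v = F 0"
  proof (rule ccontr)
    assume ne: "v \<noteq> F 0"
    have "isCont (\<lambda>x. G x - F x) 0"
      using F(1) G(1) analytic_at_imp_isCont by (intro continuous_intros) auto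
    then have "((\<lambda>x. G x - F x) \<longlongrightarrow> G 0 - F 0) (nhds 0)"
      unfolding isCont_def by (rule iffD1[OF tendsto_at_iff_tendsto_nhds])
    moreover have "G 0 - F 0 \<noteq> 0" using ne G(3) by simp
    ultimately have "eventually (\<lambda>x. G x - F x \<noteq> 0) (nhds 0)"
      by (rule tendsto_imp_eventually_ne)
    then obtain d where d: "d > 0" "\<And>x. norm x < d \<Longrightarrow> G x \<noteq> F x"
      unfolding eventually_nhds_metric by (auto simp: dist_norm)
    obtain Y1 where Y1: "\<forall>\<^sub>\<approx>z\<in>{z. Im z > Y1}. f z = F (exp (2 * of_real pi * \<i> * z))"
      using F(2) by (auto simp: q_function_def)
    obtain Y2 where Y2: "\<forall>\<^sub>\<approx>z\<in>{z. Im z > Y2}. f z = G (exp (2 * of_real pi * \<i> * z))"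
      using G(2) by (auto simp: q_function_def)
    define M where "M = max (max Y1 Y2) (- ln d / (2 * pi))"
    define L where "L = {z::complex. Im z > M}"
    have sub: "L \<subseteq> {z. Im z > Y1}" "L \<subseteq> {z. Im z > Y2}" by (auto simp: L_def M_def)
    have "eventually (\<lambda>z. f z = F (exp (2 * of_real pi * \<i> * z))) (cosparse L)"
      "eventually (\<lambda>z. f z = G (exp (2 * of_real pi * \<i> * z))) (cosparse L)"
      using Y1 Y2 sub sparse_in_subset unfolding eventually_cosparse by blast+
    moreover have "eventually (\<lambda>z. z \<in> L) (cosparse L)"
      by (rule eventually_in_cosparse) (auto simp: L_def open_halfspace_Im_gt)
    ultimately have ev: "eventually (\<lambda>z. z \<in> L \<and> F (exp (2 * of_real pi * \<i> * z)) = G (exp (2 * of_real pi * \<i> * z))) (cosparse L)"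
      by eventually_elim simp
    have nb: "cosparse L \<noteq> bot"
    proof -
      have "Complex 0 (M + 1) \<in> L" by (simp add: L_def)
      then show ?thesis by auto
    qed
    obtain z where z: "z \<in> L" "F (exp (2 * of_real pi * \<i> * z)) = G (exp (2 * of_real pi * \<i> * z))"
      using eventually_happens[OF ev] nb by blast
    have "- ln d / (2 * pi) < Im z" using z(1) by (auto simp: L_def M_def)
    then have "- (2 * pi * Im z) < ln d" by (simp add: field_simps; linarith)
    then have "exp (- (2 * pi * Im z)) < d" using d(1) by (metis exp_less_mono exp_ln)
    then have "norm (exp (2 * of_real pi * \<i> * z)) < d" by simp
    then show False using d(2) z(2) by metis
  qed
qed (use F in blast)

lemma mset_cong_iff:
  "mset_cong A B m \<longleftrightarrow> image_mset (\<lambda>x. x rmod m) A = image_mset (\<lambda>x. x rmod m) B"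
proof -
  have "mset_cong A B m \<longleftrightarrow> rel_mset (=) (image_mset (\<lambda>x. x rmod m) A) (image_mset (\<lambda>x. x rmod m) B)"
    unfolding mset_cong_def multiset.rel_map by (simp add: rcong_def)
  then show ?thesis by (simp add: multiset.rel_eq)
qed

lemma rmod_of_int:
  assumes "m > 0"
  shows "real_of_int a rmod real_of_int m = real_of_int (a mod m)"
proof -
  have "real_of_int (a mod m) rmod real_of_int m = real_of_int (a mod m)"
    using assms by (intro rmod_idem) (auto simp: pos_mod_bound)
  moreover have "[real_of_int a = real_of_int (a mod m)] (rmod real_of_int m)"
  proof -
    have "real_of_int a = real_of_int (a mod m) + real_of_int (a div m) * real_of_int m"
      by (metis mod_div_mult_eq of_int_add of_int_mult)
    then have "[real_of_int (a mod m) = real_of_int a] (rmod real_of_int m)" unfolding rcong_altdef by blast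
    then show ?thesis by (rule rcong_sym)
  qed
  ultimately show ?thesis by (simp add: rcong_def)
qed

lemma mset_cong_int:
  assumes "m > 0"
  shows "mset_cong {#real_of_int a, real_of_int b, real_of_int c#} {#real_of_int d, real_of_int e, real_of_int f#} (real_of_int m)
    \<longleftrightarrow> {#a mod m, b mod m, c mod m#} = {#d mod m, e mod m, f mod m#}"
proof -
  have "mset_cong {#real_of_int a, real_of_int b, real_of_int c#} {#real_of_int d, real_of_int e, real_of_int f#} (real_of_int m)
    \<longleftrightarrow> image_mset real_of_int {#a mod m, b mod m, c mod m#} = image_mset real_of_int {#d mod m, e mod m, f mod m#}"
    unfolding mset_cong_iff by (simp add: rmod_of_int[OF assms])
  also have "\<dots> \<longleftrightarrow> {#a mod m, b mod m, c mod m#} = {#d mod m, e mod m, f mod m#}"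
  proof
    assume "image_mset real_of_int {#a mod m, b mod m, c mod m#} = image_mset real_of_int {#d mod m, e mod m, f mod m#}"
    then have "image_mset floor (image_mset real_of_int {#a mod m, b mod m, c mod m#})
        = image_mset floor (image_mset real_of_int {#d mod m, e mod m, f mod m#})" by (rule arg_cong)
    then show "{#a mod m, b mod m, c mod m#} = {#d mod m, e mod m, f mod m#}" by simp
  qed simp
  finally show ?thesis .
qed

text \<open>Vieta's formula for the coefficient \<open>-3\<close> of \<open>\<kappa>\<^sup>2\<close>, by divided differences of the indicial polynomial.\<close>

lemma exponent_sum:
  assumes "local_exponents Q2 Q3 z0 k1 k2 k3" "k1 < k2" "k2 < k3"
  shows "k1 + k2 + k3 = 3"
proof -
  define a where "a = 2 + polar_coeff 2 Q2 z0"
  define b where "b = polar_coeff 3 Q3 z0"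
  have root: "of_real k ^ 3 + (- 3) * of_real k ^ 2 + a * of_real k + b = 0" if "k \<in> {k1, k2, k3}" for k
    using ordered_roots_roots[OF assms(1)[unfolded local_exponents_def], of "of_real k"] that
    unfolding poly_indicial a_def b_def by auto
  define K1 K2 K3 where "K1 = complex_of_real k1" and "K2 = complex_of_real k2" and "K3 = complex_of_real k3"
  have r: "K1 ^ 3 + (- 3) * K1 ^ 2 + a * K1 + b = 0" "K2 ^ 3 + (- 3) * K2 ^ 2 + a * K2 + b = 0"
     "K3 ^ 3 + (- 3) * K3 ^ 2 + a * K3 + b = 0"
    using root unfolding K1_def K2_def K3_def by auto
  have d: "K1 - K2 \<noteq> 0" "K1 - K3 \<noteq> 0" "K2 - K3 \<noteq> 0" using assms(2,3) by (auto simp: K1_def K2_def K3_def)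
  have "(K1 - K2) * (K1 ^ 2 + K1 * K2 + K2 ^ 2 - 3 * (K1 + K2) + a)
      = (K1 ^ 3 + (- 3) * K1 ^ 2 + a * K1 + b) - (K2 ^ 3 + (- 3) * K2 ^ 2 + a * K2 + b)"
    by (simp add: algebra_simps power2_eq_square power3_eq_cube)
  then have e1: "K1 ^ 2 + K1 * K2 + K2 ^ 2 - 3 * (K1 + K2) + a = 0" unfolding r using d by simp
  have "(K1 - K3) * (K1 ^ 2 + K1 * K3 + K3 ^ 2 - 3 * (K1 + K3) + a)
      = (K1 ^ 3 + (- 3) * K1 ^ 2 + a * K1 + b) - (K3 ^ 3 + (- 3) * K3 ^ 2 + a * K3 + b)"
    by (simp add: algebra_simps power2_eq_square power3_eq_cube)
  then have e2: "K1 ^ 2 + K1 * K3 + K3 ^ 2 - 3 * (K1 + K3) + a = 0" unfolding r using d by simp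
  have "(K2 - K3) * (K1 + K2 + K3 - 3)
      = (K1 ^ 2 + K1 * K2 + K2 ^ 2 - 3 * (K1 + K2) + a) - (K1 ^ 2 + K1 * K3 + K3 ^ 2 - 3 * (K1 + K3) + a)"
    by (simp add: algebra_simps power2_eq_square)
  then have "K1 + K2 + K3 - 3 = 0" unfolding e1 e2 using d by simp
  then have "complex_of_real (k1 + k2 + k3 - 3) = 0" by (simp add: K1_def K2_def K3_def)
  then show ?thesis unfolding of_real_eq_0_iff by simp
qed

text \<open>With \<open>n = 3 i1\<close>, the sum of the exponents gives \<open>n + m2 + m3 = 3\<close>, so \<open>3 i1\<close>, \<open>3 i2\<close>, \<open>3 i3\<close> are
  integers with an odd sum: all three are odd, or exactly one is.\<close>

lemma parity_criterion:
  assumes "3 * i1 = of_int n" "i2 = i1 + real m2" "i3 = i1 + real m3" "i1 + i2 + i3 = 3"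
  shows "mset_cong {#3 * i1, 3 * i2, 3 * i3#} {#0, 0, 1#} 2 \<longleftrightarrow> \<not> (even m2 \<and> even m3)"
proof -
  have "3 * i2 = of_int (n + 3 * int m2)" "3 * i3 = of_int (n + 3 * int m3)" using assms(1-3) by simp_all
  then have "mset_cong {#3 * i1, 3 * i2, 3 * i3#} {#0, 0, 1#} 2 \<longleftrightarrow>
      {#n mod 2, (n + 3 * int m2) mod 2, (n + 3 * int m3) mod 2#} = {#0, 0, 1#}"
    using mset_cong_int[of 2 n "n + 3 * int m2" "n + 3 * int m3" 0 0 1] assms(1) by simp
  moreover have s: "n + int m2 + int m3 = 3"
  proof -
    have "real_of_int (n + int m2 + int m3) = real_of_int 3" using assms by simp
    then show ?thesis by (simp only: of_int_eq_iff)
  qed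
  moreover have "{#n mod 2, (n + 3 * int m2) mod 2, (n + 3 * int m3) mod 2#} = {#0, 0, 1#} \<longleftrightarrow> \<not> (even m2 \<and> even m3)"
  proof (cases "even m2")
    case True
    then obtain a where a: "m2 = 2 * a" by blast
    show ?thesis
    proof (cases "even m3")
      case True
      then obtain b where b: "m3 = 2 * b" by blast
      have "n mod 2 = 1" "(n + 3 * int m2) mod 2 = 1" "(n + 3 * int m3) mod 2 = 1" using s a b by presburger+
      then show ?thesis using a b by (auto dest!: arg_cong[where f = "\<lambda>M. count M (0::int)"])
    next
      case False
      then obtain b where b: "m3 = 2 * b + 1" using oddE by blast
      have "n mod 2 = 0" "(n + 3 * int m2) mod 2 = 0" "(n + 3 * int m3) mod 2 = 1" using s a b by presburger+
      then show ?thesis using a b by simp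
    qed
  next
    case False
    then obtain a where a: "m2 = 2 * a + 1" using oddE by blast
    show ?thesis
    proof (cases "even m3")
      case True
      then obtain b where b: "m3 = 2 * b" by blast
      have "n mod 2 = 0" "(n + 3 * int m2) mod 2 = 1" "(n + 3 * int m3) mod 2 = 0" using s a b by presburger+
      then show ?thesis using a b by (simp add: add_mset_commute)
    next
      case False
      then obtain b where b: "m3 = 2 * b + 1" using oddE by blast
      have "n mod 2 = 1" "(n + 3 * int m2) mod 2 = 0" "(n + 3 * int m3) mod 2 = 0" using s a b by presburger+
      then show ?thesis using a b by (simp add: add_mset_commute)
    qed
  qed
  ultimately show ?thesis by simp
qed

text \<open>The sum of the exponents makes \<open>m2 + m3\<close> divisible by \<open>3\<close>, so the three exponents are either all
  congruent or pairwise incongruent modulo \<open>3\<close>.\<close>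

lemma mod3_criterion:
  assumes "r1 = of_int n" "r2 = r1 + real m2" "r3 = r1 + real m3" "r1 + r2 + r3 = 3"
  shows "mset_cong {#r1, r2, r3#} {#0, 1, 2#} 3 \<longleftrightarrow> \<not> (3 dvd m2 \<and> 3 dvd m3)"
proof -
  have "r2 = of_int (n + int m2)" "r3 = of_int (n + int m3)" using assms(1-3) by simp_all
  then have "mset_cong {#r1, r2, r3#} {#0, 1, 2#} 3 \<longleftrightarrow>
      {#n mod 3, (n + int m2) mod 3, (n + int m3) mod 3#} = {#0, 1, 2#}"
    using mset_cong_int[of 3 n "n + int m2" "n + int m3" 0 1 2] assms(1) by simp
  moreover have s: "3 * n + int m2 + int m3 = 3"
  proof -
    have "real_of_int (3 * n + int m2 + int m3) = real_of_int 3" using assms by simp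
    then show ?thesis by (simp only: of_int_eq_iff)
  qed
  moreover have "{#n mod 3, (n + int m2) mod 3, (n + int m3) mod 3#} = {#0, 1, 2#} \<longleftrightarrow> \<not> (3 dvd m2 \<and> 3 dvd m3)"
  proof -
    have "m2 mod 3 = 0 \<and> m3 mod 3 = 0 \<or> m2 mod 3 = 1 \<and> m3 mod 3 = 2 \<or> m2 mod 3 = 2 \<and> m3 mod 3 = 1"
    proof -
      have "(m2 + m3) mod 3 = 0" using s by presburger
      then show ?thesis by presburger
    qed
    moreover have "n mod 3 = 0 \<or> n mod 3 = 1 \<or> n mod 3 = 2" by presburger
    moreover have e: "(n + int m2) mod 3 = (n mod 3 + int (m2 mod 3)) mod 3" "(n + int m3) mod 3 = (n mod 3 + int (m3 mod 3)) mod 3"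
      by (simp_all only: zmod_int mod_add_eq of_nat_numeral)
    moreover have "{#0, 0, 0#} \<noteq> {#0, 1, 2::int#}" "{#1, 1, 1#} \<noteq> {#0, 1, 2::int#}" "{#2, 2, 2#} \<noteq> {#0, 1, 2::int#}"
      "{#0, 2, 1#} = {#0, 1, 2::int#}" "{#1, 2, 0#} = {#0, 1, 2::int#}" "{#1, 0, 2#} = {#0, 1, 2::int#}"
      "{#2, 0, 1#} = {#0, 1, 2::int#}" "{#2, 1, 0#} = {#0, 1, 2::int#}"
      by (auto simp: multiset_eq_iff dest: spec[of _ 0])
    ultimately show ?thesis
      unfolding e dvd_eq_mod_eq_0 by (elim disjE conjE) (simp_all del: add_mset_eq_singleton_iff)
  qed
  ultimately show ?thesis by simp
qed

section \<open>Comparison of the two elliptic points\<close>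

context scalar_equation
begin

text \<open>If the substitution fixing \<open>p\<close> acts by scalars, the ratio of its multipliers on any section is \<open>1\<close>.
  At the cusp the ratios at \<open>p\<close> and \<open>p'\<close> coincide, so each pair of eigenvectors at \<open>p'\<close> has equal
  eigenvalues. The roles of \<open>p\<close> and \<open>p'\<close> can be exchanged.\<close>

lemma elliptic_points_agree:
  assumes S: "elliptic_point Q2 Q3 p r B2 B3 k m2 m3 n 0 N" "ball p r \<subseteq> Hp" "ball p r \<inter> X \<subseteq> {p}" "p \<in> X"
    and R: "elliptic_point Q2 Q3 p' r' B2' B3' k' m2' m3' n' 1 N'" "ball p' r' \<subseteq> Hp" "ball p' r' \<inter> X \<subseteq> {p'}" "p' \<in> X"
    and \<zeta>: "\<zeta> = 1 / (p + 0) ^ 2" "\<zeta> ^ N = 1" and \<zeta>': "\<zeta>' = 1 / (p' + 1) ^ 2" "\<zeta>' ^ N' = 1"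
    and cF: "F2 holomorphic_on ball 0 (exp c)" "F3 holomorphic_on ball 0 (exp c)"
    and cQ: "\<And>z. 2 * of_real pi * \<i> * z \<in> half_plane c \<Longrightarrow> z \<in> Hp - X \<Longrightarrow>
        Q2 z = F2 (exp (2 * of_real pi * \<i> * z)) \<and> Q3 z = F3 (exp (2 * of_real pi * \<i> * z))"
    and c: "c < 0"
    and roots: "\<And>\<kappa>. \<kappa> ^ 3 + ((2 * of_real pi * \<i>) powi (-2) * F2 0) * \<kappa>
        + (2 * of_real pi * \<i>) powi (-3) * F3 0 = 0 \<Longrightarrow> exp (2 * of_real pi * \<i> * \<kappa>) = \<mu>"
  shows "\<zeta> ^ m2 = 1 \<and> \<zeta> ^ m3 = 1 \<longleftrightarrow> \<zeta>' ^ m2' = 1 \<and> \<zeta>' ^ m3' = 1"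
proof -
  have N: "N > 0" "N' > 0"
    using S(1) R(1) unfolding elliptic_point_def elliptic_point_axioms_def by blast+
  have nz: "\<zeta> \<noteq> 0" "\<zeta>' \<noteq> 0" using \<zeta>(2) \<zeta>'(2) N by (auto simp: power_0_left)
  have pH: "p \<in> Hp" "p' \<in> Hp" using S(4) R(4) X by auto
  have 1: "\<zeta>' ^ m = 1" if sc: "\<zeta> ^ m2 = 1" "\<zeta> ^ m3 = 1" and m: "m \<in> {0, m2', m3'}" for m
  proof -
    obtain F C z1 where F: "sec Hp F" "z1 \<in> Hp - X" "fst (F z1) \<noteq> 0" "snd (F z1) \<noteq> 0" "C \<noteq> 0"
      and l: "eventually (\<lambda>z. (z + 1) ^ 6 * fst (F (- 1 / (z + 1))) = C * fst (F z)) (at p')"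
        "eventually (\<lambda>z. (z + 1) ^ 6 * snd (F (- 1 / (z + 1))) = C * \<zeta>' ^ m * snd (F z)) (at p')"
      by (rule section_from_eigen_germs[OF R \<zeta>' m], rule that; assumption)
    obtain C' where C': "C' \<noteq> 0"
      and l': "eventually (\<lambda>z. (z + 0) ^ 6 * fst (F (- 1 / (z + 0))) = C' * fst (F z)) (at p)"
        "eventually (\<lambda>z. (z + 0) ^ 6 * snd (F (- 1 / (z + 0))) = C' * snd (F z)) (at p)"
      by (rule multipliers_at_scalar_point[OF S \<zeta>(1) sc F(1)], rule that; assumption)
    have "C / C' = C * \<zeta>' ^ m / C'"
      by (rule multiplier_ratio[OF F(1,2,3,2,4) pH l' l C' C' F(5) cF cQ c roots])
    then show ?thesis using F(5) C' by simp
  qed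
  have 2: "\<zeta> ^ m = 1" if sc: "\<zeta>' ^ m2' = 1" "\<zeta>' ^ m3' = 1" and m: "m \<in> {0, m2, m3}" for m
  proof -
    obtain F C z1 where F: "sec Hp F" "z1 \<in> Hp - X" "fst (F z1) \<noteq> 0" "snd (F z1) \<noteq> 0" "C \<noteq> 0"
      and l: "eventually (\<lambda>z. (z + 0) ^ 6 * fst (F (- 1 / (z + 0))) = C * fst (F z)) (at p)"
        "eventually (\<lambda>z. (z + 0) ^ 6 * snd (F (- 1 / (z + 0))) = C * \<zeta> ^ m * snd (F z)) (at p)"
      by (rule section_from_eigen_germs[OF S \<zeta> m], rule that; assumption)
    obtain C' where C': "C' \<noteq> 0"
      and l': "eventually (\<lambda>z. (z + 1) ^ 6 * fst (F (- 1 / (z + 1))) = C' * fst (F z)) (at p')"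
        "eventually (\<lambda>z. (z + 1) ^ 6 * snd (F (- 1 / (z + 1))) = C' * snd (F z)) (at p')"
      by (rule multipliers_at_scalar_point[OF R \<zeta>'(1) sc F(1)], rule that; assumption)
    have Cz: "C * \<zeta> ^ m \<noteq> 0" using F(5) nz by simp
    have "C' / C = C' / (C * \<zeta> ^ m)"
      by (rule multiplier_ratio[OF F(1,2,3,2,4) pH l l' F(5) Cz C' cF cQ c roots])
    then show ?thesis using F(5) C' nz by (simp add: field_simps)
  qed
  show ?thesis using 1 2 by blast
qed

end

lemma rho_square: "rho ^ 2 + rho + 1 = 0"
  by (simp add: rho_def complex_eq_iff power2_eq_square)

lemma rho_upper: "rho \<in> upper_half_plane" "\<i> \<in> upper_half_plane"
  by (simp_all add: rho_def upper_half_plane_def)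

lemma rho_plus_1: "rho + 1 \<noteq> 0" "rho = - 1 / (rho + 1)" "(rho + 1) ^ 3 = - 1" "(rho + 1) ^ 2 = rho"
proof -
  have m: "rho * (rho + 1) = - 1" using rho_square
    by (simp add: distrib_left power2_eq_square eq_neg_iff_add_eq_0)
  then show nz: "rho + 1 \<noteq> 0" by auto
  show "rho = - 1 / (rho + 1)" by (rule nonzero_eq_divide_eq[OF nz, THEN iffD2, OF m])
  have "(rho + 1) ^ 2 = (rho ^ 2 + rho + 1) + rho" by (simp add: power2_eq_square algebra_simps)
  then show sq: "(rho + 1) ^ 2 = rho" using rho_square by simp
  have "(rho + 1) ^ 3 = (rho + 1) ^ 2 * (rho + 1)" by (simp add: power3_eq_cube power2_eq_square)
  then show "(rho + 1) ^ 3 = - 1" unfolding sq m .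
qed

lemma cube_root_power_eq_1: "w ^ 3 = 1 \<Longrightarrow> w \<noteq> 1 \<Longrightarrow> w ^ m = 1 \<longleftrightarrow> 3 dvd m" for w :: complex
proof -
  assume w: "w ^ 3 = 1" "w \<noteq> 1"
  have "w ^ m = (w ^ 3) ^ (m div 3) * w ^ (m mod 3)"
    by (metis mult_div_mod_eq power_add power_mult)
  then have e: "w ^ m = w ^ (m mod 3)" using w(1) by simp
  have w2: "w ^ 2 \<noteq> 1"
  proof
    assume "w ^ 2 = 1"
    then have "w ^ 3 = w" by (simp add: power3_eq_cube power2_eq_square)
    then show False using w by simp
  qed
  have "m mod 3 = 0 \<or> m mod 3 = 1 \<or> m mod 3 = 2" by presburger
  then show ?thesis using e w w2 by (elim disjE) (simp_all add: dvd_eq_mod_eq_0)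
qed

text \<open>The substitution \<open>-1 / z\<close> has order \<open>2\<close>.\<close>

lemma cocycle_i:
  "eventually (\<lambda>x. ((\<lambda>x. x / ((\<i> + 0) * (\<i> + 0 + x))) ^^ 2) x = x \<and>
     (\<Prod>i<2. (\<i> + 0) / (\<i> + 0 + ((\<lambda>x. x / ((\<i> + 0) * (\<i> + 0 + x))) ^^ i) x)) = 1) (nhds 0)"
proof -
  have "eventually (\<lambda>x. x \<in> ball 0 1) (nhds (0::complex))" by (rule eventually_nhds_in_open) auto
  then show ?thesis
  proof eventually_elim
    case (elim x)
    have w: "\<i> + x \<noteq> 0"
    proof
      assume "\<i> + x = 0"
      then have "x = - \<i>" by (simp add: eq_neg_iff_add_eq_0 add.commute)
      then show False using elim by simp
    qed
    have g: "\<i> + x / (\<i> * (\<i> + x)) = - 1 / (\<i> + x)"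
    proof -
      have "\<i> + x / (\<i> * (\<i> + x)) = (\<i> * (\<i> * (\<i> + x)) + x) / (\<i> * (\<i> + x))"
        by (rule add_divide_eq_iff) (use w in simp)
      also have "\<i> * (\<i> * (\<i> + x)) + x = \<i> * (- 1)" by (simp add: algebra_simps)
      also have "\<i> * (- 1) / (\<i> * (\<i> + x)) = - 1 / (\<i> + x)" by (rule mult_divide_mult_cancel_left) simp
      finally show ?thesis .
    qed
    have "x / (\<i> * y) / (\<i> * (- 1 / y)) = x" "\<i> / y * (\<i> / (- 1 / y)) = 1" if "y \<noteq> 0" for y
      using that by simp_all
    note this[OF w]
    then have "x / (\<i> * (\<i> + x)) / (\<i> * (\<i> + x / (\<i> * (\<i> + x)))) = x"
      "\<i> / (\<i> + x) * (\<i> / (\<i> + x / (\<i> * (\<i> + x)))) = 1"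
      unfolding g .
    then show ?case by (simp add: numeral_2_eq_2)
  qed
qed

text \<open>The substitution \<open>-1 / (z + 1)\<close> has order \<open>3\<close>; with \<open>w = z + 1\<close> it permutes \<open>w\<close>, \<open>1 - 1 / w\<close> and
  \<open>-1 / (w - 1)\<close> cyclically.\<close>

lemma cocycle_rho:
  "eventually (\<lambda>x. ((\<lambda>x. x / ((rho + 1) * (rho + 1 + x))) ^^ 3) x = x \<and>
     (\<Prod>i<3. (rho + 1) / (rho + 1 + ((\<lambda>x. x / ((rho + 1) * (rho + 1 + x))) ^^ i) x)) = 1) (nhds 0)"
proof -
  define j where "j = rho + 1"
  define g where "g = (\<lambda>x. x / (j * (j + x)))"
  have j: "j \<noteq> 0" "j ^ 3 = - 1" "j ^ 2 = rho" using rho_plus_1 by (simp_all add: j_def)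
  have jj: "j * j = j - 1" using j(3) by (simp add: power2_eq_square j_def)
  have "rho \<noteq> 0" using rho_upper by (auto simp: upper_half_plane_def)
  then have j1: "j - 1 \<noteq> 0" by (simp add: j_def)
  have step: "j + g x = (j + x - 1) / (j + x)" if "j + x \<noteq> 0" for x
  proof -
    have "j + g x = (j * j * (j + x) + x) / (j * (j + x))" using that j by (simp add: g_def add_divide_distrib)
    also have "j * j * (j + x) + x = j * (j + x - 1)" unfolding jj
      using jj by (simp add: algebra_simps)
    finally show ?thesis using j by simp
  qed
  have o: "open (- {- j, 1 - j})" by (simp add: finite_imp_closed open_Compl)
  have "eventually (\<lambda>x. x \<in> - {- j, 1 - j}) (nhds 0)"
    by (rule eventually_nhds_in_open[OF o]) (use j(1) j1 in auto)
  then have "eventually (\<lambda>x. (g ^^ 3) x = x \<and> (\<Prod>i<3. j / (j + (g ^^ i) x)) = 1) (nhds 0)"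
  proof eventually_elim
    case (elim x)
    define w where "w = j + x"
    have w: "w \<noteq> 0" "w - 1 \<noteq> 0"
      using elim by (auto simp: w_def add_eq_0_iff2 algebra_simps add.commute)
    have s1: "j + g x = (w - 1) / w" using step[of x] w by (simp add: w_def)
    then have n1: "j + g x \<noteq> 0" using w by simp
    have s2: "j + g (g x) = - 1 / (w - 1)"
      unfolding step[OF n1] s1 using w by (simp add: divide_simps)
    then have n2: "j + g (g x) \<noteq> 0" using w by simp
    have s3: "j + g (g (g x)) = w"
      unfolding step[OF n2] s2 using w by (simp add: divide_simps)
    then have "g (g (g x)) = x" by (simp add: w_def)
    moreover have "j / (j + x) * (j / (j + g x)) * (j / (j + g (g x))) = 1"
    proof -
      have "j / w * (j / ((w - 1) / w)) * (j / (- 1 / (w - 1))) = - (j ^ 3)"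
        using w by (simp add: power3_eq_cube)
      then show ?thesis unfolding s1 s2 using j(2) by (simp add: w_def)
    qed
    ultimately show ?case by (simp add: numeral_3_eq_3)
  qed
  then show ?thesis by (simp add: g_def j_def)
qed

text \<open>The matrix has the rows \<open>(0, -1)\<close> and \<open>(1, t)\<close>.\<close>

lemma modular_law:
  assumes "meromorphic_modular_form k f" "z0 \<in> upper_half_plane" "t \<in> {0, 1}"
  shows "eventually (\<lambda>z. f (- 1 / (z + t)) = (z + t) powi k * f z) (at z0)"
proof -
  obtain d :: int where d: "t = of_int d" using assms(3) by (metis Ints_0 Ints_1 Ints_cases empty_iff insert_iff)
  have "0 * d - (- 1) * 1 = (1::int)" by simp
  then have "\<forall>\<^sub>\<approx>z\<in>upper_half_plane. f ((of_int 0 * z + of_int (- 1)) / (of_int 1 * z + of_int d)) =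
      (of_int 1 * z + of_int d) powi k * f z"
    using assms(1) unfolding meromorphic_modular_form_def by blast
  from eventually_cosparse_imp_eventually_at[OF this assms(2)] show ?thesis by (simp add: d)
qed

text \<open>The expansion holds off a sparse set, and by continuity at every point where \<open>f\<close> is holomorphic.\<close>

lemma cusp_expansion:
  assumes "holomorphic_at_cusp f"
  obtains F e Y where "e > 0" "F holomorphic_on ball 0 e" "cusp_value f = F 0"
    "\<And>z. Im z > Y \<Longrightarrow> f analytic_on {z} \<Longrightarrow> norm (exp (2 * of_real pi * \<i> * z)) < e \<Longrightarrow>
        f z = F (exp (2 * of_real pi * \<i> * z))"
proof -
  obtain F where F: "F analytic_on {0}" "q_function f F" using assms unfolding holomorphic_at_cusp_def by blast
  obtain Y where Y: "\<forall>\<^sub>\<approx>z\<in>{z. Im z > Y}. f z = F (exp (2 * of_real pi * \<i> * z))"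
    using F(2) unfolding q_function_def by blast
  obtain e where e: "e > 0" "F holomorphic_on ball 0 e" using F(1) by (auto simp: analytic_on_def)
  show ?thesis
  proof (rule that[OF e cusp_value_eq[OF F]])
    fix z assume z: "Im z > Y" "f analytic_on {z}" "norm (exp (2 * of_real pi * \<i> * z)) < e"
    have "z \<in> {z. Im z > Y}" using z by simp
    from eventually_cosparse_imp_eventually_at[OF Y this]
    have ev: "eventually (\<lambda>z. f z = F (exp (2 * of_real pi * \<i> * z))) (at z)" .
    have "(f \<longlongrightarrow> f z) (at z)" using analytic_at_imp_isCont[OF z(2)] by (simp add: isCont_def)
    then have "((\<lambda>z. F (exp (2 * of_real pi * \<i> * z))) \<longlongrightarrow> f z) (at z)"
      using ev by (rule Lim_transform_eventually)
    moreover have "isCont F (exp (2 * of_real pi * \<i> * z))"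
      using holomorphic_on_imp_continuous_on[OF e(2)] z(3) by (simp add: continuous_on_eq_continuous_at)
    then have "isCont (\<lambda>z. F (exp (2 * of_real pi * \<i> * z))) z"
      by (intro isCont_o2[where g = F and f = "\<lambda>z. exp (2 * of_real pi * \<i> * z)"]) (auto intro!: continuous_intros)
    then have "((\<lambda>z. F (exp (2 * of_real pi * \<i> * z))) \<longlongrightarrow> F (exp (2 * of_real pi * \<i> * z))) (at z)"
      by (simp add: isCont_def)
    ultimately show "f z = F (exp (2 * of_real pi * \<i> * z))" by (rule LIM_unique)
  qed
qed

theorem corollary1p5:
  fixes Q2 Q3 :: "complex \<Rightarrow> complex"
    and i1 i2 i3 r1 r2 r3 :: real
  assumes "MODE Q2 Q3"
    and "H1 Q2 Q3" and "H2 Q2 Q3" and "H3 Q2 Q3"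
    and "local_exponents Q2 Q3 \<i> i1 i2 i3"
    and "local_exponents Q2 Q3 rho r1 r2 r3"
    and "r1 \<in> \<int>"
  shows "mset_cong {#3 * i1, 3 * i2, 3 * i3#} {#0, 0, 1#} 2 \<longleftrightarrow>
         (r1 \<in> \<int> \<and> r2 \<in> \<int> \<and> r3 \<in> \<int> \<and> mset_cong {#r1, r2, r3#} {#0, 1, 2#} 3)"
proof -
  have mm: "meromorphic_modular_form 4 Q2" "meromorphic_modular_form 6 (\<lambda>z. Q3 z - deriv Q2 z / 2)"
    using assms(1) by (auto simp: MODE_def)
  have mer2: "Q2 meromorphic_on upper_half_plane" using mm(1) by (simp add: meromorphic_modular_form_def)
  have "(\<lambda>z. (Q3 z - deriv Q2 z / 2) + deriv Q2 z / 2) meromorphic_on upper_half_plane"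
    using mm(2) meromorphic_on_deriv[OF mer2] unfolding meromorphic_modular_form_def
    by (intro meromorphic_on_add meromorphic_on_divide meromorphic_on_const) blast+
  then have mer3: "Q3 meromorphic_on upper_half_plane" by simp
  define X where "X = {z \<in> upper_half_plane. \<not> (Q2 analytic_on {z} \<and> Q3 analytic_on {z})} \<union> {\<i>, rho}"
  have XH: "X \<subseteq> upper_half_plane" using rho_upper by (auto simp: X_def)
  have "{z \<in> upper_half_plane. \<not> Q2 analytic_on {z}} \<union> {z \<in> upper_half_plane. \<not> Q3 analytic_on {z}} \<union> {\<i>, rho}
      sparse_in upper_half_plane"
    by (intro sparse_in_union' meromorphic_on_imp_sparse_singularities' mer2 mer3 finite_imp_sparse) auto
  then have Xsp: "X sparse_in upper_half_plane"
    by (rule sparse_in_subset2) (auto simp: X_def)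
  have oH: "open upper_half_plane" by (simp add: upper_half_plane_def open_halfspace_Im_gt)
  have charts: "\<exists>r B2 B3 k m2 m3 n. scalar_point Q2 Q3 z0 r B2 B3 k m2 m3 n \<and>
        ball z0 r \<subseteq> upper_half_plane \<and> ball z0 r \<inter> X \<subseteq> {z0} \<and>
        local_exponents Q2 Q3 z0 k (k + real m2) (k + real m3)" if z0: "z0 \<in> upper_half_plane" for z0
  proof -
    obtain r0 where r0: "r0 > 0" "\<And>e. 0 < e \<Longrightarrow> e \<le> r0 \<Longrightarrow> \<exists>B2 B3 k m2 m3 n. scalar_point Q2 Q3 z0 e B2 B3 k m2 m3 n \<and>
        local_exponents Q2 Q3 z0 k (k + real m2) (k + real m3)"
      by (rule chart_exists[OF mer2 mer3 assms(2,3) z0], rule that; assumption)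
    have "eventually (\<lambda>w. w \<notin> X) (at z0)"
      using eventually_cosparse_imp_eventually_at[OF eventually_not_in_cosparse[OF Xsp] z0] .
    then obtain d where d: "d > 0" "\<And>w. w \<noteq> z0 \<Longrightarrow> dist w z0 < d \<Longrightarrow> w \<notin> X"
      unfolding eventually_at by auto
    obtain d' where d': "d' > 0" "ball z0 d' \<subseteq> upper_half_plane" using openE[OF oH z0] by blast
    define e where "e = min r0 (min d d')"
    have e: "0 < e" "e \<le> r0" "e \<le> d" "e \<le> d'" using r0 d d' by (auto simp: e_def)
    have "ball z0 e \<subseteq> upper_half_plane" using d'(2) e(4) subset_ball[of e d' z0] by blast
    moreover have "ball z0 e \<inter> X \<subseteq> {z0}" using d(2) e(3) by (force simp: dist_commute)
    ultimately show ?thesis using r0(2)[OF e(1,2)] by blast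
  qed
  interpret scalar_equation Q2 Q3 X
  proof
    show "\<exists>r B2 B3 k m2 m3 n. scalar_point Q2 Q3 z0 r B2 B3 k m2 m3 n \<and>
        ball z0 r \<subseteq> upper_half_plane \<and> ball z0 r \<inter> X \<subseteq> {z0}" if "z0 \<in> X" for z0
      using charts[of z0] that XH by blast
  qed (use XH Xsp in \<open>auto simp: X_def\<close>)
  obtain ri Bi2 Bi3 ki mi2 mi3 ni where I: "scalar_point Q2 Q3 \<i> ri Bi2 Bi3 ki mi2 mi3 ni"
      "ball \<i> ri \<subseteq> upper_half_plane" "ball \<i> ri \<inter> X \<subseteq> {\<i>}"
      "local_exponents Q2 Q3 \<i> ki (ki + real mi2) (ki + real mi3)"
    using charts[OF rho_upper(2)] by blast
  obtain rr Br2 Br3 kr mr2 mr3 nr where R: "scalar_point Q2 Q3 rho rr Br2 Br3 kr mr2 mr3 nr"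
      "ball rho rr \<subseteq> upper_half_plane" "ball rho rr \<inter> X \<subseteq> {rho}"
      "local_exponents Q2 Q3 rho kr (kr + real mr2) (kr + real mr3)"
    using charts[OF rho_upper(1)] by blast
  have mI: "0 < mi2" "mi2 < mi3" "3 * ki = of_int ni" and mR: "0 < mr2" "mr2 < mr3"
    using I(1) R(1) unfolding scalar_point_def scalar_point_axioms_def by blast+
  have i: "i1 = ki" "i2 = i1 + real mi2" "i3 = i1 + real mi3"
    using ordered_roots_unique assms(5) I(4) unfolding local_exponents_def by blast+
  have r: "r1 = kr" "r2 = r1 + real mr2" "r3 = r1 + real mr3"
    using ordered_roots_unique assms(6) R(4) unfolding local_exponents_def by blast+
  have sums: "i1 + i2 + i3 = 3" "r1 + r2 + r3 = 3"
    using exponent_sum[OF assms(5)] exponent_sum[OF assms(6)] i r mI mR by auto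
  have laws: "eventually (\<lambda>z. Q2 (- 1 / (z + t)) = (z + t) ^ 4 * Q2 z \<and>
      Q3 (- 1 / (z + t)) - deriv Q2 (- 1 / (z + t)) / 2 = (z + t) ^ 6 * (Q3 z - deriv Q2 z / 2)) (at z0)"
    if "z0 \<in> upper_half_plane" "t \<in> {0, 1}" for z0 t
    using modular_law[OF mm(1) that] modular_law[OF mm(2) that] by eventually_elim simp
  have EI: "elliptic_point Q2 Q3 \<i> ri Bi2 Bi3 ki mi2 mi3 ni 0 2"
    unfolding elliptic_point_def elliptic_point_axioms_def
    using I(1) laws[OF rho_upper(2), of 0] cocycle_i by (simp add: divide_i)
  have ER: "elliptic_point Q2 Q3 rho rr Br2 Br3 kr mr2 mr3 nr 1 3"
    unfolding elliptic_point_def elliptic_point_axioms_def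
    using R(1) laws[OF rho_upper(1), of 1] cocycle_rho rho_plus_1(1,2) by simp
  have XI: "\<i> \<in> X" "rho \<in> X" by (auto simp: X_def)
  \<comment> \<open>the equation at the cusp\<close>
  have hc: "holomorphic_at_cusp Q2" "holomorphic_at_cusp Q3" using assms(2) by (auto simp: H1_def)
  obtain F2 e2 Y2 where F2: "e2 > 0" "F2 holomorphic_on ball 0 e2" "cusp_value Q2 = F2 0"
    "\<And>z. Im z > Y2 \<Longrightarrow> Q2 analytic_on {z} \<Longrightarrow> norm (exp (2 * of_real pi * \<i> * z)) < e2 \<Longrightarrow>
        Q2 z = F2 (exp (2 * of_real pi * \<i> * z))"
    by (rule cusp_expansion[OF hc(1)], rule that; assumption)
  obtain F3 e3 Y3 where F3: "e3 > 0" "F3 holomorphic_on ball 0 e3" "cusp_value Q3 = F3 0"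
    "\<And>z. Im z > Y3 \<Longrightarrow> Q3 analytic_on {z} \<Longrightarrow> norm (exp (2 * of_real pi * \<i> * z)) < e3 \<Longrightarrow>
        Q3 z = F3 (exp (2 * of_real pi * \<i> * z))"
    by (rule cusp_expansion[OF hc(2)], rule that; assumption)
  define c where "c = min (min (ln e2) (ln e3)) (min (- 1) (min (- 2 * pi * Y2) (- 2 * pi * Y3)))"
  have c: "c < 0" "c \<le> ln e2" "c \<le> ln e3" "c \<le> - 2 * pi * Y2" "c \<le> - 2 * pi * Y3" by (auto simp: c_def)
  have ec: "exp c \<le> e2" "exp c \<le> e3" using c(2,3) F2(1) F3(1) by (metis exp_le_cancel_iff exp_ln)+
  have cF: "F2 holomorphic_on ball 0 (exp c)" "F3 holomorphic_on ball 0 (exp c)"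
    using F2(2) F3(2) ec by (auto elim!: holomorphic_on_subset intro: subset_ball)
  have cQ: "Q2 z = F2 (exp (2 * of_real pi * \<i> * z)) \<and> Q3 z = F3 (exp (2 * of_real pi * \<i> * z))"
    if "2 * of_real pi * \<i> * z \<in> half_plane c" "z \<in> Hp - X" for z
  proof -
    have im: "- (2 * pi * Im z) < c" using that(1) by (simp add: half_plane_def)
    then have "2 * pi * Y2 < 2 * pi * Im z" "2 * pi * Y3 < 2 * pi * Im z" using c(4,5) by linarith+
    then have Y: "Im z > Y2" "Im z > Y3" by simp_all
    have "norm (exp (2 * of_real pi * \<i> * z)) < exp c" using im by simp
    then show ?thesis using F2(4)[OF Y(1)] F3(4)[OF Y(2)] regular[OF that(2)] ec by linarith
  qed
  obtain k1 k2 k3 where k: "cusp_exponents Q2 Q3 k1 k2 k3" "k2 - k1 \<in> \<int>" "k3 - k1 \<in> \<int>"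
    using assms(4) unfolding H3_def by blast
  have roots: "exp (2 * of_real pi * \<i> * \<kappa>) = exp (2 * of_real pi * \<i> * of_real k1)"
    if "\<kappa> ^ 3 + ((2 * of_real pi * \<i>) powi (-2) * F2 0) * \<kappa> + (2 * of_real pi * \<i>) powi (-3) * F3 0 = 0" for \<kappa>
  proof -
    have "poly (cusp_indicial_poly Q2 Q3) \<kappa> = 0" using that unfolding poly_cusp_indicial F2(3) F3(3) .
    then have "\<kappa> \<in> {of_real k1, of_real k2, of_real k3}"
      using ordered_roots_roots k(1) unfolding cusp_exponents_def by blast
    then obtain k' where k': "\<kappa> = of_real k'" "k' - k1 \<in> \<int>" using k(2,3) by auto
    then obtain j where "k' = k1 + of_int j" by (metis Ints_cases add.commute diff_add_cancel)
    then have "exp (2 * of_real pi * \<i> * \<kappa>) = exp (2 * of_real pi * \<i> * of_real k1) * exp ((2 * of_int j * of_real pi) * \<i>)"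
      using k'(1) by (simp add: distrib_left exp_add mult_ac)
    then show ?thesis using exp_integer_2pi[of "of_int j"] by simp
  qed
  define \<zeta> where "\<zeta> = 1 / (\<i> + 0) ^ 2"
  define \<zeta>' where "\<zeta>' = 1 / (rho + 1) ^ 2"
  have zi: "\<zeta> = - 1" by (simp add: \<zeta>_def)
  have z3: "\<zeta>' ^ 3 = 1" "\<zeta>' \<noteq> 1"
  proof -
    have "\<zeta>' ^ 3 = 1 / ((rho + 1) ^ 3) ^ 2" by (simp add: \<zeta>'_def power_one_over power_mult[symmetric])
    then show "\<zeta>' ^ 3 = 1" by (simp add: rho_plus_1(3))
    show "\<zeta>' \<noteq> 1" using rho_upper(1) by (auto simp: \<zeta>'_def rho_plus_1(4) upper_half_plane_def)
  qed
  have "\<zeta> ^ mi2 = 1 \<and> \<zeta> ^ mi3 = 1 \<longleftrightarrow> \<zeta>' ^ mr2 = 1 \<and> \<zeta>' ^ mr3 = 1"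
    by (rule elliptic_points_agree[OF EI I(2,3) XI(1) ER R(2,3) XI(2) \<zeta>_def _ \<zeta>'_def z3(1) cF cQ c(1) roots])
       (simp_all add: zi)
  moreover have "\<zeta> ^ m = 1 \<longleftrightarrow> even m" for m unfolding zi by (cases "even m") auto
  ultimately have main: "even mi2 \<and> even mi3 \<longleftrightarrow> 3 dvd mr2 \<and> 3 dvd mr3"
    using cube_root_power_eq_1[OF z3] by simp
  obtain n where n: "r1 = of_int n" using assms(7) by (auto elim: Ints_cases)
  have "r2 \<in> \<int>" "r3 \<in> \<int>" using r assms(7) by auto
  moreover have "mset_cong {#3 * i1, 3 * i2, 3 * i3#} {#0, 0, 1#} 2 \<longleftrightarrow> \<not> (even mi2 \<and> even mi3)"
    by (rule parity_criterion[OF _ i(2,3) sums(1)]) (use mI(3) i(1) in simp)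
  moreover have "mset_cong {#r1, r2, r3#} {#0, 1, 2#} 3 \<longleftrightarrow> \<not> (3 dvd mr2 \<and> 3 dvd mr3)"
    by (rule mod3_criterion[OF n r(2,3) sums(2)])
  ultimately show ?thesis using main assms(7) by simp
qed

end
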